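(* Let $G$ be a metric graph. Then $$\mathcal{L}_2(G)=\lambda_1^{\min}(G).$$ Moreover, if $\mu$ is a Borel probability measure on $G$ with $\lambda_1(H_\mu)=\lambda_1^{\min}(G)$ and $f$ is an eigenfunction of $H_\mu$ for $\lambda_1(H_\mu)$, then the nodal domains $$N^+=\overline{\{x\in G: f(x)>0\}},\qquad N^-=\overline{\{x\in G: f(x)<0\}}$$ together with the weights $\omega_+=\omega_-=\frac12$ form a minimizing $2$-partition for $\mathcal{L}_2(G)$, that is, $\mathcal{P}=\{(N^+,\frac12),(N^-,\frac12)\}$ is a weighted $2$-partition of $G$ with $\Lambda(\mathcal{P})=\mathcal{L}_2(G)$.
   Context: A metric graph $G=(V,E,\ell)$ is given by a finite connected graph $(V,E)$ with at least one edge (loops and multiple edges allowed) and edge lengths $\ell:E\to(0,\infty)$: each edge $e$ is (after choosing an orientation) identified with the interval $[0,\ell(e)]$, and $G$ is the compact topological space obtained by gluing endpoints of edges corresponding to the same vertex. $dx$ is the Lebesgue measure on $G$. $H^1(G)$ is the space of continuous $f:G\to\mathbb{R}$ whose restriction to every open edge lies in $H^1((0,\ell(e)))$; $q(f,g)=\int_G f'g'\,dx$, $q(f)=q(f,f)$. A function $f\in H^1(G)$ is harmonic on an open set $O\subset G$ if $q(f,g)=0$ for all $g\in H^1(G)$ with $g\equiv 0$ on $G\setminus O$. Laplacian $H_\mu$: for a Borel probability measure $\mu$ on $G$, let $H^1(G,\mu)=\{f\in H^1(G): f \text{ harmonic on } G\setminus\operatorname{supp}\mu\}$, regarded (injectively)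 as a dense subspace of $L^2(G,\mu)$. $H_\mu$ is the non-negative self-adjoint operator in $L^2(G,\mu)$ associated with the closed form $q|_{H^1(G,\mu)}$: $f\in\operatorname{dom}(H_\mu)$ and $H_\mu f=g$ iff $f\in H^1(G,\mu)$ and $q(f,\varphi)=\int_G g\varphi\,d\mu$ for all $\varphi\in H^1(G,\mu)$. Its spectrum is discrete; its eigenvalues, counted with multiplicity, are $0=\lambda_0(H_\mu)<\lambda_1(H_\mu)\le\cdots$, with $\lambda_k(H_\mu):=+\infty$ for $k\ge\dim L^2(G,\mu)$. Eigenfunctions are elements of $H^1(G,\mu)$, hence continuous functions on all of $G$. Let $\lambda_k^{\min}(G):=\min_{\mu}\lambda_k(H_\mu)$ over all Borel probability measures $\mu$ on $G$ (attained). Dirichlet variant: for a metric graph $G'$ and a closed nonempty subset $A\subset G'$, let $H_0^1(G',A)=\{f\in H^1(G'): f|_A\equiv 0\}$. For a Borel probability measure $\mu$ on $G'$ with $\mu(A)=0$, let $H_0^1(G',A,\mu)$ be the set of $f\in H_0^1(G',A)$ harmonic on $G'\setminus(\operatorname{supp}\mu\cup A)$, a dense subspace of $L^2(G',\mu)$; the form $q$ restricted to it is closed and defines a self-adjoint operator $H_\mu^D$ with discrete spectrum, whose smallest eigenvalue is $\lambda_0(H_\mu^D)=\inf\{q(f)/\|f\|^2_{L^2(G',\mu)}: 0\neq f\in H_0^1(G',A,\mu)\}$. Put $\lambda_0^{\min,D}(G',A):=\inf\{\lambda_0(H_\mu^D):\mu \text{ a Borel probability measure on } G',\ \mu(A)=0\}$,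 with $\inf\emptyset=+\infty$ (so the value is $+\infty$ if $A=G'$); for $A=\emptyset$ the same formulas are used and give the value $0$. Partitions: a weighted $n$-partition of $G$ is a collection $\mathcal{P}=\{(G_1,\omega_1),\dots,(G_n,\omega_n)\}$ where $G_1,\dots,G_n$ are closed, nonempty, connected subsets of $G$ with mutually disjoint interiors (they need not cover $G$) and $\omega_i>0$ are reals with $\sum_i\omega_i=1$. Each $G_i$ is itself a metric graph (possibly a single point), and $\partial G_i$ denotes its topological boundary in $G$. Set $\Lambda(\mathcal{P})=\max_{i}\frac{1}{\omega_i}\lambda_0^{\min,D}(G_i,\partial G_i)$ and $\mathcal{L}_n(G)=\inf_{\mathcal{P}}\Lambda(\mathcal{P})$, the infimum over all weighted $n$-partitions of $G$. *)

theory Defs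
  imports
    "Graph_Theory.Digraph_Component"
    "HOL-Probability.Probability_Measure"
    "HOL-Analysis.Analysis"
    "HOL-Library.Function_Algebras"
begin

section \<open>Sobolev functions on open subsets of the line\<close>

definition sq_integrable_on :: "real set \<Rightarrow> (real \<Rightarrow> real) \<Rightarrow> bool" where
  "sq_integrable_on I g \<longleftrightarrow>
     set_borel_measurable lborel I g \<and> set_integrable lborel I (\<lambda>t. (g t)\<^sup>2)"

text \<open>Weak derivatives are tested against compactly supported functions of class C1.\<close>

definition weak_derivative_on :: "real set \<Rightarrow> (real \<Rightarrow> real) \<Rightarrow> (real \<Rightarrow> real) \<Rightarrow> bool" where
  "weak_derivative_on I u g \<longleftrightarrow>
     (\<forall>\<phi> \<phi>'. (\<forall>t. (\<phi> has_real_derivative \<phi>' t) (at t)) \<and> continuous_on UNIV \<phi>' \<and>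
        compact (closure {t. \<phi> t \<noteq> 0}) \<and> closure {t. \<phi> t \<noteq> 0} \<subseteq> I \<longrightarrow>
        (LINT t:I|lborel. u t * \<phi>' t) = - (LINT t:I|lborel. g t * \<phi> t))"

definition sobolev_H1_on :: "real set \<Rightarrow> (real \<Rightarrow> real) \<Rightarrow> bool" where
  "sobolev_H1_on I u \<longleftrightarrow>
     sq_integrable_on I u \<and> (\<exists>g. sq_integrable_on I g \<and> weak_derivative_on I u g)"

text \<open>A representative of the weak derivative, determined almost everywhere on the open set
  \<open>I\<close> when \<open>sobolev_H1_on I u\<close>.\<close>

definition weak_deriv :: "real set \<Rightarrow> (real \<Rightarrow> real) \<Rightarrow> real \<Rightarrow> real" where
  "weak_deriv I u = (SOME g. sq_integrable_on I g \<and> weak_derivative_on I u g)"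


section \<open>Dimension of linear spaces of real functions\<close>

lemma vector_space_real_fun: "vector_space (\<lambda>(c::real) (f::'a \<Rightarrow> real) x. c * f x)"
  by unfold_locales (auto simp: fun_eq_iff algebra_simps)

definition fun_dim :: "('a \<Rightarrow> real) set \<Rightarrow> nat" where
  "fun_dim = vector_space.dim (\<lambda>(c::real) (f::'a \<Rightarrow> real) x. c * f x)"


section \<open>Metric graphs\<close>

text \<open>The arcs of the multi-digraph \<open>G\<close> are the edges, each with an arbitrarily chosen
  orientation; the connectedness predicate ignores orientations.\<close>

locale metric_graph = fin_digraph G
  for G :: "('v, 'e) pre_digraph" (structure) +
  fixes len :: "'e \<Rightarrow> real"
  assumes connected_G: "Digraph_Component.connected G"
    and arcs_nonempty: "arcs G \<noteq> {}"
    and len_pos: "e \<in> arcs G \<Longrightarrow> 0 < len e"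

datatype ('v, 'e) gpoint = Vertex 'v | Inner 'e real

type_synonym ('v, 'e) gfun = "('v, 'e) gpoint \<Rightarrow> real"

context metric_graph
begin

definition points :: "('v, 'e) gpoint set" where
  "points = Vertex ` verts G \<union> {Inner e t | e t. e \<in> arcs G \<and> 0 < t \<and> t < len e}"

text \<open>The gluing map from the interval \<open>{0..len e}\<close> to the graph.\<close>

definition edge_map :: "'e \<Rightarrow> real \<Rightarrow> ('v, 'e) gpoint" where
  "edge_map e t =
     (if t \<le> 0 then Vertex (tail G e) else if len e \<le> t then Vertex (head G e) else Inner e t)"

text \<open>The quotient topology of the disjoint union of the intervals.\<close>

definition gtop :: "('v, 'e) gpoint topology" where
  "gtop = topology (\<lambda>U. U \<subseteq> points \<and>
     (\<forall>e \<in> arcs G. openin (top_of_set {0..len e}) {t \<in> {0..len e}. edge_map e t \<in> U}))"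

lemma openin_gtop:
  "openin gtop U \<longleftrightarrow> U \<subseteq> points \<and>
     (\<forall>e \<in> arcs G. openin (top_of_set {0..len e}) {t \<in> {0..len e}. edge_map e t \<in> U})"
proof -
  have "istopology (\<lambda>U. U \<subseteq> points \<and>
     (\<forall>e \<in> arcs G. openin (top_of_set {0..len e}) {t \<in> {0..len e}. edge_map e t \<in> U}))"
    unfolding istopology_def
  proof (intro conjI allI impI ballI; (elim conjE)?)
    fix S T e
    assume "\<forall>e\<in>arcs G. openin (top_of_set {0..len e}) {t \<in> {0..len e}. edge_map e t \<in> S}"
      "\<forall>e\<in>arcs G. openin (top_of_set {0..len e}) {t \<in> {0..len e}. edge_map e t \<in> T}"
      "e \<in> arcs G"
    then have "openin (top_of_set {0..len e})
      ({t \<in> {0..len e}. edge_map e t \<in> S} \<inter> {t \<in> {0..len e}. edge_map e t \<in> T})"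
      by blast
    then show "openin (top_of_set {0..len e}) {t \<in> {0..len e}. edge_map e t \<in> S \<inter> T}"
      by (rule back_subst) auto
  next
    fix \<K> e
    assume "\<forall>K\<in>\<K>. K \<subseteq> points \<and>
        (\<forall>e\<in>arcs G. openin (top_of_set {0..len e}) {t \<in> {0..len e}. edge_map e t \<in> K})"
      "e \<in> arcs G"
    then have "openin (top_of_set {0..len e})
      (\<Union>K\<in>\<K>. {t \<in> {0..len e}. edge_map e t \<in> K})"
      by blast
    then show "openin (top_of_set {0..len e}) {t \<in> {0..len e}. edge_map e t \<in> \<Union>\<K>}"
      by (rule back_subst) auto
  qed auto
  then show ?thesis
    unfolding gtop_def by (simp add: topology_inverse')
qed


subsection \<open>Function spaces and the energy form\<close>

text \<open>The notions below are stated for a closed connected subset \<open>K\<close> of the graph, viewed as a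
  metric graph itself (a single point is allowed); \<open>K = points\<close> gives the whole graph. The
  connected components of \<open>edge_dom K e\<close>, over all \<open>e\<close>, are the open edges of \<open>K\<close>.\<close>

definition edge_dom :: "('v, 'e) gpoint set \<Rightarrow> 'e \<Rightarrow> real set" where
  "edge_dom K e = interior {t. 0 < t \<and> t < len e \<and> edge_map e t \<in> K}"

text \<open>Functions on \<open>K\<close> are represented by total functions vanishing off \<open>K\<close>, so that \<open>H1 K\<close> is
  a linear space whose elements are determined by their restrictions to \<open>K\<close>. Continuity is only
  required on the subspace \<open>K\<close>.\<close>

definition H1 :: "('v, 'e) gpoint set \<Rightarrow> ('v, 'e) gfun set" where
  "H1 K = {f. (\<forall>x. x \<notin> K \<longrightarrow> f x = 0) \<and>
     continuous_map (subtopology gtop K) euclideanreal f \<and>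
     (\<forall>e \<in> arcs G. sobolev_H1_on (edge_dom K e) (f \<circ> edge_map e))}"

definition energy :: "('v, 'e) gpoint set \<Rightarrow> ('v, 'e) gfun \<Rightarrow> ('v, 'e) gfun \<Rightarrow> real" where
  "energy K f g = (\<Sum>e \<in> arcs G. LINT t:edge_dom K e|lborel.
     weak_deriv (edge_dom K e) (f \<circ> edge_map e) t * weak_deriv (edge_dom K e) (g \<circ> edge_map e) t)"

definition harmonic_on :: "('v, 'e) gpoint set \<Rightarrow> ('v, 'e) gpoint set \<Rightarrow> ('v, 'e) gfun \<Rightarrow> bool" where
  "harmonic_on K U f \<longleftrightarrow>
     f \<in> H1 K \<and> (\<forall>g \<in> H1 K. (\<forall>x \<in> K - U. g x = 0) \<longrightarrow> energy K f g = 0)"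


subsection \<open>Borel probability measures\<close>

definition borel_probs :: "('v, 'e) gpoint set \<Rightarrow> ('v, 'e) gpoint measure set" where
  "borel_probs K =
     {\<mu>. prob_space \<mu> \<and> sets \<mu> = sigma_sets K {U. openin (subtopology gtop K) U}}"

definition msupp :: "('v, 'e) gpoint set \<Rightarrow> ('v, 'e) gpoint measure \<Rightarrow> ('v, 'e) gpoint set" where
  "msupp K \<mu> = {x \<in> K. \<forall>U. openin (subtopology gtop K) U \<and> x \<in> U \<longrightarrow> 0 < emeasure \<mu> U}"


subsection \<open>The Laplacian of a measure and its eigenvalues\<close>

definition H1_mu :: "('v, 'e) gpoint measure \<Rightarrow> ('v, 'e) gfun set" where
  "H1_mu \<mu> = {f \<in> H1 points. harmonic_on points (points - msupp points \<mu>) f}"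

text \<open>\<open>laplacian \<mu> f g\<close>: \<open>f\<close> lies in the domain of the operator and is mapped to \<open>g\<close>.\<close>

definition laplacian :: "('v, 'e) gpoint measure \<Rightarrow> ('v, 'e) gfun \<Rightarrow> ('v, 'e) gfun \<Rightarrow> bool" where
  "laplacian \<mu> f g \<longleftrightarrow> f \<in> H1_mu \<mu> \<and>
     g \<in> borel_measurable \<mu> \<and> integrable \<mu> (\<lambda>x. (g x)\<^sup>2) \<and>
     (\<forall>\<phi> \<in> H1_mu \<mu>. energy points f \<phi> = (LINT x|\<mu>. g x * \<phi> x))"

definition eigenspace :: "('v, 'e) gpoint measure \<Rightarrow> real \<Rightarrow> ('v, 'e) gfun set" where
  "eigenspace \<mu> \<kappa> = {f. laplacian \<mu> f (\<lambda>x. \<kappa> * f x)}"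

definition eigenfunction :: "('v, 'e) gpoint measure \<Rightarrow> real \<Rightarrow> ('v, 'e) gfun \<Rightarrow> bool" where
  "eigenfunction \<mu> \<kappa> f \<longleftrightarrow> f \<in> eigenspace \<mu> \<kappa> \<and> f \<noteq> (\<lambda>x. 0)"

definition eigenvalues :: "('v, 'e) gpoint measure \<Rightarrow> real set" where
  "eigenvalues \<mu> = {\<kappa>. \<exists>f. eigenfunction \<mu> \<kappa> f}"

text \<open>The eigenvalue with index \<open>k\<close> (starting from 0) of the increasing enumeration with
  multiplicities: the least \<open>\<kappa>\<close> such that the eigenvalues up to \<open>\<kappa>\<close> have total multiplicity
  exceeding \<open>k\<close>. The total multiplicity of all eigenvalues is the dimension of L2, so the infimum
  is over the empty set, with value \<open>\<infinity>\<close>, when \<open>k\<close> is at least that dimension.\<close>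

definition eigval :: "('v, 'e) gpoint measure \<Rightarrow> nat \<Rightarrow> ereal" where
  "eigval \<mu> k = (INF \<kappa> \<in> {\<kappa>. k < (\<Sum>\<eta> \<in> {\<eta> \<in> eigenvalues \<mu>. \<eta> \<le> \<kappa>}. fun_dim (eigenspace \<mu> \<eta>))}.
     ereal \<kappa>)"

definition eigval_min :: "nat \<Rightarrow> ereal" where
  "eigval_min k = (INF \<mu> \<in> borel_probs points. eigval \<mu> k)"


subsection \<open>Dirichlet conditions on a closed set\<close>

definition H1_dir :: "('v, 'e) gpoint set \<Rightarrow> ('v, 'e) gpoint set \<Rightarrow> ('v, 'e) gfun set" where
  "H1_dir K A = {f \<in> H1 K. \<forall>x \<in> A. f x = 0}"

definition H1_dir_mu ::
    "('v, 'e) gpoint set \<Rightarrow> ('v, 'e) gpoint set \<Rightarrow> ('v, 'e) gpoint measure \<Rightarrow> ('v, 'e) gfun set" where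
  "H1_dir_mu K A \<mu> = {f \<in> H1_dir K A. harmonic_on K (K - (msupp K \<mu> \<union> A)) f}"

definition dir_eigval0 ::
    "('v, 'e) gpoint set \<Rightarrow> ('v, 'e) gpoint set \<Rightarrow> ('v, 'e) gpoint measure \<Rightarrow> ereal" where
  "dir_eigval0 K A \<mu> =
     (INF f \<in> H1_dir_mu K A \<mu> - {\<lambda>x. 0}. ereal (energy K f f / (LINT x|\<mu>. (f x)\<^sup>2)))"

definition dir_eigval0_min :: "('v, 'e) gpoint set \<Rightarrow> ('v, 'e) gpoint set \<Rightarrow> ereal" where
  "dir_eigval0_min K A = (INF \<mu> \<in> {\<mu> \<in> borel_probs K. emeasure \<mu> A = 0}. dir_eigval0 K A \<mu>)"


subsection \<open>Weighted partitions\<close>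

definition weighted_partition :: "nat \<Rightarrow> (('v, 'e) gpoint set \<times> real) list \<Rightarrow> bool" where
  "weighted_partition n P \<longleftrightarrow> length P = n \<and>
     (\<forall>(K, w) \<in> set P. closedin gtop K \<and> K \<noteq> {} \<and> connectedin gtop K \<and> 0 < w) \<and>
     (\<forall>i<n. \<forall>j<n. i \<noteq> j \<longrightarrow>
        gtop interior_of fst (P ! i) \<inter> gtop interior_of fst (P ! j) = {}) \<and>
     (\<Sum>(K, w) \<leftarrow> P. w) = 1"

definition partition_energy :: "(('v, 'e) gpoint set \<times> real) list \<Rightarrow> ereal" where
  "partition_energy P =
     Max ((\<lambda>(K, w). ereal (1 / w) * dir_eigval0_min K (gtop frontier_of K)) ` set P)"

definition min_partition_energy :: "nat \<Rightarrow> ereal" where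
  "min_partition_energy n = (INF P \<in> {P. weighted_partition n P}. partition_energy P)"

definition pos_nodal :: "('v, 'e) gfun \<Rightarrow> ('v, 'e) gpoint set" where
  "pos_nodal f = gtop closure_of {x \<in> points. 0 < f x}"

definition neg_nodal :: "('v, 'e) gfun \<Rightarrow> ('v, 'e) gpoint set" where
  "neg_nodal f = gtop closure_of {x \<in> points. f x < 0}"

end

end

theory Submission
  imports Defs "HOL-Probability.Probability_Mass_Function"
begin

text \<open>Both sides equal \<open>4c\<close>, where \<open>c\<close> is the minimum of \<open>q(f) / (max f - min f)\<^sup>2\<close> over non-constant
  \<open>f\<close>. The minimum exists: along a minimizing sequence of functions with values in \<open>[0,1]\<close> the
  points where \<open>1\<close> and \<open>0\<close> are attained and the values at the vertices converge up to a
  subsequence, and by Cauchy--Schwarz the piecewise linear interpolation of the limiting values has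
  no more energy. Since \<open>q(h) - c (h(x) - h(y))\<^sup>2 \<ge> 0\<close> for all \<open>h\<close>, a minimizer \<open>f\<close> with extrema at
  \<open>x\<close> and \<open>y\<close> satisfies \<open>q(f,h) = c (f(x) - f(y)) (h(x) - h(y))\<close> for all \<open>h\<close>.

  An eigenfunction \<open>f\<close> for a nonzero eigenvalue has mean zero, so \<open>\<integral> f\<^sup>2 d\<mu> \<le> - max f min f \<le>
  (max f - min f)\<^sup>2 / 4\<close>, which gives \<open>\<lambda>\<^sub>1 \<ge> 4c\<close>; two point masses \<open>1/2\<close> at the extrema of a
  minimizer attain \<open>4c\<close>, and equality forces \<open>f\<close> to be a minimizer with \<open>min f = - max f\<close>.

  For a partition, test functions \<open>g\<^sub>1, g\<^sub>2\<close> of the two cells with maximum \<open>1\<close> are glued to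
  \<open>w\<^sub>2 g\<^sub>1 - w\<^sub>1 g\<^sub>2\<close>, whose oscillation is at least \<open>1\<close>; this gives \<open>\<Lambda> \<ge> 4c\<close> because \<open>4 w\<^sub>1 w\<^sub>2 \<le> 1\<close>. Conversely,
  for a minimizer the restrictions of \<open>f\<close> to its nodal domains each carry half of the energy.\<close>

section \<open>Square-integrable functions and their primitives\<close>

text \<open>The energy is defined through weak derivatives chosen by \<open>SOME\<close>, while the
  argument needs values at points, estimates on intervals, cutting and gluing. So along each edge
  every function is first identified with a primitive of a square-integrable function, the predicate
  \<open>AC2\<close>. The delicate gluing is the extension by zero from a closed set. It is applied
  to nodal domains, and to closed pieces of them, before their connectedness is known, so the
  interior of such a set may meet an edge in infinitely many intervals.

  The identity for \<open>q(f,h)\<close> says that a minimizer is harmonic away from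
  \<open>x\<close> and \<open>y\<close>; this is why point masses at its extrema are optimal and why
  the spectrum only has to be determined up to \<open>4c\<close>. It also explains the halves: for
  \<open>f(y) = - f(x)\<close> and the positive part \<open>h\<close> of \<open>f\<close> one gets
  \<open>q(h) = q(f,h) = 2c f(x)^2\<close>, while \<open>q(f) = 4c f(x)^2\<close>.\<close>

definition L2 :: "(real \<Rightarrow> real) \<Rightarrow> bool" where
  "L2 g \<longleftrightarrow> g \<in> borel_measurable lborel \<and> integrable lborel (\<lambda>r. (g r)\<^sup>2)"

lemma L2_measurable [measurable_dest]: "L2 g \<Longrightarrow> g \<in> borel_measurable borel"
  by (simp add: L2_def)

lemma L2_mult:
  assumes "L2 f" "L2 g"
  shows "integrable lborel (\<lambda>r. f r * g r)"
proof (rule Bochner_Integration.integrable_bound)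
  show "integrable lborel (\<lambda>r. (f r)\<^sup>2 + (g r)\<^sup>2)"
    using assms by (auto simp: L2_def)
  show "(\<lambda>r. f r * g r) \<in> borel_measurable lborel"
    using assms by simp
  have "\<bar>x * y\<bar> \<le> x\<^sup>2 + y\<^sup>2" for x y :: real
  proof -
    have "0 \<le> (\<bar>x\<bar> - \<bar>y\<bar>)\<^sup>2" by simp
    then have "2 * (\<bar>x\<bar> * \<bar>y\<bar>) \<le> x\<^sup>2 + y\<^sup>2" by (simp add: power2_diff)
    moreover have "0 \<le> \<bar>x\<bar> * \<bar>y\<bar>" by simp
    ultimately show ?thesis by (simp only: abs_mult)
  qed
  then show "AE x in lborel. norm (f x * g x) \<le> norm ((f x)\<^sup>2 + (g x)\<^sup>2)"
    by simp
qed

lemma L2_add: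
  assumes "L2 f" "L2 g"
  shows "L2 (\<lambda>r. f r + g r)"
proof -
  have "integrable lborel (\<lambda>r. (f r)\<^sup>2 + (g r)\<^sup>2 + 2 * (f r * g r))"
    using assms L2_mult[OF assms] by (auto simp: L2_def)
  moreover have "(f r)\<^sup>2 + (g r)\<^sup>2 + 2 * (f r * g r) = (f r + g r)\<^sup>2" for r
    by (simp add: power2_sum)
  ultimately show ?thesis
    using assms by (auto simp: L2_def)
qed

lemma L2_scale: "L2 f \<Longrightarrow> L2 (\<lambda>r. c * f r)"
  by (auto simp: L2_def power_mult_distrib)

lemma L2_indicator:
  assumes "L2 f" "A \<in> sets borel"
  shows "L2 (\<lambda>r. indicator A r * f r)"
proof -
  have "integrable lborel (\<lambda>r. indicator A r *\<^sub>R (f r)\<^sup>2)"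
    using assms by (intro integrable_mult_indicator) (auto simp: L2_def)
  moreover have "indicator A r *\<^sub>R (f r)\<^sup>2 = (indicator A r * f r)\<^sup>2" for r :: real
    by (auto simp: indicator_def)
  moreover have "(\<lambda>r. indicator A r * f r) \<in> borel_measurable lborel"
    using assms by (auto simp: L2_def)
  ultimately show ?thesis
    by (simp add: L2_def)
qed

lemma L2_const_Ioc: "L2 (\<lambda>r. indicator {s<..t} r * c)"
proof -
  have "integrable lborel (indicat_real {s<..t})"
    by (cases "s \<le> t") (auto intro!: integrable_real_indicator)
  then have "integrable lborel (\<lambda>r. indicat_real {s<..t} r * c\<^sup>2)"
    by simp
  also have "(\<lambda>r. indicat_real {s<..t} r * c\<^sup>2) = (\<lambda>r. (indicator {s<..t} r * c)\<^sup>2)"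
    by (auto simp: indicator_def)
  finally show ?thesis
    by (simp add: L2_def)
qed

lemma L2_set_integrable:
  assumes "L2 g"
  shows "set_integrable lborel {s<..t} g"
  using L2_mult[OF L2_const_Ioc[of s t 1] assms] by (simp add: set_integrable_def)

lemma L2_set_integrable_sq:
  assumes "L2 g" "A \<in> sets borel"
  shows "set_integrable lborel A (\<lambda>r. (g r)\<^sup>2)"
  using assms unfolding set_integrable_def
  by (intro integrable_mult_indicator) (auto simp: L2_def)

text \<open>Lets functions on an open set be treated as functions on the whole line that vanish off
  it, so that sums, products and restrictions carry no domain.\<close>

lemma sq_integrable_on_iff: "sq_integrable_on U g \<longleftrightarrow> L2 (\<lambda>r. indicator U r * g r)"
proof -
  have "indicator U r *\<^sub>R (g r)\<^sup>2 = (indicator U r * g r)\<^sup>2" for r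
    by (auto simp: indicator_def)
  then show ?thesis
    by (simp add: sq_integrable_on_def L2_def set_borel_measurable_def set_integrable_def)
qed

lemma set_lebesgue_integral_Ioc_split:
  fixes g :: "real \<Rightarrow> real"
  assumes "set_integrable lborel {s<..t} g" "s \<le> m" "m \<le> t"
  shows "(LINT r:{s<..t}|lborel. g r) = (LINT r:{s<..m}|lborel. g r) + (LINT r:{m<..t}|lborel. g r)"
proof -
  have "{s<..t} = {s<..m} \<union> {m<..t}" using assms by auto
  moreover have "(LINT r:{s<..m} \<union> {m<..t}|lborel. g r)
      = (LINT r:{s<..m}|lborel. g r) + (LINT r:{m<..t}|lborel. g r)"
    by (rule set_integral_Un) (use assms in \<open>auto intro: set_integrable_subset\<close>)
  ultimately show ?thesis by simp
qed

text \<open>Cauchy--Schwarz against the constant 1, obtained by expanding the integral of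
  \<open>(g r - m)\<^sup>2\<close> for the mean value \<open>m\<close> of \<open>g\<close>.\<close>

lemma square_integral_Ioc_le:
  assumes "L2 g" "s \<le> t"
  shows "(LINT r:{s<..t}|lborel. g r)\<^sup>2 \<le> (t - s) * (LINT r:{s<..t}|lborel. (g r)\<^sup>2)"
proof (cases "s = t")
  case True
  then show ?thesis by (simp add: set_lebesgue_integral_def)
next
  case False
  define m where "m = (LINT r:{s<..t}|lborel. g r) / (t - s)"
  have st: "t - s > 0" using False assms by simp
  have i1: "set_integrable lborel {s<..t} g" by (rule L2_set_integrable) fact
  have i2: "set_integrable lborel {s<..t} (\<lambda>r. (g r)\<^sup>2)" by (rule L2_set_integrable_sq) (use assms in auto)
  have i3: "set_integrable lborel {s<..t} (\<lambda>r. c :: real)" for c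
    using assms by (simp add: set_integrable_def integrable_real_indicator)
  have "0 \<le> (LINT r:{s<..t}|lborel. (g r - m)\<^sup>2)"
    unfolding set_lebesgue_integral_def by (rule integral_nonneg_AE) auto
  also have "\<dots> = (LINT r:{s<..t}|lborel. (g r)\<^sup>2 + ((- 2 * m) * g r + m\<^sup>2))"
    by (simp add: power2_diff algebra_simps)
  also have "\<dots> = (LINT r:{s<..t}|lborel. (g r)\<^sup>2) + ((- 2 * m) * (LINT r:{s<..t}|lborel. g r)
      + (LINT r:{s<..t}|lborel. m\<^sup>2))"
    using i1 i2 i3[of "m\<^sup>2"] set_integrable_mult_right[of "- 2 * m" lborel "{s<..t}" g]
    by (simp add: set_integral_add(2) set_integral_add(1))
  also have "(LINT r:{s<..t}|lborel. m\<^sup>2) = m\<^sup>2 * (t - s)"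
    using assms by (simp add: set_lebesgue_integral_def)
  also have "(LINT r:{s<..t}|lborel. g r) = m * (t - s)"
    using st by (simp add: m_def)
  finally have "m\<^sup>2 * (t - s) \<le> (LINT r:{s<..t}|lborel. (g r)\<^sup>2)"
    by (simp add: algebra_simps power2_eq_square)
  then have "(t - s) * (m\<^sup>2 * (t - s)) \<le> (t - s) * (LINT r:{s<..t}|lborel. (g r)\<^sup>2)"
    using st by (intro mult_left_mono) auto
  moreover have "(LINT r:{s<..t}|lborel. g r)\<^sup>2 = (t - s) * (m\<^sup>2 * (t - s))"
    using st by (simp add: m_def power2_eq_square)
  ultimately show ?thesis by simp
qed

text \<open>The hypothesis is Hoelder continuity of exponent 1/2, which is what Cauchy--Schwarz
  yields for primitives of square-integrable functions.\<close>

lemma continuous_on_square_bound: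
  fixes u :: "real \<Rightarrow> real"
  assumes "\<And>s t. s \<in> S \<Longrightarrow> t \<in> S \<Longrightarrow> s \<le> t \<Longrightarrow> (u t - u s)\<^sup>2 \<le> (t - s) * C"
  shows "continuous_on S u"
proof -
  have *: "dist (u t) (u s) \<le> sqrt (dist t s * C)" if "s \<in> S" "t \<in> S" for s t
  proof -
    have "(u t - u s)\<^sup>2 \<le> \<bar>t - s\<bar> * C"
      using assms[of s t] assms[of t s] that by (cases "s \<le> t") (auto simp: power2_commute)
    then show ?thesis
      by (simp add: dist_real_def real_le_rsqrt)
  qed
  show ?thesis
    unfolding continuous_on_def
  proof
    fix x assume x: "x \<in> S"
    show "(u \<longlongrightarrow> u x) (at x within S)"
    proof (rule metric_tendsto_imp_tendsto)
      have "((\<lambda>y. sqrt (dist y x * C)) \<longlongrightarrow> sqrt (dist x x * C)) (at x within S)"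
        by (intro tendsto_intros)
      then show "((\<lambda>y. sqrt (dist y x * C)) \<longlongrightarrow> 0) (at x within S)" by simp
      show "\<forall>\<^sub>F y in at x within S. dist (u y) (u x) \<le> dist (sqrt (dist y x * C)) 0"
        unfolding eventually_at_filter
      proof (intro always_eventually allI impI)
        fix y assume "y \<in> S"
        then have "dist (u y) (u x) \<le> sqrt (dist y x * C)" using * x by blast
        then show "dist (u y) (u x) \<le> dist (sqrt (dist y x * C)) 0"
          by (simp add: dist_real_def)
      qed
    qed
  qed
qed

text \<open>The one-dimensional Sobolev functions in their continuous representative: absolutely
  continuous on the closed interval with square-integrable derivative \<open>g\<close>. Taking the
  fundamental theorem of calculus as the definition avoids pointwise derivatives, and half-open
  intervals make increments add up without overlap.\<close>

definition AC2 :: "real \<Rightarrow> real \<Rightarrow> (real \<Rightarrow> real) \<Rightarrow> (real \<Rightarrow> real) \<Rightarrow> bool" where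
  "AC2 a b u g \<longleftrightarrow> L2 g \<and>
     (\<forall>s t. a \<le> s \<longrightarrow> s \<le> t \<longrightarrow> t \<le> b \<longrightarrow> u t - u s = (LINT r:{s<..t}|lborel. g r))"

lemma AC2_Holder:
  assumes "AC2 a b u g" "a \<le> s" "s \<le> t" "t \<le> b"
  shows "(u t - u s)\<^sup>2 \<le> (t - s) * (LINT r:{s<..t}|lborel. (g r)\<^sup>2)"
  using assms square_integral_Ioc_le[of g s t] by (auto simp: AC2_def)

lemma set_integral_sq_mono:
  assumes "L2 g" "A \<subseteq> B" "A \<in> sets borel" "B \<in> sets borel"
  shows "(LINT r:A|lborel. (g r)\<^sup>2) \<le> (LINT r:B|lborel. (g r)\<^sup>2)"
  unfolding set_lebesgue_integral_def
proof (rule integral_mono)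
  show "indicat_real A r *\<^sub>R (g r)\<^sup>2 \<le> indicat_real B r *\<^sub>R (g r)\<^sup>2" for r
    using assms(2) by (auto simp: indicator_def)
qed (use assms L2_set_integrable_sq in \<open>auto simp: set_integrable_def\<close>)

lemma L2_primitive_continuous:
  assumes "L2 g"
  shows "continuous_on {a..} (\<lambda>t. LINT r:{a<..t}|lborel. g r)"
proof (rule continuous_on_square_bound)
  fix s t assume st: "s \<in> {a..}" "t \<in> {a..}" "s \<le> t"
  have "(LINT r:{a<..t}|lborel. g r) = (LINT r:{a<..s}|lborel. g r) + (LINT r:{s<..t}|lborel. g r)"
    by (rule set_lebesgue_integral_Ioc_split) (use st assms L2_set_integrable in auto)
  then have "((LINT r:{a<..t}|lborel. g r) - (LINT r:{a<..s}|lborel. g r))\<^sup>2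
      \<le> (t - s) * (LINT r:{s<..t}|lborel. (g r)\<^sup>2)"
    using square_integral_Ioc_le[OF assms] st by simp
  also have "\<dots> \<le> (t - s) * (LINT r:UNIV|lborel. (g r)\<^sup>2)"
    using st assms by (intro mult_left_mono set_integral_sq_mono) auto
  finally show "((LINT r:{a<..t}|lborel. g r) - (LINT r:{a<..s}|lborel. g r))\<^sup>2
      \<le> (t - s) * (LINT r:UNIV|lborel. (g r)\<^sup>2)" .
qed

lemma AC2_continuous_on:
  assumes "AC2 a b u g"
  shows "continuous_on {a..b} u"
proof (cases "a \<le> b")
  case True
  have "u t = u a + (LINT r:{a<..t}|lborel. g r)" if "t \<in> {a..b}" for t
  proof -
    have "u t - u a = (LINT r:{a<..t}|lborel. g r)"
      using assms that by (auto simp: AC2_def)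
    then show ?thesis by simp
  qed
  moreover have "continuous_on {a..b} (\<lambda>t. u a + (LINT r:{a<..t}|lborel. g r))"
    using L2_primitive_continuous[of g a] assms
    by (intro continuous_intros) (auto simp: AC2_def intro: continuous_on_subset)
  ultimately show ?thesis
    by (metis (no_types, lifting) continuous_on_cong)
qed auto

text \<open>Inside, \<open>u\<close> differs from the primitive of \<open>g\<close> by a constant,
  and continuity carries this to the endpoints. Weak derivatives only give information on compact
  subintervals of an open interval, so the endpoints always need this passage.\<close>

lemma AC2_from_interior:
  assumes "a < b" "L2 g" "continuous_on {a..b} u"
    and int: "\<And>s t. a < s \<Longrightarrow> s \<le> t \<Longrightarrow> t < b \<Longrightarrow> u t - u s = (LINT r:{s<..t}|lborel. g r)"
  shows "AC2 a b u g"
proof -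
  define H where "H t = (LINT r:{a<..t}|lborel. g r)" for t
  have split: "H t - H s = (LINT r:{s<..t}|lborel. g r)" if "a \<le> s" "s \<le> t" for s t
    using set_lebesgue_integral_Ioc_split[of a t g s] L2_set_integrable[OF assms(2)] that
    by (simp add: H_def)
  have cont: "continuous_on {a..b} (\<lambda>t. u t - H t)"
    using L2_primitive_continuous[OF assms(2), of a] assms(3)
    by (intro continuous_intros) (auto simp: H_def intro: continuous_on_subset)
  define m where "m = (a + b) / 2"
  have m: "a < m" "m < b" using assms(1) by (auto simp: m_def)
  have "u t - H t = u m - H m" if "t \<in> {a<..<b}" for t
  proof (cases "m \<le> t")
    case True
    then show ?thesis using int[of m t] split[of m t] that m by simp
  next
    case False
    then show ?thesis using int[of t m] split[of t m] that m by simp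
  qed
  then have const: "u t - H t = u m - H m" if "t \<in> {a..b}" for t
    using continuous_constant_on_closure[of "{a<..<b}" "\<lambda>t. u t - H t" "u m - H m" t] cont that assms(1)
    by simp
  show ?thesis
    unfolding AC2_def
  proof (intro conjI allI impI)
    fix s t assume "a \<le> s" "s \<le> t" "t \<le> b"
    then show "u t - u s = (LINT r:{s<..t}|lborel. g r)"
      using const[of s] const[of t] split[of s t] by simp
  qed fact
qed


section \<open>Weak derivatives on the line\<close>

text \<open>A step from 0 to 1 over the unit interval. It is only of class C1, which is enough for
  the test functions in \<open>weak_derivative_on\<close>, and truncated squares make it
  differentiable by one rule without case distinctions at the joints.\<close>

definition smoothstep :: "real \<Rightarrow> real" where
  "smoothstep x = 2 * ((max 0 x)\<^sup>2 - 2 * (max 0 (x - 1/2))\<^sup>2 + (max 0 (x - 1))\<^sup>2)"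

text \<open>A tent of height 2 over the unit interval. Its integral is 1, so its rescalings form an
  approximate identity.\<close>

definition smoothstep' :: "real \<Rightarrow> real" where
  "smoothstep' x = 4 * (max 0 x - 2 * max 0 (x - 1/2) + max 0 (x - 1))"

lemma max_zero_square_has_derivative:
  "((\<lambda>x::real. (max 0 x)\<^sup>2) has_real_derivative 2 * max 0 x) (at x)"
proof -
  consider "x > 0" | "x < 0" | "x = 0" by linarith
  then show ?thesis
  proof cases
    case 1
    have "((\<lambda>x::real. x\<^sup>2) has_real_derivative 2 * max 0 x) (at x)"
      using 1 by (auto intro!: derivative_eq_intros)
    then show ?thesis
      by (rule has_field_derivative_transform_within_open[of _ _ _ "{0<..}"]) (use 1 in auto)
  next
    case 2
    have "((\<lambda>x::real. 0) has_real_derivative 2 * max 0 x) (at x)"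
      using 2 by (auto intro!: derivative_eq_intros)
    then show ?thesis
      by (rule has_field_derivative_transform_within_open[of _ _ _ "{..<0}"]) (use 2 in auto)
  next
    case 3
    have "((\<lambda>h::real. max 0 h) \<longlongrightarrow> max 0 0) (at 0)"
      by (intro tendsto_intros)
    moreover have "\<forall>\<^sub>F h::real in at 0. max 0 h = ((max 0 (0 + h))\<^sup>2 - (max 0 0)\<^sup>2) / h"
      by (auto simp: eventually_at_filter max_def power2_eq_square)
    ultimately have "((\<lambda>h::real. ((max 0 (0 + h))\<^sup>2 - (max 0 0)\<^sup>2) / h) \<longlongrightarrow> 0) (at 0)"
      by (simp add: filterlim_cong[OF refl refl])
    then show ?thesis
      using 3 by (simp add: DERIV_def)
  qed
qed

lemma smoothstep_has_derivative: "(smoothstep has_real_derivative smoothstep' x) (at x)"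
proof -
  have *: "((\<lambda>x::real. (max 0 (x - c))\<^sup>2) has_real_derivative 2 * max 0 (x - c)) (at x)" for c
  proof -
    have "((\<lambda>x. x - c) has_real_derivative 1) (at x)"
      by (auto intro!: derivative_eq_intros)
    then show ?thesis
      using DERIV_chain2[where f = "\<lambda>x. (max 0 x)\<^sup>2" and g = "\<lambda>x. x - c" and s = UNIV,
          OF max_zero_square_has_derivative, of 1 x] by simp
  qed
  show ?thesis
    unfolding smoothstep_def[abs_def] smoothstep'_def
    by (rule derivative_eq_intros max_zero_square_has_derivative * refl | simp)+
qed

lemma smoothstep'_continuous: "continuous_on S smoothstep'"
  unfolding smoothstep'_def[abs_def] by (intro continuous_intros)

lemma smoothstep'_nonneg: "0 \<le> smoothstep' x"
  by (simp add: smoothstep'_def max_def)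

lemma smoothstep'_eq_0: "x \<le> 0 \<or> 1 \<le> x \<Longrightarrow> smoothstep' x = 0"
  by (auto simp: smoothstep'_def max_def)

lemma smoothstep_eq_0: "x \<le> 0 \<Longrightarrow> smoothstep x = 0"
  by (simp add: smoothstep_def)

lemma smoothstep_eq_1: "1 \<le> x \<Longrightarrow> smoothstep x = 1"
  by (simp add: smoothstep_def max_def power2_eq_square algebra_simps)

lemma smoothstep_mono: "x \<le> y \<Longrightarrow> smoothstep x \<le> smoothstep y"
  by (rule DERIV_nonneg_imp_nondecreasing[where f = smoothstep])
    (use smoothstep_has_derivative smoothstep'_nonneg in blast)+

lemma smoothstep_bounds: "0 \<le> smoothstep x" "smoothstep x \<le> 1"
  using smoothstep_mono[of "min 0 x" x] smoothstep_mono[of x "max 1 x"]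
  by (auto simp: smoothstep_eq_0 smoothstep_eq_1)

text \<open>Averages against nonnegative kernels of mass 1 that concentrate at \<open>p\<close>. The
  point may be an end of the interval, with all mass on one side, and this is how the lemma is
  used.\<close>

lemma kernel_limit:
  fixes u :: "real \<Rightarrow> real" and k :: "nat \<Rightarrow> real \<Rightarrow> real"
  assumes u: "continuous_on {s..t} u" and p: "p \<in> {s..t}"
    and k: "\<And>n. continuous_on {s..t} (k n)" "\<And>n x. 0 \<le> k n x"
    and one: "\<forall>\<^sub>F n in sequentially. (LINT x:{s..t}|lborel. k n x) = 1"
    and loc: "\<And>n x. 0 < n \<Longrightarrow> k n x \<noteq> 0 \<Longrightarrow> \<bar>x - p\<bar> \<le> 1 / real n"
  shows "(\<lambda>n. LINT x:{s..t}|lborel. u x * k n x) \<longlonglongrightarrow> u p"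
proof (rule tendstoI)
  fix e :: real assume e: "0 < e"
  obtain d where d: "d > 0" "\<And>x. x \<in> {s..t} \<Longrightarrow> dist x p < d \<Longrightarrow> dist (u x) (u p) < e / 2"
    using u p e unfolding continuous_on_iff by (meson half_gt_zero)
  have "(\<lambda>n. 1 / real n) \<longlonglongrightarrow> 0" by (rule lim_1_over_n)
  then have ev: "\<forall>\<^sub>F n in sequentially. 1 / real n < d"
    by (rule order_tendstoD) fact
  show "\<forall>\<^sub>F n in sequentially. dist (LINT x:{s..t}|lborel. u x * k n x) (u p) < e"
    using one ev eventually_gt_at_top[of 0]
  proof eventually_elim
    case (elim n)
    have i1: "set_integrable lborel {s..t} (\<lambda>x. u x * k n x)"
      by (intro borel_integrable_atLeastAtMost' continuous_intros u k)
    have i2: "set_integrable lborel {s..t} (\<lambda>x. c * k n x)" for c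
      by (intro borel_integrable_atLeastAtMost' continuous_intros u k)
    have i3: "set_integrable lborel {s..t} (\<lambda>x. (u x - u p) * k n x)"
      by (intro borel_integrable_atLeastAtMost' continuous_intros u k)
    have "(LINT x:{s..t}|lborel. u x * k n x) - u p
        = (LINT x:{s..t}|lborel. u x * k n x) - (LINT x:{s..t}|lborel. u p * k n x)"
      using elim by simp
    also have "\<dots> = (LINT x:{s..t}|lborel. (u x - u p) * k n x)"
      using i1 i2 by (simp add: set_integral_diff(2)[symmetric] left_diff_distrib)
    finally have "\<bar>(LINT x:{s..t}|lborel. u x * k n x) - u p\<bar>
        = \<bar>LINT x:{s..t}|lborel. (u x - u p) * k n x\<bar>" by simp
    also have "\<dots> \<le> (LINT x:{s..t}|lborel. \<bar>(u x - u p) * k n x\<bar>)"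
      using set_integral_norm_bound[OF i3] by simp
    also have "\<dots> \<le> (LINT x:{s..t}|lborel. (e / 2) * k n x)"
    proof (rule set_integral_mono)
      show "set_integrable lborel {s..t} (\<lambda>x. \<bar>(u x - u p) * k n x\<bar>)"
        using set_integrable_abs[OF i3] by simp
      fix x assume x: "x \<in> {s..t}"
      show "\<bar>(u x - u p) * k n x\<bar> \<le> e / 2 * k n x"
      proof (cases "k n x = 0")
        case False
        then have "\<bar>u x - u p\<bar> \<le> e / 2"
          using d(2)[OF x] loc[of n x] elim by (auto simp: dist_real_def)
        then show ?thesis
          using mult_right_mono[of "\<bar>u x - u p\<bar>" "e / 2" "k n x"] k(2)[of n x] by (simp add: abs_mult)
      qed simp
    qed (rule i2)
    also have "\<dots> = e / 2" using elim by simp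
    finally show ?case using e by (simp add: dist_real_def)
  qed
qed

text \<open>Tests the weak derivative with trapezoids that rise from 0 to 1 just right of
  \<open>s\<close> and fall back just left of \<open>t\<close>. Their derivatives are two opposite
  approximate identities, so one side tends to \<open>u s - u t\<close>; the other tends to minus
  the integral of \<open>g\<close> by dominated convergence.\<close>

lemma weak_derivative_integral:
  assumes u: "continuous_on {s..t} u" and wd: "weak_derivative_on U u g"
    and g: "L2 (\<lambda>r. indicator U r * g r)" and st: "s < t" "{s..t} \<subseteq> U"
  shows "u t - u s = (LINT r:{s<..t}|lborel. g r)"
proof -
  define k1 where "k1 n x = real n * smoothstep' (real n * (x - s))" for n x
  \<comment> \<open>The shift by 1 places this bump on the interval from \<open>t - 1/n\<close> to
    \<open>t\<close>, so that the trapezoid stays inside the given closed interval and hence inside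
    \<open>U\<close>.\<close>
  define k2 where "k2 n x = real n * smoothstep' (real n * (x - t) + 1)" for n x
  define \<phi> where "\<phi> n x = smoothstep (real n * (x - s)) - smoothstep (real n * (x - t) + 1)" for n x
  have D1: "((\<lambda>x. smoothstep (real n * (x - s))) has_real_derivative k1 n x) (at x)" for n x
    unfolding k1_def by (rule DERIV_chain2[OF smoothstep_has_derivative, THEN DERIV_cong])
      (auto intro!: derivative_eq_intros)
  have D2: "((\<lambda>x. smoothstep (real n * (x - t) + 1)) has_real_derivative k2 n x) (at x)" for n x
    unfolding k2_def by (rule DERIV_chain2[OF smoothstep_has_derivative, THEN DERIV_cong])
      (auto intro!: derivative_eq_intros)
  have D: "(\<phi> n has_real_derivative k1 n x - k2 n x) (at x)" for n x
    unfolding \<phi>_def[abs_def] by (intro DERIV_diff D1 D2)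
  have c1: "continuous_on S (k1 n)" for n S
    unfolding k1_def[abs_def]
    by (intro continuous_intros continuous_on_compose2[OF smoothstep'_continuous[of UNIV]]) auto
  have c2: "continuous_on S (k2 n)" for n S
    unfolding k2_def[abs_def]
    by (intro continuous_intros continuous_on_compose2[OF smoothstep'_continuous[of UNIV]]) auto
  \<comment> \<open>From \<open>N\<close> on, \<open>1/n\<close> \<le> \<open>t - s\<close>; for
    smaller \<open>n\<close> the falling step would begin left of \<open>s\<close>, and the test
    function would not vanish there.\<close>
  obtain N :: nat where N: "1 / (t - s) < real N" using reals_Archimedean2 by blast
  have large: "1 \<le> real n * (t - s)" if "n \<ge> N" for n
  proof -
    have "1 < real N * (t - s)" using N st by (simp add: field_simps)
    also have "\<dots> \<le> real n * (t - s)" using that st by (intro mult_right_mono) auto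
    finally show ?thesis by simp
  qed
  have out: "k1 n x = 0 \<and> k2 n x = 0 \<and> \<phi> n x = 0" if n: "n \<ge> N" and x: "x \<notin> {s<..<t}" for n x
  proof -
    have "0 < n" using large[OF n] by (cases "n = 0") auto
    consider "x \<le> s" | "t \<le> x" using x by fastforce
    then show ?thesis
    proof cases
      case 1
      then have "real n * (x - s) \<le> 0" "real n * (x - t) \<le> real n * (s - t)"
        by (auto intro: mult_nonneg_nonpos mult_left_mono)
      moreover have "real n * (s - t) \<le> - 1" using large[OF n] by (simp add: algebra_simps)
      ultimately show ?thesis
        by (simp add: k1_def k2_def \<phi>_def smoothstep'_eq_0 smoothstep_eq_0)
    next
      case 2
      then have "real n * (x - s) \<ge> real n * (t - s)" "real n * (x - t) \<ge> 0"
        by (auto intro: mult_left_mono)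
      then show ?thesis
        using large[OF n] by (simp add: k1_def k2_def \<phi>_def smoothstep'_eq_0 smoothstep_eq_1)
    qed
  qed
  have test: "(LINT x:U|lborel. u x * (k1 n x - k2 n x)) = - (LINT x:U|lborel. g x * \<phi> n x)"
    if "n \<ge> N" for n
  proof -
    have "{x. \<phi> n x \<noteq> 0} \<subseteq> {s..t}"     proof
      fix x assume "x \<in> {x. \<phi> n x \<noteq> 0}"
      then have "x \<in> {s<..<t}" using out[OF that, of x] by blast
      then show "x \<in> {s..t}" by simp
    qed
    then have sub: "closure {x. \<phi> n x \<noteq> 0} \<subseteq> {s..t}" by (simp add: closure_minimal)
    then have "compact (closure {x. \<phi> n x \<noteq> 0})"
      by (metis bounded_closed_interval bounded_subset closed_closure compact_eq_bounded_closed)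
    then show ?thesis
      using wd sub st(2) D c1 c2 unfolding weak_derivative_on_def
      by (intro wd[unfolded weak_derivative_on_def, rule_format, of "\<phi> n" "\<lambda>x. k1 n x - k2 n x"])
        (auto intro!: continuous_intros)
  qed
  have loc: "(LINT x:U|lborel. u x * (k1 n x - k2 n x))
      = (LINT x:{s..t}|lborel. u x * k1 n x) - (LINT x:{s..t}|lborel. u x * k2 n x)" if "n \<ge> N" for n
  proof -
    have "(LINT x:U|lborel. u x * (k1 n x - k2 n x)) = (LINT x:{s..t}|lborel. u x * (k1 n x - k2 n x))"
      unfolding set_lebesgue_integral_def
      by (rule Bochner_Integration.integral_cong) (use out[OF that] st(2) in \<open>auto simp: indicator_def\<close>)
    also have "\<dots> = (LINT x:{s..t}|lborel. u x * k1 n x - u x * k2 n x)"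
      by (simp add: right_diff_distrib)
    also have "\<dots> = (LINT x:{s..t}|lborel. u x * k1 n x) - (LINT x:{s..t}|lborel. u x * k2 n x)"
      by (intro set_integral_diff borel_integrable_atLeastAtMost' continuous_intros u c1 c2)
    finally show ?thesis .
  qed
  have one1: "(LINT x:{s..t}|lborel. k1 n x) = 1" if "n \<ge> N" for n
  proof -
    have "(LINT x:{s..t}|lborel. k1 n x) = smoothstep (real n * (t - s)) - smoothstep (real n * (s - s))"
      unfolding set_lebesgue_integral_def
      by (rule integral_FTC_Icc[OF _ _ c1])
        (use st D1 in \<open>auto simp: has_real_derivative_iff_has_vector_derivative[symmetric]
           intro: has_field_derivative_at_within\<close>)
    then show ?thesis using large[OF that] by (simp add: smoothstep_eq_0 smoothstep_eq_1)
  qed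
  have one2: "(LINT x:{s..t}|lborel. k2 n x) = 1" if "n \<ge> N" for n
  proof -
    have "(LINT x:{s..t}|lborel. k2 n x)
        = smoothstep (real n * (t - t) + 1) - smoothstep (real n * (s - t) + 1)"
      unfolding set_lebesgue_integral_def
      by (rule integral_FTC_Icc[OF _ _ c2])
        (use st D2 in \<open>auto simp: has_real_derivative_iff_has_vector_derivative[symmetric]
           intro: has_field_derivative_at_within\<close>)
    moreover have "real n * (s - t) + 1 \<le> 0" using large[OF that] by (simp add: algebra_simps)
    ultimately show ?thesis by (simp add: smoothstep_eq_0 smoothstep_eq_1)
  qed
  have k1_loc: "\<bar>x - s\<bar> \<le> 1 / real n" if "0 < n" "k1 n x \<noteq> 0" for n x
  proof -
    have "\<not> (real n * (x - s) \<le> 0 \<or> 1 \<le> real n * (x - s))"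
      using smoothstep'_eq_0[of "real n * (x - s)"] that by (auto simp: k1_def)
    then have "0 < real n * (x - s)" "real n * (x - s) < 1" by auto
    then show ?thesis using that by (auto simp: field_simps zero_less_mult_iff)
  qed
  have k2_loc: "\<bar>x - t\<bar> \<le> 1 / real n" if "0 < n" "k2 n x \<noteq> 0" for n x
  proof -
    have "\<not> (real n * (x - t) + 1 \<le> 0 \<or> 1 \<le> real n * (x - t) + 1)"
      using smoothstep'_eq_0[of "real n * (x - t) + 1"] that by (auto simp: k2_def)
    then have "0 < real n * (x - t) + 1" "real n * (x - t) + 1 < 1" by auto
    then show ?thesis using that by (auto simp: field_simps mult_less_0_iff)
  qed
  have "(\<lambda>n. LINT x:{s..t}|lborel. u x * k1 n x) \<longlonglongrightarrow> u s"
    by (rule kernel_limit[OF u _ c1])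
      (use st one1 k1_loc in \<open>auto simp: eventually_sequentially k1_def smoothstep'_nonneg\<close>)
  moreover have "(\<lambda>n. LINT x:{s..t}|lborel. u x * k2 n x) \<longlonglongrightarrow> u t"
    by (rule kernel_limit[OF u _ c2])
      (use st one2 k2_loc in \<open>auto simp: eventually_sequentially k2_def smoothstep'_nonneg\<close>)
  ultimately have "(\<lambda>n. (LINT x:{s..t}|lborel. u x * k1 n x) - (LINT x:{s..t}|lborel. u x * k2 n x))
      \<longlonglongrightarrow> u s - u t"
    by (rule tendsto_diff)
  moreover have "\<forall>\<^sub>F n in sequentially. (LINT x:{s..t}|lborel. u x * k1 n x) - (LINT x:{s..t}|lborel. u x * k2 n x)
      = - (LINT x:U|lborel. g x * \<phi> n x)"
    using eventually_ge_at_top[of N] by eventually_elim (use test loc in auto)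
  ultimately have lim1: "(\<lambda>n. - (LINT x:U|lborel. g x * \<phi> n x)) \<longlonglongrightarrow> u s - u t"
    by (simp add: filterlim_cong[OF refl refl])
  \<comment> \<open>The functions to be dominated live on the closed interval; starting the
    half-open interval at \<open>s - 1\<close> makes it contain \<open>s\<close>.\<close>
  have ind: "integrable lborel (\<lambda>x. \<bar>indicator {s - 1<..t} x * (indicator U x * g x)\<bar>)"
    using L2_set_integrable[OF g, of "s - 1" t] by (simp add: set_integrable_def)
  have lim2: "(\<lambda>n. LINT x|lborel. indicator {s..t} x * (indicator U x * g x) * \<phi> n x)
      \<longlonglongrightarrow> (LINT x|lborel. indicator {s<..t} x * (indicator U x * g x))"
  proof (rule integral_dominated_convergence[OF _ _ ind])
    have "\<phi> n \<in> borel_measurable lborel" for n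
      using DERIV_isCont[OF D] by (auto intro!: borel_measurable_continuous_onI continuous_at_imp_continuous_on)
    then show "(\<lambda>x. indicator {s..t} x * (indicator U x * g x) * \<phi> n x) \<in> borel_measurable lborel" for n
      using L2_measurable[OF g] by simp
    show "(\<lambda>x. indicator {s<..t} x * (indicator U x * g x)) \<in> borel_measurable lborel"
      using L2_measurable[OF g] by simp
    \<comment> \<open>The point \<open>t\<close> is excluded because the trapezoids vanish there
      while the limit need not; at \<open>s\<close> both sides are 0.\<close>
    have "(\<lambda>n. indicator {s..t} x * (indicator U x * g x) * \<phi> n x)
        \<longlonglongrightarrow> indicator {s<..t} x * (indicator U x * g x)" if "x \<noteq> t" for x
    proof (cases "x \<in> {s<..<t}")
      case True
      obtain M1 :: nat where M1: "1 / (x - s) < real M1" using reals_Archimedean2 by blast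
      obtain M2 :: nat where M2: "1 / (t - x) < real M2" using reals_Archimedean2 by blast
      have "\<forall>\<^sub>F n in sequentially. \<phi> n x = 1"
        using eventually_ge_at_top[of "max M1 M2"]
      proof eventually_elim
        case (elim n)
        have "1 / (x - s) < real n" "1 / (t - x) < real n" using M1 M2 elim by auto
        then have "1 \<le> real n * (x - s)" "real n * (x - t) + 1 \<le> 0"
          using True by (auto simp: field_simps)
        then show ?case by (simp add: \<phi>_def smoothstep_eq_0 smoothstep_eq_1)
      qed
      then have "\<forall>\<^sub>F n in sequentially. indicator {s..t} x * (indicator U x * g x) * \<phi> n x
          = indicator {s<..t} x * (indicator U x * g x)"
        by eventually_elim (use True in auto)
      then show ?thesis by (rule tendsto_eventually)
    next
      case False
      have "\<forall>\<^sub>F n in sequentially. indicator {s..t} x * (indicator U x * g x) * \<phi> n x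
          = indicator {s<..t} x * (indicator U x * g x)"
        using eventually_ge_at_top[of N] by eventually_elim (use out False that in auto)
      then show ?thesis by (rule tendsto_eventually)
    qed
    moreover have "AE x in lborel. x \<noteq> t" by (rule AE_lborel_singleton)
    ultimately show "AE x in lborel. (\<lambda>n. indicator {s..t} x * (indicator U x * g x) * \<phi> n x)
        \<longlonglongrightarrow> indicator {s<..t} x * (indicator U x * g x)" by auto
    have "\<bar>\<phi> n x\<bar> \<le> 1" for n x
      using smoothstep_bounds[of "real n * (x - s)"] smoothstep_bounds[of "real n * (x - t) + 1"]
      unfolding \<phi>_def by linarith
    then have "\<bar>indicator {s..t} x * (indicator U x * g x) * \<phi> n x\<bar>
        \<le> \<bar>indicator {s - 1<..t} x * (indicator U x * g x)\<bar>" for n x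
      using mult_left_mono[of "\<bar>\<phi> n x\<bar>" 1 "\<bar>g x\<bar>"] by (auto simp: indicator_def abs_mult)
    then show "AE x in lborel. norm (indicator {s..t} x * (indicator U x * g x) * \<phi> n x)
        \<le> \<bar>indicator {s - 1<..t} x * (indicator U x * g x)\<bar>" for n by simp
  qed
  have "\<forall>\<^sub>F n in sequentially. (LINT x|lborel. indicator {s..t} x * (indicator U x * g x) * \<phi> n x)
      = (LINT x:U|lborel. g x * \<phi> n x)"
    using eventually_ge_at_top[of N]
  proof eventually_elim
    case (elim n)
    show ?case
      unfolding set_lebesgue_integral_def
    proof (rule Bochner_Integration.integral_cong)
      show "indicator {s..t} x * (indicator U x * g x) * \<phi> n x = indicator U x *\<^sub>R (g x * \<phi> n x)" for x
        using out[OF elim, of x] by (cases "x \<in> {s<..<t}") auto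
    qed simp
  qed
  then have "\<forall>\<^sub>F n in sequentially. - (LINT x|lborel. indicator {s..t} x * (indicator U x * g x) * \<phi> n x)
      = - (LINT x:U|lborel. g x * \<phi> n x)"
    by eventually_elim simp
  then have "(\<lambda>n. - (LINT x:U|lborel. g x * \<phi> n x))
      \<longlonglongrightarrow> - (LINT x|lborel. indicator {s<..t} x * (indicator U x * g x))"
    by (rule Lim_transform_eventually[OF tendsto_minus[OF lim2]])
  then have "u s - u t = - (LINT x|lborel. indicator {s<..t} x * (indicator U x * g x))"
    using lim1 LIMSEQ_unique by blast
  moreover have "(LINT x|lborel. indicator {s<..t} x * (indicator U x * g x)) = (LINT r:{s<..t}|lborel. g r)"
    unfolding set_lebesgue_integral_def
    by (rule Bochner_Integration.integral_cong) (use st(2) in \<open>auto simp: indicator_def subset_iff\<close>)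
  ultimately show ?thesis by simp
qed

section \<open>Uniqueness of weak derivatives\<close>

lemma AE_zero_of_Ioc_integrals:
  fixes h :: "real \<Rightarrow> real"
  assumes h: "integrable lborel h" and supp: "\<And>r. r \<notin> {a<..b} \<Longrightarrow> h r = 0"
    and zero: "\<And>s t. s < t \<Longrightarrow> (LINT r:{s<..t}|lborel. h r) = 0"
  shows "AE r in lborel. h r = 0"
proof (rule density_unique_real)
  show "integrable lborel h" "integrable lborel (\<lambda>r::real. 0::real)" by (auto simp: h)
  have int: "set_integrable lborel A h" if "A \<in> sets lborel" for A
    using integrable_mult_indicator[OF that h] by (simp add: set_integrable_def)
  have Ioc: "(LINT r:{s<..t}|lborel. h r) = 0" for s t
    using zero[of s t] by (cases "s < t") (auto simp: set_lebesgue_integral_def)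
  \<comment> \<open>Passing to complements requires the integral over the whole line, and this is
    where the bounded support enters.\<close>
  have UNIV: "(LINT r:UNIV|lborel. h r) = 0"
  proof -
    have "(LINT r:UNIV|lborel. h r) = (LINT r:{a<..b}|lborel. h r)"
      unfolding set_lebesgue_integral_def
      by (rule Bochner_Integration.integral_cong) (use supp in \<open>auto simp: indicator_def\<close>)
    then show ?thesis using Ioc by simp
  qed
  fix A :: "real set" assume "A \<in> sets lborel"
  then have A: "A \<in> sigma_sets UNIV (range (\<lambda>(a, b). {a <.. b::real}))"
    by (simp add: borel_sigma_sets_Ioc)
  have sets: "A \<in> sigma_sets UNIV (range (\<lambda>(a, b). {a <.. b::real})) \<longleftrightarrow> A \<in> sets lborel" for A
    by (simp add: borel_sigma_sets_Ioc)
  \<comment> \<open>A Dynkin argument: half-open intervals are an intersection-stable generator of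
    the Borel sets, and the sets over which \<open>h\<close> integrates to 0 are closed under
    complements and countable disjoint unions.\<close>
  have "Int_stable (range (\<lambda>(a, b). {a <.. b::real}))"
    unfolding Int_stable_def by (auto simp: greaterThanAtMost_def Int_Collect) (metis Int_greaterThanAtMost greaterThanAtMost_def rangeI case_prod_conv)
  then have "(LINT r:A|lborel. h r) = 0"
    using _ A
  proof (rule sigma_sets_induct_disjoint)
    show "range (\<lambda>(a, b). {a <.. b::real}) \<subseteq> Pow UNIV" by simp
    fix A assume "A \<in> range (\<lambda>(a, b). {a <.. b::real})"
    then show "(LINT r:A|lborel. h r) = 0" using Ioc by auto
  next
    show "(LINT r:{}|lborel. h r) = 0" by (simp add: set_lebesgue_integral_def)
  next
    fix A assume A: "A \<in> sigma_sets UNIV (range (\<lambda>(a, b). {a <.. b::real}))" "(LINT r:A|lborel. h r) = 0"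
    then have "(LINT r:A \<union> (UNIV - A)|lborel. h r) = (LINT r:A|lborel. h r) + (LINT r:UNIV - A|lborel. h r)"
      using sets by (intro set_integral_Un int) auto
    then show "(LINT r:UNIV - A|lborel. h r) = 0"
      using A UNIV by simp
  next
    fix A :: "nat \<Rightarrow> real set"
    assume A: "disjoint_family A" "range A \<subseteq> sigma_sets UNIV (range (\<lambda>(a, b). {a <.. b::real}))"
      "\<And>i. (LINT r:A i|lborel. h r) = 0"
    have A_sets: "A i \<in> sets lborel" for i
      using A(2) sets[of "A i"] by blast
    have "(LINT r:(\<Union>i. A i)|lborel. h r) = (\<Sum>i. (LINT r:A i|lborel. h r))"
      using A(1) A_sets
      by (intro lebesgue_integral_countable_add int sets.countable_UN) (auto simp: disjoint_family_on_def)
    then show "(LINT r:(\<Union>i. A i)|lborel. h r) = 0" using A(3) by simp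
  qed
  then show "(LINT r:A|lborel. h r) = (LINT r:A|lborel. 0)"
    by (simp add: set_lebesgue_integral_def)
qed

text \<open>Compact intervals with rational endpoints cover the open set and are countable in
  number, so null sets found on each of them can be united.\<close>

lemma AE_zero_on_open:
  assumes U: "open U" and h: "L2 (\<lambda>r. indicator U r * h r)"
    and zero: "\<And>s t. s < t \<Longrightarrow> {s..t} \<subseteq> U \<Longrightarrow> (LINT r:{s<..t}|lborel. h r) = 0"
  shows "AE r in lborel. r \<in> U \<longrightarrow> h r = 0"
proof -
  have loc: "AE r in lborel. r \<in> {a<..b} \<longrightarrow> h r = 0" if ab: "{a..b} \<subseteq> U" for a b
  proof -
    define k where "k r = indicator {a<..b} r * (indicator U r * h r)" for r
    have k_eq: "k r = indicator {a<..b} r * h r" for r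
      using ab by (auto simp: k_def indicator_def subset_iff)
    have "AE r in lborel. k r = 0"
    proof (rule AE_zero_of_Ioc_integrals)
      show "integrable lborel k"
        using L2_set_integrable[OF h, of a b] by (simp add: k_def[abs_def] set_integrable_def)
      show "k r = 0" if "r \<notin> {a<..b}" for r using that by (simp add: k_def)
      fix s t :: real assume "s < t"
      have "(LINT r:{s<..t}|lborel. k r) = (LINT r:{max a s<..min b t}|lborel. h r)"
        unfolding set_lebesgue_integral_def
        by (rule Bochner_Integration.integral_cong) (auto simp: k_eq indicator_def)
      also have "\<dots> = 0"
      proof (cases "max a s < min b t")
        case True
        moreover have "{max a s..min b t} \<subseteq> U" using ab by auto
        ultimately show ?thesis by (rule zero)
      qed (auto simp: set_lebesgue_integral_def)
      finally show "(LINT r:{s<..t}|lborel. k r) = 0" .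
    qed
    then show ?thesis by eventually_elim (auto simp: k_eq)
  qed
  define Q where "Q = {(a, b). a \<in> \<rat> \<and> b \<in> \<rat> \<and> {a..b} \<subseteq> U}"
  have "Q \<subseteq> \<rat> \<times> \<rat>" by (auto simp: Q_def)
  then have "countable Q"
    by (rule countable_subset) (simp add: countable_rat)
  then have "AE r in lborel. \<forall>p\<in>Q. r \<in> {fst p<..snd p} \<longrightarrow> h r = 0"
    using loc by (subst AE_ball_countable) (auto simp: Q_def)
  then show ?thesis
  proof eventually_elim
    case (elim r)
    show ?case
    proof
      assume "r \<in> U"
      then obtain e where e: "e > 0" "cball r e \<subseteq> U"
        using U open_contains_cball by blast
      obtain a where a: "a \<in> \<rat>" "r - e < a" "a < r"
        using Rats_dense_in_real[of "r - e" r] e by auto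
      obtain b where b: "b \<in> \<rat>" "r < b" "b < r + e"
        using Rats_dense_in_real[of r "r + e"] e by auto
      have "{a..b} \<subseteq> cball r e" using a b by (auto simp: dist_real_def)
      then have "(a, b) \<in> Q" using a b e by (auto simp: Q_def)
      then show "h r = 0" using elim a b by fastforce
    qed
  qed
qed

text \<open>This makes the choice by \<open>SOME\<close> in \<open>weak_deriv\<close> harmless:
  whatever weak derivative a construction produces agrees with the chosen one almost everywhere. Two
  weak derivatives have the same integrals over compact subintervals, namely the increments of
  \<open>u\<close>.\<close>

lemma weak_derivative_unique:
  assumes U: "open U" and u: "continuous_on U u"
    and g: "sq_integrable_on U g" "weak_derivative_on U u g"
    and h: "sq_integrable_on U h" "weak_derivative_on U u h"
  shows "AE r in lborel. r \<in> U \<longrightarrow> g r = h r"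
proof -
  have L: "L2 (\<lambda>r. indicator U r * g r)" "L2 (\<lambda>r. indicator U r * h r)"
    using g h by (auto simp: sq_integrable_on_iff)
  have "AE r in lborel. r \<in> U \<longrightarrow> g r - h r = 0"
  proof (rule AE_zero_on_open[OF U])
    have "(\<lambda>r. indicator U r * (g r - h r))
        = (\<lambda>r. indicator U r * g r + (- 1) * (indicator U r * h r))"
      by (auto simp: algebra_simps)
    then show "L2 (\<lambda>r. indicator U r * (g r - h r))"
      using L2_add[OF L(1) L2_scale[OF L(2), of "- 1"]] by simp
    fix s t :: real assume st: "s < t" "{s..t} \<subseteq> U"
    have cont: "continuous_on {s..t} u" using u st(2) continuous_on_subset by blast
    have eq: "(LINT r:{s<..t}|lborel. indicator U r * f r) = (LINT r:{s<..t}|lborel. f r)"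
      for f :: "real \<Rightarrow> real"
      unfolding set_lebesgue_integral_def
      by (rule Bochner_Integration.integral_cong) (use st(2) in \<open>auto simp: indicator_def subset_iff\<close>)
    have "(LINT r:{s<..t}|lborel. indicator U r * g r - indicator U r * h r)
        = (LINT r:{s<..t}|lborel. indicator U r * g r) - (LINT r:{s<..t}|lborel. indicator U r * h r)"
      by (rule set_integral_diff) (use L L2_set_integrable in auto)
    also have "\<dots> = 0"
      unfolding eq using weak_derivative_integral[OF cont g(2) L(1) st]
        weak_derivative_integral[OF cont h(2) L(2) st] by simp
    finally show "(LINT r:{s<..t}|lborel. g r - h r) = 0"
      using eq[of "\<lambda>r. g r - h r"] by (simp add: right_diff_distrib)
  qed
  then show ?thesis by simp
qed

lemma weak_deriv:
  assumes "sobolev_H1_on U u"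
  shows "sq_integrable_on U (weak_deriv U u)" "weak_derivative_on U u (weak_deriv U u)"
proof -
  have "\<exists>g. sq_integrable_on U g \<and> weak_derivative_on U u g"
    using assms by (simp add: sobolev_H1_on_def)
  from someI_ex[OF this] show "sq_integrable_on U (weak_deriv U u)"
    "weak_derivative_on U u (weak_deriv U u)" by (auto simp: weak_deriv_def)
qed

section \<open>Primitives of square-integrable functions are Sobolev functions\<close>

lemma integrable_product_lborel:
  fixes h k :: "real \<Rightarrow> real"
  assumes "integrable lborel h" "integrable lborel k"
  shows "integrable (lborel \<Otimes>\<^sub>M lborel) (\<lambda>(x, y). h x * k y)"
proof (rule lborel_pair.Fubini_integrable)
  have [measurable]: "h \<in> borel_measurable borel" "k \<in> borel_measurable borel"
    using assms by (auto dest: borel_measurable_integrable)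
  show "(\<lambda>(x, y). h x * k y) \<in> borel_measurable (lborel \<Otimes>\<^sub>M lborel)"
    by measurable
  have "integrable lborel (\<lambda>x. \<bar>h x\<bar> * (LINT y|lborel. \<bar>k y\<bar>))"
    using assms by simp
  then show "integrable lborel (\<lambda>x. LINT y|lborel. norm (case (x, y) of (x, y) \<Rightarrow> h x * k y))"
    by (simp add: abs_mult)
  show "AE x in lborel. integrable lborel (\<lambda>y. case (x, y) of (x, y) \<Rightarrow> h x * k y)"
    using assms by simp
qed

lemma derivative_zero_off_support:
  assumes "\<forall>t. (\<phi> has_real_derivative \<phi>' t) (at t)" "t \<notin> closure {t. \<phi> t \<noteq> 0}"
  shows "\<phi>' t = 0"
proof -
  have "(\<phi> has_real_derivative 0) (at t)"
  proof (rule has_field_derivative_transform_within_open)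
    show "((\<lambda>_. 0) has_real_derivative 0) (at t)" by simp
    show "open (- closure {t. \<phi> t \<noteq> 0})" by auto
    show "t \<in> - closure {t. \<phi> t \<noteq> 0}" using assms by blast
    show "0 = \<phi> s" if "s \<in> - closure {t. \<phi> t \<noteq> 0}" for s
      using closure_subset[of "{t. \<phi> t \<noteq> 0}"] that by auto
  qed
  then show ?thesis using assms DERIV_unique by blast
qed

text \<open>Integration by parts through Fubini: \<open>g r * \<phi>' t\<close> is integrated over
  the triangle \<open>a < r \<le> t \<le> b\<close>. Integrating in \<open>r\<close> first produces
  \<open>u t - u a\<close>, integrating in \<open>t\<close> first produces
  \<open>- \<phi> r\<close>. The constant \<open>u a\<close> contributes nothing because
  \<open>\<phi>'\<close> has integral 0.\<close>

lemma AC2_weak_derivative: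
  assumes ab: "a < b" and AC: "AC2 a b u g"
  shows "weak_derivative_on {a<..<b} u g"
  unfolding weak_derivative_on_def
proof (intro allI impI, elim conjE)
  fix \<phi> \<phi>' :: "real \<Rightarrow> real"
  assume D: "\<forall>t. (\<phi> has_real_derivative \<phi>' t) (at t)" and cont': "continuous_on UNIV \<phi>'"
    and supp: "closure {t. \<phi> t \<noteq> 0} \<subseteq> {a<..<b}"
  have L2g: "L2 g" using AC by (simp add: AC2_def)
  have phi0: "\<phi> t = 0" if "t \<notin> {a<..<b}" for t
    using supp closure_subset[of "{t. \<phi> t \<noteq> 0}"] that by blast
  have phi'0: "\<phi>' t = 0" if "t \<notin> {a<..<b}" for t
    using derivative_zero_off_support[OF D] supp that by blast
  have c': "continuous_on S \<phi>'" for S using cont' continuous_on_subset by blast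
  have [measurable]: "\<phi>' \<in> borel_measurable borel"
    using cont' by (rule borel_measurable_continuous_onI)
  have [measurable]: "g \<in> borel_measurable borel" using L2g by measurable
  have "bounded (\<phi>' ` {a..b})"
    using c' compact_Icc compact_continuous_image compact_imp_bounded by blast
  then obtain B where B: "\<And>t. t \<in> {a..b} \<Longrightarrow> \<bar>\<phi>' t\<bar> \<le> B"
    unfolding bounded_iff by (metis imageI real_norm_def)
  have FTC: "(LINT t:{r..b}|lborel. \<phi>' t) = \<phi> b - \<phi> r" if "r \<le> b" for r
    unfolding set_lebesgue_integral_def
    by (rule integral_FTC_Icc[OF that _ c'])
      (use D in \<open>auto simp: has_real_derivative_iff_has_vector_derivative[symmetric]
         intro: has_field_derivative_at_within\<close>)
  define F where "F r t = (if a < r \<and> r \<le> t \<and> t \<le> b then g r * \<phi>' t else 0)" for r t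
  have "integrable (lborel \<Otimes>\<^sub>M lborel) (\<lambda>(r, t). F r t)"
  proof (rule Bochner_Integration.integrable_bound)
    show "integrable (lborel \<Otimes>\<^sub>M lborel) (\<lambda>(r, t). (indicator {a<..b} r * g r) * (B * indicator {a..b} t))"
    proof (rule integrable_product_lborel)
      show "integrable lborel (\<lambda>r. indicator {a<..b} r * g r)"
        using L2_set_integrable[OF L2g, of a b] by (simp add: set_integrable_def)
      show "integrable lborel (\<lambda>t. B * indicator {a..b} t)"
        using ab by (auto intro!: integrable_real_indicator)
    qed
    show "(\<lambda>(r, t). F r t) \<in> borel_measurable (lborel \<Otimes>\<^sub>M lborel)"
      unfolding F_def by measurable
    have "\<bar>F r t\<bar> \<le> \<bar>(indicator {a<..b} r * g r) * (B * indicator {a..b} t)\<bar>" for r t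
    proof (cases "a < r \<and> r \<le> t \<and> t \<le> b")
      case True
      then have "\<bar>\<phi>' t\<bar> \<le> \<bar>B\<bar>" using B[of t] by auto
      then show ?thesis using True by (auto simp: F_def abs_mult intro: mult_left_mono)
    qed (auto simp: F_def)
    then show "AE x in lborel \<Otimes>\<^sub>M lborel. norm (case x of (r, t) \<Rightarrow> F r t)
        \<le> norm (case x of (r, t) \<Rightarrow> (indicator {a<..b} r * g r) * (B * indicator {a..b} t))"
      by (auto simp: split_beta)
  qed
  then have Fub: "(LINT t|lborel. LINT r|lborel. F r t) = (LINT r|lborel. LINT t|lborel. F r t)"
    by (rule lborel_pair.Fubini_integral)
  have inner1: "(LINT r|lborel. F r t) = indicator {a<..<b} t *\<^sub>R ((u t - u a) * \<phi>' t)" for t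
  proof (cases "t \<in> {a<..<b}")
    case True
    have "(LINT r|lborel. F r t) = (LINT r|lborel. (indicator {a<..t} r *\<^sub>R g r) * \<phi>' t)"
      by (rule Bochner_Integration.integral_cong) (use True in \<open>auto simp: F_def indicator_def\<close>)
    also have "\<dots> = (LINT r:{a<..t}|lborel. g r) * \<phi>' t"
      unfolding set_lebesgue_integral_def by simp
    also have "(LINT r:{a<..t}|lborel. g r) = u t - u a"
      using AC True by (simp add: AC2_def)
    finally show ?thesis using True by simp
  next
    case False
    then have "F r t = 0" for r using phi'0[OF False] by (simp add: F_def)
    then show ?thesis using False by simp
  qed
  have inner2: "(LINT t|lborel. F r t) = - (indicator {a<..<b} r *\<^sub>R (g r * \<phi> r))" for r
  proof (cases "r \<in> {a<..b}")
    case True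
    have "(LINT t|lborel. F r t) = (LINT t|lborel. g r * (indicator {r..b} t *\<^sub>R \<phi>' t))"
      by (rule Bochner_Integration.integral_cong) (use True in \<open>auto simp: F_def indicator_def\<close>)
    also have "\<dots> = g r * (\<phi> b - \<phi> r)"
      using FTC[of r] True unfolding set_lebesgue_integral_def by simp
    finally show ?thesis using True phi0[of b] phi0[of r] by (cases "r = b") auto
  next
    case False
    then have "F r t = 0" for t by (auto simp: F_def)
    moreover have "\<phi> r = 0" using phi0[of r] False by auto
    ultimately show ?thesis by simp
  qed
  have const: "(LINT t:{a<..<b}|lborel. u a * \<phi>' t) = 0"
  proof -
    have "(LINT t:{a<..<b}|lborel. u a * \<phi>' t) = u a * (LINT t:{a..b}|lborel. \<phi>' t)"
      unfolding set_lebesgue_integral_def integral_mult_right_zero[symmetric]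
    proof (rule Bochner_Integration.integral_cong)
      show "indicator {a<..<b} x *\<^sub>R (u a * \<phi>' x) = u a * (indicator {a..b} x *\<^sub>R \<phi>' x)" for x
        using phi'0[of x] by (cases "x \<in> {a<..<b}") auto
    qed simp
    then show ?thesis using FTC[of a] phi0 ab by simp
  qed
  have contu: "continuous_on {a..b} u" using AC by (rule AC2_continuous_on)
  have i1: "set_integrable lborel {a<..<b} (\<lambda>t. (u t - u a) * \<phi>' t)"
    by (rule set_integrable_subset[OF borel_integrable_atLeastAtMost'[of a b]])
      (auto intro!: continuous_intros contu c')
  have i2: "set_integrable lborel {a<..<b} (\<lambda>t. u a * \<phi>' t)"
    by (rule set_integrable_subset[OF borel_integrable_atLeastAtMost'[of a b]])
      (auto intro!: continuous_intros c')
  have "(LINT t:{a<..<b}|lborel. u t * \<phi>' t)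
      = (LINT t:{a<..<b}|lborel. (u t - u a) * \<phi>' t + u a * \<phi>' t)"
    by (simp add: algebra_simps)
  also have "\<dots> = (LINT t:{a<..<b}|lborel. (u t - u a) * \<phi>' t) + (LINT t:{a<..<b}|lborel. u a * \<phi>' t)"
    using i1 i2 by (rule set_integral_add(2))
  also have "\<dots> = (LINT t|lborel. LINT r|lborel. F r t)"
    unfolding const inner1 by (simp add: set_lebesgue_integral_def)
  also have "\<dots> = - (LINT t:{a<..<b}|lborel. g t * \<phi> t)"
    unfolding Fub inner2 by (simp add: set_lebesgue_integral_def)
  finally show "(LINT t:{a<..<b}|lborel. u t * \<phi>' t) = - (LINT t:{a<..<b}|lborel. g t * \<phi> t)" .
qed

lemma sq_integrable_on_continuous:
  assumes "continuous_on {a..b} u"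
  shows "sq_integrable_on {a<..<b} u"
proof -
  have "set_integrable lborel {a<..<b} u" "set_integrable lborel {a<..<b} (\<lambda>r. (u r)\<^sup>2)"
    using assms
    by (auto intro!: set_integrable_subset[OF borel_integrable_atLeastAtMost'[of a b]] continuous_intros)
  then show ?thesis
    by (simp add: sq_integrable_on_def set_borel_measurable_def set_integrable_def borel_measurable_integrable)
qed

lemma AC2_sobolev:
  assumes "a < b" "AC2 a b u g"
  shows "sobolev_H1_on {a<..<b} u" "AE r in lborel. r \<in> {a<..<b} \<longrightarrow> weak_deriv {a<..<b} u r = g r"
proof -
  have g: "sq_integrable_on {a<..<b} g"
    using assms L2_indicator[of g "{a<..<b}"] by (auto simp: sq_integrable_on_iff AC2_def)
  have wd: "weak_derivative_on {a<..<b} u g" by (rule AC2_weak_derivative) fact+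
  have cont: "continuous_on {a..b} u" using assms(2) by (rule AC2_continuous_on)
  show s: "sobolev_H1_on {a<..<b} u"
    using g wd sq_integrable_on_continuous[OF cont] by (auto simp: sobolev_H1_on_def)
  show "AE r in lborel. r \<in> {a<..<b} \<longrightarrow> weak_deriv {a<..<b} u r = g r"
    by (rule weak_derivative_unique[OF _ _ weak_deriv[OF s] g wd])
      (auto intro: continuous_on_subset[OF cont])
qed

lemma sobolev_AC2:
  assumes "a < b" "continuous_on {a..b} u" "sobolev_H1_on {a<..<b} u"
  shows "AC2 a b u (\<lambda>r. indicator {a<..<b} r * weak_deriv {a<..<b} u r)"
proof (rule AC2_from_interior)
  note wd = weak_deriv[OF assms(3)]
  show L: "L2 (\<lambda>r. indicator {a<..<b} r * weak_deriv {a<..<b} u r)"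
    using wd(1) by (simp add: sq_integrable_on_iff)
  fix s t assume st: "a < s" "s \<le> t" "t < b"
  have "(LINT r:{s<..t}|lborel. indicator {a<..<b} r * weak_deriv {a<..<b} u r)
      = (LINT r:{s<..t}|lborel. weak_deriv {a<..<b} u r)"
    unfolding set_lebesgue_integral_def
    by (rule Bochner_Integration.integral_cong) (use st in \<open>auto simp: indicator_def\<close>)
  moreover have "u t - u s = (LINT r:{s<..t}|lborel. weak_deriv {a<..<b} u r)"
  proof (cases "s = t")
    case False
    show ?thesis
      by (rule weak_derivative_integral[OF _ wd(2) L])
        (use st False assms(2) in \<open>auto intro: continuous_on_subset\<close>)
  qed (simp add: set_lebesgue_integral_def)
  ultimately show "u t - u s
      = (LINT r:{s<..t}|lborel. indicator {a<..<b} r * weak_deriv {a<..<b} u r)" by simp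
qed (use assms in auto)


section \<open>Extension by zero and interpolation on the line\<close>

text \<open>Components are relatively closed, so an endpoint lying in \<open>W\<close> would belong
  to its own component, which is open and has no extreme points.\<close>

lemma open_connected_real:
  fixes C W :: "real set"
  assumes "C \<in> components W" "open W" "bounded W"
  obtains \<alpha> \<beta> where "C = {\<alpha><..<\<beta>}" "\<alpha> < \<beta>" "\<alpha> \<notin> W" "\<beta> \<notin> W" "\<alpha> \<in> closure W" "\<beta> \<in> closure W"
proof -
  have ne: "C \<noteq> {}" and conn: "Topological_Spaces.connected C" and sub: "C \<subseteq> W" and op: "open C"
    using assms in_components_nonempty in_components_connected in_components_subset open_components
    by blast+
  have "bounded C" using sub assms(3) bounded_subset by blast
  then have bdd: "bdd_above C" "bdd_below C"
    by (auto intro: bounded_imp_bdd_above bounded_imp_bdd_below)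
  have closed: "closedin (top_of_set W) C" using assms(1) by (rule closedin_component)
  then obtain T where T: "closed T" "C = W \<inter> T" by (auto simp: closedin_closed)
  have cl: "x \<in> C" if "x \<in> closure C" "x \<in> W" for x
    using T that closure_minimal[of C T] by blast
  have ends: "Inf C \<in> closure C" "Sup C \<in> closure C"
    using closure_contains_Inf[OF ne bdd(2)] closure_contains_Sup[OF ne bdd(1)] by auto
  have notin: "Inf C \<notin> C" "Sup C \<notin> C"
  proof -
    show "Inf C \<notin> C"
    proof
      assume "Inf C \<in> C"
      then obtain e where "e > 0" "ball (Inf C) e \<subseteq> C" using op openE by blast
      then have "Inf C - e / 2 \<in> C" by (auto simp: dist_real_def subset_iff)
      then have "Inf C \<le> Inf C - e / 2" using bdd(2) cInf_lower by blast
      then show False using \<open>e > 0\<close> by simp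
    qed
    show "Sup C \<notin> C"
    proof
      assume "Sup C \<in> C"
      then obtain e where "e > 0" "ball (Sup C) e \<subseteq> C" using op openE by blast
      then have "Sup C + e / 2 \<in> C" by (auto simp: dist_real_def subset_iff)
      then have "Sup C + e / 2 \<le> Sup C" using bdd(1) cSup_upper by blast
      then show False using \<open>e > 0\<close> by simp
    qed
  qed
  have eq: "C = {Inf C<..<Sup C}"
  proof (intro equalityI subsetI)
    fix x assume x: "x \<in> C"
    then have "Inf C \<le> x" "x \<le> Sup C" using bdd cInf_lower cSup_upper by blast+
    then show "x \<in> {Inf C<..<Sup C}" using notin x
      by (metis greaterThanLessThan_iff order_le_less)
  next
    fix x assume x: "x \<in> {Inf C<..<Sup C}"
    then obtain y z where yz: "y \<in> C" "z \<in> C" "y < x" "x < z"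
      using less_cSup_iff[OF ne bdd(1)] cInf_less_iff[OF ne bdd(2)] by auto
    have "is_interval C" using conn is_interval_connected_1 by blast
    then show "x \<in> C" using yz unfolding is_interval_1 by (meson less_imp_le)
  qed
  show thesis
  proof (rule that[OF eq])
    show "Inf C < Sup C" using eq ne by force
    show "Inf C \<notin> W" "Sup C \<notin> W" using cl ends notin by blast+
    show "Inf C \<in> closure W" "Sup C \<in> closure W" using ends closure_mono[OF sub] by blast+
  qed
qed

text \<open>Between two zeros of \<open>u\<close> the integral of the derivative is the sum of its integrals over the
  components of \<open>U\<close>, and each of these vanishes because \<open>u\<close> is zero at both ends.\<close>

lemma zero_extension_integral:
  fixes u g :: "real \<Rightarrow> real"
  assumes U: "open U" and L: "L2 g" and g0: "\<And>r. r \<notin> U \<Longrightarrow> g r = 0"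
    and u: "continuous_on {s..t} u" and u0: "\<And>r. r \<in> {s..t} \<Longrightarrow> r \<notin> U \<Longrightarrow> u r = 0"
    and int: "\<And>p q. s \<le> p \<Longrightarrow> p < q \<Longrightarrow> q \<le> t \<Longrightarrow> {p..q} \<subseteq> U \<Longrightarrow> u q - u p = (LINT r:{p<..q}|lborel. g r)"
    and st: "s \<le> t"
  shows "u t - u s = (LINT r:{s<..t}|lborel. g r)"
proof -
  \<comment> \<open>Here the endpoints may lie outside \<open>U\<close>; continuity of
    \<open>u\<close> extends the hypothesis to such intervals.\<close>
  have step1: "u q - u p = (LINT r:{p<..q}|lborel. g r)"
    if "s \<le> p" "p \<le> q" "q \<le> t" "{p<..<q} \<subseteq> U" for p q
  proof (cases "p = q")
    case True
    then show ?thesis by (simp add: set_lebesgue_integral_def)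
  next
    case False
    have "AC2 p q u g"
    proof (rule AC2_from_interior)
      show "p < q" using False that by simp
      show "continuous_on {p..q} u" by (rule continuous_on_subset[OF u]) (use that in auto)
      fix a b assume ab: "p < a" "a \<le> b" "b < q"
      show "u b - u a = (LINT r:{a<..b}|lborel. g r)"
      proof (cases "a = b")
        case False
        have "{a..b} \<subseteq> U" using that(4) ab by (meson atLeastAtMost_iff greaterThanLessThan_iff order_le_less_trans order_less_le_trans subset_iff)
        then show ?thesis using int[of a b] ab that False by auto
      qed (simp add: set_lebesgue_integral_def)
    qed (rule L)
    then show ?thesis using that by (simp add: AC2_def)
  qed
  have step2: "(LINT r:{p<..q}|lborel. g r) = 0"
    if p: "p \<in> {s..t}" "p \<notin> U" and q: "q \<in> {s..t}" "q \<notin> U" and pq: "p \<le> q" for p q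
  proof -
    define W where "W = U \<inter> {p<..<q}"
    have W: "open W" "bounded W" "W \<subseteq> {p..q}"
      using U bounded_subset[of "{p..q}" W] by (auto simp: W_def)
    then have clW: "closure W \<subseteq> {p..q}" by (simp add: closure_minimal)
    have "countable (components W)"
      using W(1) open_components pairwise_disjoint_components[of W]
      by (intro countable_disjoint_open_subsets) (auto simp: disjoint_def pairwise_def disjnt_def)
    \<comment> \<open>Countable additivity is stated for sequences, so the components are listed by
      their codes, with the empty set at the codes that are not taken.\<close>
    define A where "A i = (if i \<in> to_nat_on (components W) ` components W
        then from_nat_into (components W) i else {})" for i
    note cnt = \<open>countable (components W)\<close>
    have A_C: "A (to_nat_on (components W) C) = C" if "C \<in> components W" for C
      using that cnt by (auto simp: A_def)
    have A_cases: "A i = {} \<or> A i \<in> components W" for i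
      using A_C by (auto simp: A_def)
    have A_Un: "(\<Union>i. A i) = W"
    proof
      show "(\<Union>i. A i) \<subseteq> W" using A_cases in_components_subset by blast
      show "W \<subseteq> (\<Union>i. A i)"
      proof
        fix x assume "x \<in> W"
        then obtain C where "C \<in> components W" "x \<in> C" using Union_components[of W] by blast
        then show "x \<in> (\<Union>i. A i)" using A_C by blast
      qed
    qed
    have A_disj: "A i \<inter> A j = {}" if "i \<noteq> j" for i j
    proof (rule ccontr)
      assume ne: "A i \<inter> A j \<noteq> {}"
      then have "A i \<in> components W" "A j \<in> components W" using A_cases by blast+
      then have eq: "A i = A j" using ne components_nonoverlap by blast
      have "i \<in> to_nat_on (components W) ` components W" "j \<in> to_nat_on (components W) ` components W"
        using ne by (auto simp: A_def split: if_splits)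
      then obtain C D where "C \<in> components W" "i = to_nat_on (components W) C"
        "D \<in> components W" "j = to_nat_on (components W) D" by blast
      then show False using eq A_C \<open>i \<noteq> j\<close> by metis
    qed
    have A_sets: "A i \<in> sets lborel" for i
      using A_cases[of i] open_components[OF W(1)] by auto
    have A_zero: "(LINT r:A i|lborel. g r) = 0" for i
    proof (cases "A i = {}")
      case False
      then have "A i \<in> components W" using A_cases by blast
      then obtain \<alpha> \<beta> where C: "A i = {\<alpha><..<\<beta>}" "\<alpha> < \<beta>" "\<alpha> \<notin> W" "\<beta> \<notin> W"
        "\<alpha> \<in> closure W" "\<beta> \<in> closure W"
        using open_connected_real[OF _ W(1,2)] by metis
      then have in_pq: "\<alpha> \<in> {p..q}" "\<beta> \<in> {p..q}" using clW by auto
      then have notU: "\<alpha> \<notin> U" "\<beta> \<notin> U" using C(3,4) p(2) q(2) by (auto simp: W_def order_le_less)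
      have "{\<alpha><..<\<beta>} \<subseteq> U" using C(1) \<open>A i \<in> components W\<close> in_components_subset by (auto simp: W_def)
      then have "(LINT r:{\<alpha><..\<beta>}|lborel. g r) = u \<beta> - u \<alpha>"
        using step1[of \<alpha> \<beta>] in_pq p q C(2) by auto
      also have "\<dots> = 0" using u0 notU in_pq p q by auto
      finally have "(LINT r:{\<alpha><..\<beta>}|lborel. g r) = 0" .
      \<comment> \<open>The open and the half-open interval differ by an endpoint outside
        \<open>U\<close>, where \<open>g\<close> is 0.\<close>
      moreover have "(LINT r:A i|lborel. g r) = (LINT r:{\<alpha><..\<beta>}|lborel. g r)"
        unfolding set_lebesgue_integral_def C(1)
        by (rule Bochner_Integration.integral_cong) (use g0 notU in \<open>auto simp: indicator_def\<close>)
      ultimately show ?thesis by simp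
    qed (simp add: set_lebesgue_integral_def)
    have "(LINT r:{p<..q}|lborel. g r) = (LINT r:W|lborel. g r)"
      unfolding set_lebesgue_integral_def
    proof (rule Bochner_Integration.integral_cong)
      show "indicator {p<..q} x *\<^sub>R g x = indicator W x *\<^sub>R g x" for x
        using g0[of x] q(2) by (cases "x \<in> U") (auto simp: indicator_def W_def)
    qed simp
    also have "\<dots> = (\<Sum>i. LINT r:A i|lborel. g r)"
      unfolding A_Un[symmetric]
    proof (rule lebesgue_integral_countable_add[OF A_sets A_disj])
      show "set_integrable lborel (\<Union>i. A i) g"
        unfolding A_Un
        by (rule set_integrable_subset[OF L2_set_integrable[OF L, of p q]]) (use W(1) in \<open>auto simp: W_def\<close>)
    qed
    finally show ?thesis using A_zero by simp
  qed
  show ?thesis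
  proof (cases "{s..t} \<subseteq> U")
    case True
    then show ?thesis using step1[of s t] st by (meson dual_order.refl greaterThanLessThan_subseteq_atLeastAtMost_iff subset_trans)
  next
    case False
    \<comment> \<open>Between the first and the last point outside \<open>U\<close>, neither
      \<open>u\<close> nor the integral of \<open>g\<close> changes in total; the two outer pieces
      lie in \<open>U\<close> except possibly at their ends.\<close>
    define Z where "Z = {s..t} - U"
    have Z: "compact Z" "Z \<noteq> {}" using U False by (auto simp: Z_def compact_diff)
    obtain p where p: "p \<in> Z" "\<And>z. z \<in> Z \<Longrightarrow> p \<le> z" using compact_attains_inf[OF Z] by blast
    obtain q where q: "q \<in> Z" "\<And>z. z \<in> Z \<Longrightarrow> z \<le> q" using compact_attains_sup[OF Z] by blast
    have in_st: "s \<le> p" "p \<le> q" "q \<le> t" using p q by (auto simp: Z_def)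
    have "{s<..<p} \<subseteq> U"
    proof
      fix x assume "x \<in> {s<..<p}"
      then show "x \<in> U" using p(2)[of x] in_st by (auto simp: Z_def)
    qed
    then have 1: "u p - u s = (LINT r:{s<..p}|lborel. g r)" using step1 in_st by auto
    have "{q<..<t} \<subseteq> U"
    proof
      fix x assume "x \<in> {q<..<t}"
      then show "x \<in> U" using q(2)[of x] in_st by (auto simp: Z_def)
    qed
    then have 2: "u t - u q = (LINT r:{q<..t}|lborel. g r)" using step1 in_st by auto
    have 3: "(LINT r:{p<..q}|lborel. g r) = 0" using step2 p(1) q(1) in_st by (auto simp: Z_def)
    have "u p = 0" "u q = 0" using u0 p(1) q(1) by (auto simp: Z_def)
    moreover have "(LINT r:{s<..t}|lborel. g r) = (LINT r:{s<..p}|lborel. g r) + (LINT r:{p<..t}|lborel. g r)"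
      "(LINT r:{p<..t}|lborel. g r) = (LINT r:{p<..q}|lborel. g r) + (LINT r:{q<..t}|lborel. g r)"
      using set_lebesgue_integral_Ioc_split[of s t g p] set_lebesgue_integral_Ioc_split[of p t g q]
        L2_set_integrable[OF L] in_st by simp_all
    ultimately show ?thesis using 1 2 3 by simp
  qed
qed

section \<open>Joining and interpolating primitives\<close>

lemma AC2_subinterval: "AC2 a b u g \<Longrightarrow> a \<le> c \<Longrightarrow> d \<le> b \<Longrightarrow> AC2 c d u g"
  by (auto simp: AC2_def)

lemma AC2_join:
  assumes 1: "AC2 a m u1 g1" and 2: "AC2 m b u2 g2" and eq: "u1 m = u2 m"
  shows "AC2 a b (\<lambda>t. if t \<le> m then u1 t else u2 t) (\<lambda>r. if r \<le> m then g1 r else g2 r)"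
proof -
  let ?g = "\<lambda>r. if r \<le> m then g1 r else g2 r"
  have "L2 (\<lambda>r. indicator {..m} r * g1 r + indicator {m<..} r * g2 r)"
    using 1 2 by (intro L2_add L2_indicator) (auto simp: AC2_def)
  also have "(\<lambda>r. indicator {..m} r * g1 r + indicator {m<..} r * g2 r) = ?g"
    by auto
  finally have L: "L2 ?g" .
  have left: "(LINT r:{s<..t}|lborel. ?g r) = (LINT r:{s<..t}|lborel. g1 r)" if "t \<le> m" for s t
    unfolding set_lebesgue_integral_def
    by (rule Bochner_Integration.integral_cong) (use that in \<open>auto simp: indicator_def\<close>)
  have right: "(LINT r:{s<..t}|lborel. ?g r) = (LINT r:{s<..t}|lborel. g2 r)" if "m \<le> s" for s t
    unfolding set_lebesgue_integral_def
    by (rule Bochner_Integration.integral_cong) (use that in \<open>auto simp: indicator_def\<close>)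
  show ?thesis
    unfolding AC2_def
  proof (intro conjI allI impI L)
    fix s t assume st: "a \<le> s" "s \<le> t" "t \<le> b"
    consider "t \<le> m" | "m < s" | "s \<le> m" "m < t" by linarith
    then show "(if t \<le> m then u1 t else u2 t) - (if s \<le> m then u1 s else u2 s) = (LINT r:{s<..t}|lborel. ?g r)"
    proof cases
      case 1
      then show ?thesis using left[OF 1] assms(1) st by (simp add: AC2_def)
    next
      case 2
      then show ?thesis using right[of s t] assms(2) st by (simp add: AC2_def)
    next
      case 3
      have "(LINT r:{s<..t}|lborel. ?g r) = (LINT r:{s<..m}|lborel. ?g r) + (LINT r:{m<..t}|lborel. ?g r)"
        by (rule set_lebesgue_integral_Ioc_split) (use 3 L2_set_integrable[OF L] in auto)
      also have "\<dots> = (u1 m - u1 s) + (u2 t - u2 m)"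
        using left[of m s] right[of m t] 3 st 1 2 by (simp add: AC2_def)
      finally show ?thesis using eq 3 by simp
    qed
  qed
qed

lemma AC2_linear: "AC2 a b (\<lambda>t. c + t * m) (\<lambda>r. indicator {a<..b} r * m)"
  unfolding AC2_def
proof (intro conjI allI impI)
  show "L2 (\<lambda>r. indicator {a<..b} r * m)" by (rule L2_const_Ioc)
  fix s t assume st: "a \<le> s" "s \<le> t" "t \<le> b"
  have "(LINT r:{s<..t}|lborel. indicator {a<..b} r * m) = (LINT r:{s<..t}|lborel. m)"
    unfolding set_lebesgue_integral_def
    by (rule Bochner_Integration.integral_cong) (use st in \<open>auto simp: indicator_def\<close>)
  also have "\<dots> = (t - s) * m" using st by (simp add: set_lebesgue_integral_def)
  finally show "(c + t * m) - (c + s * m) = (LINT r:{s<..t}|lborel. indicator {a<..b} r * m)"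
    by (simp add: algebra_simps)
qed

text \<open>The interval is split at a point of \<open>B\<close> until no prescribed point is left
  inside. On such a piece the chord is taken: its energy is the limit of the quotients
  \<open>Q n\<close>, and Cauchy--Schwarz puts \<open>Q n\<close> below the energy of
  \<open>u n\<close>. The convergent lower bounds \<open>Q\<close> replace the energies of
  \<open>u n\<close>, which need not converge on a single edge.\<close>

lemma linear_interpolation_limit:
  assumes "finite B" "B \<subseteq> {a<..<b}" "a < b" "\<And>n. AC2 a b (u n) (g n)"
    and "\<And>t. t \<in> B \<union> {a, b} \<Longrightarrow> (\<lambda>n::nat. u n t) \<longlonglongrightarrow> v t"
  shows "\<exists>w h Q. AC2 a b w h \<and> (\<forall>t \<in> B \<union> {a, b}. w t = v t) \<and>
    (\<forall>n. Q n \<le> (LINT r:{a<..b}|lborel. (g n r)\<^sup>2)) \<and> Q \<longlonglongrightarrow> (LINT r:{a<..b}|lborel. (h r)\<^sup>2)"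
  using assms
proof (induction "card B" arbitrary: B a b rule: less_induct)
  case less
  show ?case
  proof (cases "B = {}")
    case True
    define m where "m = (v b - v a) / (b - a)"
    define h where "h r = indicator {a<..b} r * m" for r
    define w where "w t = v a - a * m + t * m" for t
    define Q where "Q n = (u n b - u n a)\<^sup>2 / (b - a)" for n
    have ab: "b - a > 0" using less.prems(3) by simp
    have "AC2 a b w h"
      unfolding w_def[abs_def] h_def[abs_def] by (rule AC2_linear)
    moreover have "(b - a) * m = v b - v a"
      using ab by (simp add: m_def)
    then have "b * m - a * m = v b - v a"
      by (simp add: left_diff_distrib)
    then have "\<forall>t \<in> B \<union> {a, b}. w t = v t"
      using True by (auto simp: w_def)
    moreover have "Q n \<le> (LINT r:{a<..b}|lborel. (g n r)\<^sup>2)" for n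
      using AC2_Holder[OF less.prems(4)[of n], of a b] ab by (simp add: Q_def field_simps)
    moreover have "Q \<longlonglongrightarrow> (LINT r:{a<..b}|lborel. (h r)\<^sup>2)"
    proof -
      have "Q \<longlonglongrightarrow> (v b - v a)\<^sup>2 / (b - a)"
        unfolding Q_def[abs_def] using less.prems(5) ab by (intro tendsto_intros) auto
      moreover have "(LINT r:{a<..b}|lborel. (h r)\<^sup>2) = (LINT r:{a<..b}|lborel. m\<^sup>2)"
        unfolding set_lebesgue_integral_def
        by (rule Bochner_Integration.integral_cong) (auto simp: h_def indicator_def)
      moreover have "\<dots> = (v b - v a)\<^sup>2 / (b - a)"
        using ab by (simp add: set_lebesgue_integral_def m_def power2_eq_square)
      ultimately show ?thesis by simp
    qed
    ultimately show ?thesis by blast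
  next
    case False
    then obtain m where m: "m \<in> B" by blast
    then have amb: "a < m" "m < b" using less.prems(2) by auto
    define B1 where "B1 = B \<inter> {a<..<m}"
    define B2 where "B2 = B \<inter> {m<..<b}"
    have "B1 \<subset> B" "B2 \<subset> B" using m by (auto simp: B1_def B2_def)
    then have card: "card B1 < card B" "card B2 < card B"
      using less.prems(1) psubset_card_mono by blast+
    have Bsub: "t \<in> B1 \<union> {a, m} \<or> t \<in> B2 \<union> {m, b}" if "t \<in> B \<union> {a, b}" for t
      using that less.prems(2) by (auto simp: B1_def B2_def)
    have "\<exists>w h Q. AC2 a m w h \<and> (\<forall>t \<in> B1 \<union> {a, m}. w t = v t) \<and>
      (\<forall>n. Q n \<le> (LINT r:{a<..m}|lborel. (g n r)\<^sup>2)) \<and> Q \<longlonglongrightarrow> (LINT r:{a<..m}|lborel. (h r)\<^sup>2)"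
      using less.prems m amb AC2_subinterval[OF less.prems(4), of a m]
      by (intro less.hyps card) (auto simp: B1_def)
    then obtain w1 h1 Q1 where 1: "AC2 a m w1 h1" "\<forall>t \<in> B1 \<union> {a, m}. w1 t = v t"
      "\<forall>n. Q1 n \<le> (LINT r:{a<..m}|lborel. (g n r)\<^sup>2)" "Q1 \<longlonglongrightarrow> (LINT r:{a<..m}|lborel. (h1 r)\<^sup>2)"
      by blast
    have "\<exists>w h Q. AC2 m b w h \<and> (\<forall>t \<in> B2 \<union> {m, b}. w t = v t) \<and>
      (\<forall>n. Q n \<le> (LINT r:{m<..b}|lborel. (g n r)\<^sup>2)) \<and> Q \<longlonglongrightarrow> (LINT r:{m<..b}|lborel. (h r)\<^sup>2)"
      using less.prems m amb AC2_subinterval[OF less.prems(4), of m b]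
      by (intro less.hyps card) (auto simp: B2_def)
    then obtain w2 h2 Q2 where 2: "AC2 m b w2 h2" "\<forall>t \<in> B2 \<union> {m, b}. w2 t = v t"
      "\<forall>n. Q2 n \<le> (LINT r:{m<..b}|lborel. (g n r)\<^sup>2)" "Q2 \<longlonglongrightarrow> (LINT r:{m<..b}|lborel. (h2 r)\<^sup>2)"
      by blast
    define w where "w t = (if t \<le> m then w1 t else w2 t)" for t
    define h where "h r = (if r \<le> m then h1 r else h2 r)" for r
    have AC: "AC2 a b w h"
      unfolding w_def[abs_def] h_def[abs_def] using 1(1) 2(1) by (rule AC2_join) (use 1(2) 2(2) in auto)
    have split: "(LINT r:{a<..b}|lborel. (f r)\<^sup>2)
        = (LINT r:{a<..m}|lborel. (f r)\<^sup>2) + (LINT r:{m<..b}|lborel. (f r)\<^sup>2)" if "L2 f" for f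
      using L2_set_integrable_sq[OF that] amb by (intro set_lebesgue_integral_Ioc_split) auto
    have "w t = v t" if "t \<in> B \<union> {a, b}" for t
      using Bsub[OF that] 1(2) 2(2) amb by (auto simp: w_def B1_def B2_def)
    moreover have "Q1 n + Q2 n \<le> (LINT r:{a<..b}|lborel. (g n r)\<^sup>2)" for n
      using 1(3)[rule_format, of n] 2(3)[rule_format, of n] split[of "g n"] less.prems(4)[of n]
      by (simp add: AC2_def)
    moreover have "(\<lambda>n. Q1 n + Q2 n) \<longlonglongrightarrow> (LINT r:{a<..b}|lborel. (h r)\<^sup>2)"
    proof -
      have "(LINT r:{a<..m}|lborel. (h r)\<^sup>2) = (LINT r:{a<..m}|lborel. (h1 r)\<^sup>2)"
        unfolding set_lebesgue_integral_def
        by (rule Bochner_Integration.integral_cong) (auto simp: h_def indicator_def)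
      moreover have "(LINT r:{m<..b}|lborel. (h r)\<^sup>2) = (LINT r:{m<..b}|lborel. (h2 r)\<^sup>2)"
        unfolding set_lebesgue_integral_def
        by (rule Bochner_Integration.integral_cong) (auto simp: h_def indicator_def)
      ultimately show ?thesis
        using tendsto_add[OF 1(4) 2(4)] split[of h] AC by (simp add: AC2_def)
    qed
    ultimately show ?thesis
      using AC by (intro exI[of _ w] exI[of _ h] exI[of _ "\<lambda>n. Q1 n + Q2 n"]) auto
  qed
qed


section \<open>Energies on closed subsets of the graph\<close>

lemma L2_continuous_compact_support:
  fixes \<psi> :: "real \<Rightarrow> real"
  assumes c: "continuous_on UNIV \<psi>" and S: "compact S" "\<And>t. t \<notin> S \<Longrightarrow> \<psi> t = 0"
  shows "L2 \<psi>"
proof -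
  obtain b where "S \<subseteq> cbox (- b) b"
    using bounded_subset_cbox_symmetric[OF compact_imp_bounded[OF S(1)]] .
  then obtain a where ab: "S \<subseteq> {a..b}" by auto
  have "set_integrable lborel {a..b} (\<lambda>t. (\<psi> t)\<^sup>2)"
    by (intro borel_integrable_atLeastAtMost' continuous_intros continuous_on_subset[OF c]) auto
  moreover have "(\<lambda>t. indicator {a..b} t *\<^sub>R (\<psi> t)\<^sup>2) = (\<lambda>t. (\<psi> t)\<^sup>2)"
  proof
    fix t
    show "indicator {a..b} t *\<^sub>R (\<psi> t)\<^sup>2 = (\<psi> t)\<^sup>2"
    proof (cases "t \<in> {a..b}")
      case False
      then show ?thesis using S(2)[of t] ab by (simp add: subset_eq) blast
    qed simp
  qed
  ultimately show ?thesis
    using c by (auto simp: L2_def set_integrable_def intro: borel_measurable_continuous_onI)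
qed

text \<open>Square-integrability is what permits splitting the integrals, since non-integrable
  functions are assigned the integral 0 and linearity fails for them.\<close>

lemma weak_derivative_on_linear:
  assumes u: "sq_integrable_on U u" "sq_integrable_on U g" "weak_derivative_on U u g"
    and w: "sq_integrable_on U w" "sq_integrable_on U h" "weak_derivative_on U w h"
  shows "weak_derivative_on U (\<lambda>t. a * u t + b * w t) (\<lambda>t. a * g t + b * h t)"
  unfolding weak_derivative_on_def
proof (intro allI impI, elim conjE)
  fix \<phi> \<phi>' :: "real \<Rightarrow> real"
  assume D: "\<forall>t. (\<phi> has_real_derivative \<phi>' t) (at t)" and c': "continuous_on UNIV \<phi>'"
    and S: "compact (closure {t. \<phi> t \<noteq> 0})" "closure {t. \<phi> t \<noteq> 0} \<subseteq> U"
  have "continuous_on UNIV \<phi>"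
    using D by (meson DERIV_isCont continuous_at_imp_continuous_on)
  then have L: "L2 \<phi>"
    by (rule L2_continuous_compact_support[OF _ S(1)])
      (use closure_subset[of "{t. \<phi> t \<noteq> 0}"] in blast)
  have L': "L2 \<phi>'"
    by (rule L2_continuous_compact_support[OF c' S(1) derivative_zero_off_support[OF D]])
  have int: "set_integrable lborel U (\<lambda>t. f t * \<psi> t)" if "sq_integrable_on U f" "L2 \<psi>" for f \<psi>
    using L2_mult[of "\<lambda>t. indicator U t * f t" \<psi>] that
    by (simp add: sq_integrable_on_iff set_integrable_def mult.assoc)
  have lin: "(LINT t:U|lborel. (a * f t + b * k t) * \<psi> t)
      = a * (LINT t:U|lborel. f t * \<psi> t) + b * (LINT t:U|lborel. k t * \<psi> t)"
    if "sq_integrable_on U f" "sq_integrable_on U k" "L2 \<psi>" for f k \<psi>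
  proof -
    have "(LINT t:U|lborel. (a * f t + b * k t) * \<psi> t)
        = (LINT t:U|lborel. a * (f t * \<psi> t) + b * (k t * \<psi> t))"
      by (simp add: algebra_simps)
    also have "\<dots> = (LINT t:U|lborel. a * (f t * \<psi> t)) + (LINT t:U|lborel. b * (k t * \<psi> t))"
      using int that by (intro set_integral_add) auto
    finally show ?thesis by simp
  qed
  have "(LINT t:U|lborel. u t * \<phi>' t) = - (LINT t:U|lborel. g t * \<phi> t)"
    "(LINT t:U|lborel. w t * \<phi>' t) = - (LINT t:U|lborel. h t * \<phi> t)"
    using u(3) w(3) D c' S unfolding weak_derivative_on_def by blast+
  then show "(LINT t:U|lborel. (a * u t + b * w t) * \<phi>' t) = - (LINT t:U|lborel. (a * g t + b * h t) * \<phi> t)"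
    unfolding lin[OF u(1) w(1) L'] lin[OF u(2) w(2) L] by (simp add: algebra_simps)
qed

lemma weak_derivative_on_subset:
  assumes wd: "weak_derivative_on U u g" and V: "V \<subseteq> U" and uw: "\<And>t. t \<in> V \<Longrightarrow> w t = u t"
  shows "weak_derivative_on V w g"
  unfolding weak_derivative_on_def
proof (intro allI impI, elim conjE)
  fix \<phi> \<phi>' :: "real \<Rightarrow> real"
  assume D: "\<forall>t. (\<phi> has_real_derivative \<phi>' t) (at t)" and c': "continuous_on UNIV \<phi>'"
    and S: "compact (closure {t. \<phi> t \<noteq> 0})" "closure {t. \<phi> t \<noteq> 0} \<subseteq> V"
  have phi0: "\<phi> t = 0" "\<phi>' t = 0" if "t \<notin> V" for t
    using that S(2) closure_subset[of "{t. \<phi> t \<noteq> 0}"] derivative_zero_off_support[OF D] by blast+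
  have eq: "(LINT t:V|lborel. f t * \<psi> t) = (LINT t:U|lborel. k t * \<psi> t)"
    if "\<And>t. t \<notin> V \<Longrightarrow> \<psi> t = 0" "\<And>t. t \<in> V \<Longrightarrow> f t = k t" for f k \<psi> :: "real \<Rightarrow> real"
    unfolding set_lebesgue_integral_def
  proof (rule Bochner_Integration.integral_cong)
    show "indicator V t *\<^sub>R (f t * \<psi> t) = indicator U t *\<^sub>R (k t * \<psi> t)" for t
      using that V by (cases "t \<in> V") auto
  qed simp
  have "(LINT t:U|lborel. u t * \<phi>' t) = - (LINT t:U|lborel. g t * \<phi> t)"
    using wd D c' S V unfolding weak_derivative_on_def by blast
  then show "(LINT t:V|lborel. w t * \<phi>' t) = - (LINT t:V|lborel. g t * \<phi> t)"
    using eq[of \<phi>' w u] eq[of \<phi> g g] phi0 uw by simp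
qed

lemma sq_integrable_on_subset:
  assumes "sq_integrable_on U u" "V \<in> sets borel" "V \<subseteq> U" "\<And>t. t \<in> V \<Longrightarrow> w t = u t"
  shows "sq_integrable_on V w"
proof -
  have "L2 (\<lambda>r. indicator V r * (indicator U r * u r))"
    by (rule L2_indicator[OF assms(1)[unfolded sq_integrable_on_iff] assms(2)])
  also have "(\<lambda>r. indicator V r * (indicator U r * u r)) = (\<lambda>r. indicator V r * w r)"
    using assms(3,4) by (auto simp: indicator_def fun_eq_iff subset_iff)
  finally show ?thesis by (simp add: sq_integrable_on_iff)
qed

lemma sq_integrable_on_linear:
  assumes "sq_integrable_on U u" "sq_integrable_on U w"
  shows "sq_integrable_on U (\<lambda>t. a * u t + b * w t)"
proof -
  have "L2 (\<lambda>r. a * (indicator U r * u r) + b * (indicator U r * w r))"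
    using assms by (intro L2_add L2_scale) (auto simp: sq_integrable_on_iff)
  then show ?thesis by (simp add: sq_integrable_on_iff algebra_simps)
qed

section \<open>The topology of the graph and its edges\<close>

context metric_graph
begin

text \<open>Connectedness as an induction principle. Paths run in the symmetrized graph, so the
  property has to be passed along an arc in both directions.\<close>

lemma vertex_reach:
  assumes "v \<in> verts G" "w \<in> verts G" "P v"
    and P: "\<And>e. e \<in> arcs G \<Longrightarrow> P (tail G e) \<longleftrightarrow> P (head G e)"
  shows "P w"
proof -
  have "(v, w) \<in> rtrancl_on (verts G) (parcs (mk_symmetric G))"
    using connected_G assms(1,2)
    unfolding Digraph_Component.connected_def strongly_connected_def reachable_def
    by (simp add: arcs_ends_def arc_to_ends_def mk_symmetric_def)
  then show ?thesis
    using assms(3)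
  proof (induction rule: rtrancl_on_induct)
    case (step y z)
    then show ?case using P by (auto simp: mk_symmetric_def)
  qed
qed

lemma edge_map_Inner: "0 < t \<Longrightarrow> t < len e \<Longrightarrow> edge_map e t = Inner e t"
  by (simp add: edge_map_def)

lemma edge_map_0 [simp]: "edge_map e 0 = Vertex (tail G e)"
  by (simp add: edge_map_def)

lemma edge_map_len: "e \<in> arcs G \<Longrightarrow> edge_map e (len e) = Vertex (head G e)"
  using len_pos[of e] by (simp add: edge_map_def)

lemma edge_map_in_points: "e \<in> arcs G \<Longrightarrow> edge_map e t \<in> points"
  by (auto simp: edge_map_def points_def)

lemma points_edge_map:
  assumes "x \<in> points"
  obtains e t where "e \<in> arcs G" "t \<in> {0..len e}" "x = edge_map e t"
proof (cases x)
  case (Vertex v)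
  then have v: "v \<in> verts G" using assms by (auto simp: points_def)
  obtain e0 where e0: "e0 \<in> arcs G" using arcs_nonempty by blast
  \<comment> \<open>A vertex that lies on no edge is excluded by connectedness: being the end of
    some edge spreads from \<open>tail G e0\<close> to every vertex.\<close>
  have "\<exists>e \<in> arcs G. v = tail G e \<or> v = head G e"
    by (rule vertex_reach[of "tail G e0" v]) (use e0 v in auto)
  then obtain e where e: "e \<in> arcs G" "v = tail G e \<or> v = head G e" by blast
  then show thesis
    using that[of e 0] that[of e "len e"] Vertex len_pos[of e] edge_map_len[of e] by auto
next
  case (Inner e t)
  then show thesis using assms that[of e t] edge_map_Inner[of t e] by (auto simp: points_def)
qed

lemma topspace_gtop [simp]: "topspace gtop = points"
proof -
  have "openin gtop points"
    unfolding openin_gtop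
  proof (intro conjI ballI)
    fix e assume "e \<in> arcs G"
    then have "{t \<in> {0..len e}. edge_map e t \<in> points} = {0..len e}"
      using edge_map_in_points by auto
    then show "openin (top_of_set {0..len e}) {t \<in> {0..len e}. edge_map e t \<in> points}" by simp
  qed simp
  then show ?thesis
    using openin_subset[of gtop] openin_gtop by (metis openin_topspace subset_antisym)
qed

lemma subtopology_gtop_points [simp]: "subtopology gtop points = gtop"
  by (metis subtopology_topspace topspace_gtop)

lemma continuous_map_edge_map:
  assumes "e \<in> arcs G"
  shows "continuous_map (top_of_set {0..len e}) gtop (edge_map e)"
  unfolding continuous_map_def
  using assms edge_map_in_points by (auto simp: openin_gtop)

lemma continuous_map_gtop_iff:
  "continuous_map gtop euclideanreal f \<longleftrightarrow> (\<forall>e \<in> arcs G. continuous_on {0..len e} (f \<circ> edge_map e))"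
proof
  assume f: "continuous_map gtop euclideanreal f"
  show "\<forall>e \<in> arcs G. continuous_on {0..len e} (f \<circ> edge_map e)"
  proof
    fix e assume "e \<in> arcs G"
    from continuous_map_compose[OF continuous_map_edge_map[OF this] f]
    show "continuous_on {0..len e} (f \<circ> edge_map e)" by simp
  qed
next
  assume c: "\<forall>e \<in> arcs G. continuous_on {0..len e} (f \<circ> edge_map e)"
  show "continuous_map gtop euclideanreal f"
    unfolding continuous_map_def
  proof (intro conjI allI impI)
    fix U :: "real set" assume "openin euclidean U"
    then have U: "open U" by simp
    show "openin gtop {x \<in> topspace gtop. f x \<in> U}"
      unfolding openin_gtop
    proof (intro conjI ballI)
      fix e assume e: "e \<in> arcs G"
      have "openin (top_of_set {0..len e}) ({0..len e} \<inter> (f \<circ> edge_map e) -` U)"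
        using c e U continuous_openin_preimage_gen by blast
      also have "{0..len e} \<inter> (f \<circ> edge_map e) -` U
          = {t \<in> {0..len e}. edge_map e t \<in> {x \<in> topspace gtop. f x \<in> U}}"
        using edge_map_in_points[OF e] by auto
      finally show "openin (top_of_set {0..len e}) \<dots>" .
    qed auto
  qed auto
qed

lemma openin_Inner_image:
  assumes "open V" "V \<subseteq> {0<..<len e}" "e \<in> arcs G"
  shows "openin gtop (Inner e ` V)"
  unfolding openin_gtop
proof (intro conjI ballI)
  show "Inner e ` V \<subseteq> points" using assms by (auto simp: points_def)
  fix d assume d: "d \<in> arcs G"
  have "{t \<in> {0..len d}. edge_map d t \<in> Inner e ` V} = (if d = e then V else {})"
    using assms(2) by (auto simp: edge_map_def)
  moreover have "openin (top_of_set {0..len d}) (if d = e then V else {})"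
    using assms by (auto intro!: open_subset)
  ultimately show "openin (top_of_set {0..len d}) {t \<in> {0..len d}. edge_map d t \<in> Inner e ` V}"
    by simp
qed

lemma open_edge_dom: "open (edge_dom K e)"
  by (simp add: edge_dom_def)

lemma edge_dom_subset: "edge_dom K e \<subseteq> {0<..<len e}"
  using interior_subset by (force simp: edge_dom_def)

lemma edge_dom_points: "e \<in> arcs G \<Longrightarrow> edge_dom points e = {0<..<len e}"
proof -
  assume "e \<in> arcs G"
  then have "{t. 0 < t \<and> t < len e \<and> edge_map e t \<in> points} = {0<..<len e}"
    using edge_map_in_points by auto
  then show ?thesis by (simp add: edge_dom_def)
qed

text \<open>The interior taken on the line agrees with the interior in the graph away from the
  vertices because open edges are open in the graph. This turns boundary values on the topological
  frontier into values at the points of an edge outside \<open>edge_dom\<close>.\<close>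

lemma edge_dom_iff:
  assumes e: "e \<in> arcs G" and t: "t \<in> {0<..<len e}"
  shows "t \<in> edge_dom K e \<longleftrightarrow> edge_map e t \<in> gtop interior_of K"
proof
  assume "t \<in> edge_dom K e"
  moreover have "openin gtop (Inner e ` edge_dom K e)"
    using open_edge_dom edge_dom_subset e by (rule openin_Inner_image)
  moreover have "Inner e ` edge_dom K e \<subseteq> K"
  proof
    fix x :: "('v, 'e) gpoint" assume "x \<in> Inner e ` edge_dom K e"
    then obtain r where r: "r \<in> edge_dom K e" "x = Inner e r" by blast
    then have "0 < r \<and> r < len e \<and> edge_map e r \<in> K"
      using interior_subset by (force simp: edge_dom_def)
    then show "x \<in> K" using r edge_map_Inner[of r e] by auto
  qed
  ultimately show "edge_map e t \<in> gtop interior_of K"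
    using t edge_map_Inner[of t e] by (auto simp: interior_of_def)
next
  assume "edge_map e t \<in> gtop interior_of K"
  then obtain U where U: "openin gtop U" "edge_map e t \<in> U" "U \<subseteq> K"
    by (auto simp: interior_of_def)
  have o: "openin (top_of_set {0..len e}) {t \<in> {0..len e}. edge_map e t \<in> U}"
    using U(1) e by (simp add: openin_gtop)
  obtain T where T: "open T" "{t \<in> {0..len e}. edge_map e t \<in> U} = {0..len e} \<inter> T"
    using o[unfolded openin_open] by (elim exE conjE)
  have "t \<in> {t \<in> {0..len e}. edge_map e t \<in> U}" using U(2) t by auto
  then have "t \<in> T" unfolding T(2) by blast
  moreover have "T \<inter> {0<..<len e} \<subseteq> {t. 0 < t \<and> t < len e \<and> edge_map e t \<in> K}"
  proof
    fix r assume r: "r \<in> T \<inter> {0<..<len e}"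
    then have "r \<in> {t \<in> {0..len e}. edge_map e t \<in> U}" unfolding T(2) by auto
    then show "r \<in> {t. 0 < t \<and> t < len e \<and> edge_map e t \<in> K}" using U(3) r by auto
  qed
  moreover have "open (T \<inter> {0<..<len e})" using T(1) by auto
  ultimately show "t \<in> edge_dom K e"
    using t unfolding edge_dom_def by (meson IntI interiorI)
qed

lemma edge_dom_in: "e \<in> arcs G \<Longrightarrow> t \<in> edge_dom K e \<Longrightarrow> edge_map e t \<in> K"
  using edge_dom_iff[of e t K] edge_dom_subset[of K e] interior_of_subset[of gtop K] by blast

text \<open>The derivative along the edge \<open>e\<close>, continued by zero to the whole line.
  Energies of functions on different closed sets thereby become integrals over one common
  domain.\<close>

definition ed :: "('v, 'e) gpoint set \<Rightarrow> 'e \<Rightarrow> ('v, 'e) gfun \<Rightarrow> real \<Rightarrow> real" where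
  "ed K e f r = indicator (edge_dom K e) r * weak_deriv (edge_dom K e) (f \<circ> edge_map e) r"

section \<open>The energy as a bilinear form\<close>

lemma H1_sobolev: "f \<in> H1 K \<Longrightarrow> e \<in> arcs G \<Longrightarrow> sobolev_H1_on (edge_dom K e) (f \<circ> edge_map e)"
  by (simp add: H1_def)

lemma H1_off: "f \<in> H1 K \<Longrightarrow> x \<notin> K \<Longrightarrow> f x = 0"
  by (simp add: H1_def)

lemma L2_ed:
  assumes "f \<in> H1 K" "e \<in> arcs G"
  shows "L2 (ed K e f)"
  using weak_deriv(1)[OF H1_sobolev[OF assms]]
  by (simp add: sq_integrable_on_iff ed_def[abs_def])

lemma energy_ed: "energy K f g = (\<Sum>e\<in>arcs G. LINT r|lborel. ed K e f r * ed K e g r)"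
  unfolding energy_def set_lebesgue_integral_def
  by (intro sum.cong Bochner_Integration.integral_cong refl) (auto simp: ed_def indicator_def)

lemma H1_continuous_edge_dom:
  assumes f: "f \<in> H1 K" and e: "e \<in> arcs G"
  shows "continuous_on (edge_dom K e) (f \<circ> edge_map e)"
proof -
  have "continuous_map (top_of_set (edge_dom K e)) gtop (edge_map e)"
    using edge_dom_subset[of K e]
    by (intro continuous_map_from_subtopology_mono[OF continuous_map_edge_map[OF e]]) auto
  then have "continuous_map (top_of_set (edge_dom K e)) (subtopology gtop K) (edge_map e)"
    using edge_dom_in[OF e] by (auto simp: continuous_map_in_subtopology)
  from continuous_map_compose[OF this, of euclideanreal f] show ?thesis
    using f by (simp add: H1_def)
qed

lemma ed_unique:
  assumes f: "f \<in> H1 K" and e: "e \<in> arcs G"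
    and g: "sq_integrable_on (edge_dom K e) g" "weak_derivative_on (edge_dom K e) (f \<circ> edge_map e) g"
  shows "AE r in lborel. ed K e f r = indicator (edge_dom K e) r * g r"
proof -
  have "AE r in lborel. r \<in> edge_dom K e \<longrightarrow> weak_deriv (edge_dom K e) (f \<circ> edge_map e) r = g r"
    by (rule weak_derivative_unique[OF open_edge_dom H1_continuous_edge_dom[OF f e]
          weak_deriv[OF H1_sobolev[OF f e]] g])
  then show ?thesis by eventually_elim (auto simp: ed_def indicator_def)
qed

lemma H1_linear:
  assumes f: "f \<in> H1 K" and g: "g \<in> H1 K"
  shows "(\<lambda>x. a * f x + b * g x) \<in> H1 K"
    and "e \<in> arcs G \<Longrightarrow> AE r in lborel. ed K e (\<lambda>x. a * f x + b * g x) r = a * ed K e f r + b * ed K e g r"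
proof -
  have comp: "(\<lambda>x. a * f x + b * g x) \<circ> edge_map e
      = (\<lambda>t. a * (f \<circ> edge_map e) t + b * (g \<circ> edge_map e) t)" for e
    by auto
  note wf = weak_deriv[OF H1_sobolev[OF f]] and wg = weak_deriv[OF H1_sobolev[OF g]]
  have sq: "sq_integrable_on (edge_dom K e) (f \<circ> edge_map e)" "sq_integrable_on (edge_dom K e) (g \<circ> edge_map e)"
    if "e \<in> arcs G" for e
    using H1_sobolev[OF f that] H1_sobolev[OF g that] by (auto simp: sobolev_H1_on_def)
  have sq_d: "sq_integrable_on (edge_dom K e) (\<lambda>t. a * weak_deriv (edge_dom K e) (f \<circ> edge_map e) t
      + b * weak_deriv (edge_dom K e) (g \<circ> edge_map e) t)" if "e \<in> arcs G" for e
    by (rule sq_integrable_on_linear[OF wf(1)[OF that] wg(1)[OF that]])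
  have wd: "weak_derivative_on (edge_dom K e) ((\<lambda>x. a * f x + b * g x) \<circ> edge_map e)
      (\<lambda>t. a * weak_deriv (edge_dom K e) (f \<circ> edge_map e) t + b * weak_deriv (edge_dom K e) (g \<circ> edge_map e) t)"
    if "e \<in> arcs G" for e
    unfolding comp using sq[OF that] wf[OF that] wg[OF that] by (intro weak_derivative_on_linear)
  have "sobolev_H1_on (edge_dom K e) ((\<lambda>x. a * f x + b * g x) \<circ> edge_map e)" if "e \<in> arcs G" for e
    using sq_integrable_on_linear[OF sq[OF that], of a b] sq_d[OF that] wd[OF that]
    unfolding sobolev_H1_on_def comp by blast
  moreover have "continuous_map (subtopology gtop K) euclideanreal (\<lambda>x. a * f x + b * g x)"
    using f g by (intro continuous_intros) (auto simp: H1_def)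
  ultimately show H: "(\<lambda>x. a * f x + b * g x) \<in> H1 K"
    using f g by (auto simp: H1_def)
  assume e: "e \<in> arcs G"
  show "AE r in lborel. ed K e (\<lambda>x. a * f x + b * g x) r = a * ed K e f r + b * ed K e g r"
    using ed_unique[OF H e sq_d[OF e] wd[OF e]]
    by eventually_elim (auto simp: ed_def algebra_simps)
qed

lemma H1_scale: "f \<in> H1 K \<Longrightarrow> (\<lambda>x. a * f x) \<in> H1 K"
  using H1_linear(1)[of f K f a 0] by simp

lemma energy_commute: "energy K f g = energy K g f"
  by (simp add: energy_ed mult.commute)

text \<open>Derivatives are only ever computed up to null sets; this is the passage from such a
  computation to the energy.\<close>

lemma energy_cong_AE:
  assumes "f \<in> H1 K" "g \<in> H1 K"
    and "\<And>e. e \<in> arcs G \<Longrightarrow> f' e \<in> borel_measurable lborel" "\<And>e. e \<in> arcs G \<Longrightarrow> g' e \<in> borel_measurable lborel"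
    and "\<And>e. e \<in> arcs G \<Longrightarrow> AE r in lborel. ed K e f r = f' e r"
    and "\<And>e. e \<in> arcs G \<Longrightarrow> AE r in lborel. ed K e g r = g' e r"
  shows "energy K f g = (\<Sum>e\<in>arcs G. LINT r|lborel. f' e r * g' e r)"
  unfolding energy_ed
proof (intro sum.cong refl integral_cong_AE)
  fix e assume e: "e \<in> arcs G"
  show "(\<lambda>r. ed K e f r * ed K e g r) \<in> borel_measurable lborel"
    using L2_measurable[OF L2_ed[OF assms(1) e]] L2_measurable[OF L2_ed[OF assms(2) e]] by simp
  show "(\<lambda>r. f' e r * g' e r) \<in> borel_measurable lborel"
    using assms(3,4)[OF e] by simp
  show "AE r in lborel. ed K e f r * ed K e g r = f' e r * g' e r"
    using assms(5)[OF e] assms(6)[OF e] by eventually_elim simp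
qed

lemma energy_linear_left:
  assumes f: "f \<in> H1 K" and g: "g \<in> H1 K" and h: "h \<in> H1 K"
  shows "energy K (\<lambda>x. a * f x + b * g x) h = a * energy K f h + b * energy K g h"
proof -
  have "energy K (\<lambda>x. a * f x + b * g x) h
      = (\<Sum>e\<in>arcs G. LINT r|lborel. (a * ed K e f r + b * ed K e g r) * ed K e h r)"
    using H1_linear[OF f g] L2_measurable[OF L2_ed[OF f]] L2_measurable[OF L2_ed[OF g]]
      L2_measurable[OF L2_ed[OF h]] by (intro energy_cong_AE h) auto
  also have "\<dots> = (\<Sum>e\<in>arcs G. a * (LINT r|lborel. ed K e f r * ed K e h r)
      + b * (LINT r|lborel. ed K e g r * ed K e h r))"
  proof (intro sum.cong refl)
    fix e assume e: "e \<in> arcs G"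
    have "(LINT r|lborel. (a * ed K e f r + b * ed K e g r) * ed K e h r)
        = (LINT r|lborel. a * (ed K e f r * ed K e h r) + b * (ed K e g r * ed K e h r))"
      by (simp add: algebra_simps)
    also have "\<dots> = (LINT r|lborel. a * (ed K e f r * ed K e h r)) + (LINT r|lborel. b * (ed K e g r * ed K e h r))"
      using L2_mult L2_ed[OF f e] L2_ed[OF g e] L2_ed[OF h e]
      by (intro Bochner_Integration.integral_add integrable_mult_right) auto
    finally show "(LINT r|lborel. (a * ed K e f r + b * ed K e g r) * ed K e h r)
      = a * (LINT r|lborel. ed K e f r * ed K e h r) + b * (LINT r|lborel. ed K e g r * ed K e h r)"
      by simp
  qed
  finally show ?thesis
    by (simp add: energy_ed sum.distrib sum_distrib_left)
qed

lemma energy_linear_square: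
  assumes f: "f \<in> H1 K" and g: "g \<in> H1 K"
  shows "energy K (\<lambda>x. a * f x + b * g x) (\<lambda>x. a * f x + b * g x)
    = a\<^sup>2 * energy K f f + 2 * a * b * energy K f g + b\<^sup>2 * energy K g g"
proof -
  note l = H1_linear(1)[OF f g, of a b]
  show ?thesis
    unfolding energy_linear_left[OF f g l] energy_commute[of K f "\<lambda>x. a * f x + b * g x"]
      energy_commute[of K g "\<lambda>x. a * f x + b * g x"] energy_linear_left[OF f g f] energy_linear_left[OF f g g]
    by (simp add: energy_commute[of K g f] power2_eq_square algebra_simps)
qed

lemma energy_scale: "f \<in> H1 K \<Longrightarrow> energy K (\<lambda>x. a * f x) (\<lambda>x. a * f x) = a\<^sup>2 * energy K f f"
  using energy_linear_square[of f K f a 0] by simp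

lemma energy_nonneg: "0 \<le> energy K f f"
  unfolding energy_ed by (intro sum_nonneg integral_nonneg_AE) auto

lemma H1_edge_AC2:
  assumes f: "f \<in> H1 points" and e: "e \<in> arcs G"
  shows "AC2 0 (len e) (f \<circ> edge_map e) (ed points e f)"
proof -
  have "continuous_on {0..len e} (f \<circ> edge_map e)"
    using f e continuous_map_gtop_iff by (auto simp: H1_def)
  from sobolev_AC2[OF len_pos[OF e] this] show ?thesis
    using H1_sobolev[OF f e] by (simp add: ed_def[abs_def] edge_dom_points[OF e])
qed

text \<open>With \<open>H1_edge_AC2\<close> this gives the working description of
  \<open>H1 points\<close>: a primitive on every closed edge. The values at the vertices match by
  themselves, because \<open>f\<close> is a function on the glued graph.\<close>

lemma H1_points_AC2:
  assumes off: "\<And>x. x \<notin> points \<Longrightarrow> f x = 0"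
    and AC: "\<And>e. e \<in> arcs G \<Longrightarrow> AC2 0 (len e) (f \<circ> edge_map e) (g e)"
  shows "f \<in> H1 points"
    and "e \<in> arcs G \<Longrightarrow> AE r in lborel. ed points e f r = indicator {0<..<len e} r * g e r"
proof -
  show "f \<in> H1 points"
    unfolding H1_def using off AC2_continuous_on[OF AC] AC2_sobolev(1)[OF len_pos AC]
    by (auto simp: continuous_map_gtop_iff edge_dom_points)
  assume e: "e \<in> arcs G"
  show "AE r in lborel. ed points e f r = indicator {0<..<len e} r * g e r"
    using AC2_sobolev(2)[OF len_pos AC, OF e e]
    by eventually_elim (auto simp: ed_def edge_dom_points[OF e] indicator_def)
qed

section \<open>Extension by zero and restriction to closed subsets\<close>

lemma ed_supp: "r \<notin> edge_dom K e \<Longrightarrow> ed K e f r = 0"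
  by (simp add: ed_def)

text \<open>The boundary values give continuity across the frontier. Along an edge, \<open>f\<close>
  vanishes off \<open>edge_dom K e\<close>, and \<open>zero_extension_integral\<close> joins its
  possibly infinitely many intervals. In this way test functions of a cell become competitors on the
  whole graph.\<close>

lemma zero_extension:
  assumes K: "closedin gtop K" and f: "f \<in> H1_dir K (gtop frontier_of K)"
  shows "f \<in> H1 points" and "e \<in> arcs G \<Longrightarrow> AE r in lborel. ed points e f r = ed K e f r"
proof -
  have fK: "f \<in> H1 K" and f0: "\<And>x. x \<in> gtop frontier_of K \<Longrightarrow> f x = 0"
    using f by (auto simp: H1_dir_def)
  have Ksub: "K \<subseteq> points" using K closedin_subset by fastforce
  have int: "x \<in> gtop interior_of K" if "f x \<noteq> 0" for x
    using f0[of x] H1_off[OF fK, of x] that K by (auto simp: frontier_of_def closure_of_closedin)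
  have cont: "continuous_map gtop euclideanreal f"
  proof (rule continuous_map_cases_alt[where P = "\<lambda>x. x \<in> K" and f = f and g = "\<lambda>x. 0", THEN continuous_map_eq])
    show "continuous_map (subtopology gtop (gtop closure_of {x \<in> topspace gtop. x \<in> K})) euclideanreal f"
    proof -
      have "{x \<in> topspace gtop. x \<in> K} = K" using Ksub by auto
      then show ?thesis using fK K by (simp add: H1_def closure_of_closedin)
    qed
    show "continuous_map (subtopology gtop (gtop closure_of {x \<in> topspace gtop. x \<notin> K})) euclideanreal (\<lambda>x. 0)"
      by simp
    have eq: "{x \<in> topspace gtop. x \<in> K} = K" using Ksub by auto
    show "f x = 0" if "x \<in> gtop frontier_of {x \<in> topspace gtop. x \<in> K}" for x
      using that f0 unfolding eq by blast
    show "(if x \<in> K then f x else 0) = f x" for x using H1_off[OF fK] by simp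
  qed
  have AC: "AC2 0 (len e) (f \<circ> edge_map e) (ed K e f)" if e: "e \<in> arcs G" for e
  proof (rule AC2_from_interior)
    show "0 < len e" using e by (rule len_pos)
    show L: "L2 (ed K e f)" using fK e by (rule L2_ed)
    show c: "continuous_on {0..len e} (f \<circ> edge_map e)" using cont e continuous_map_gtop_iff by blast
    fix s t assume st: "0 < s" "s \<le> t" "t < len e"
    show "(f \<circ> edge_map e) t - (f \<circ> edge_map e) s = (LINT r:{s<..t}|lborel. ed K e f r)"
    proof (rule zero_extension_integral[OF open_edge_dom[of K e] L])
      show "ed K e f r = 0" if "r \<notin> edge_dom K e" for r using that by (rule ed_supp)
      show "continuous_on {s..t} (f \<circ> edge_map e)" by (rule continuous_on_subset[OF c]) (use st in auto)
      show "(f \<circ> edge_map e) r = 0" if "r \<in> {s..t}" "r \<notin> edge_dom K e" for r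
        using edge_dom_iff[OF e, of r K] int[of "edge_map e r"] that st by auto
      show "s \<le> t" by fact
      fix p q assume pq: "s \<le> p" "p < q" "q \<le> t" "{p..q} \<subseteq> edge_dom K e"
      have "(f \<circ> edge_map e) q - (f \<circ> edge_map e) p
          = (LINT r:{p<..q}|lborel. weak_deriv (edge_dom K e) (f \<circ> edge_map e) r)"
        by (rule weak_derivative_integral[OF _ weak_deriv(2)[OF H1_sobolev[OF fK e]]])
          (use pq L continuous_on_subset[OF H1_continuous_edge_dom[OF fK e]] in \<open>auto simp: ed_def[abs_def]\<close>)
      also have "\<dots> = (LINT r:{p<..q}|lborel. ed K e f r)"
        unfolding set_lebesgue_integral_def
        by (rule Bochner_Integration.integral_cong)
          (use pq in \<open>auto simp: ed_def indicator_def subset_iff\<close>)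
      finally show "(f \<circ> edge_map e) q - (f \<circ> edge_map e) p = (LINT r:{p<..q}|lborel. ed K e f r)" .
    qed
  qed
  have off: "f x = 0" if "x \<notin> points" for x using H1_off[OF fK] Ksub that by blast
  show "f \<in> H1 points" by (rule H1_points_AC2(1)[OF off AC])
  assume e: "e \<in> arcs G"
  have "AE r in lborel. ed points e f r = indicator {0<..<len e} r * ed K e f r"
    by (rule H1_points_AC2(2)) (use off AC e in auto)
  then show "AE r in lborel. ed points e f r = ed K e f r"
  proof eventually_elim
    case (elim r)
    then show ?case
      using ed_supp[of r K e f] subsetD[OF edge_dom_subset, of r K e] by (cases "r \<in> edge_dom K e") auto
  qed
qed

lemma restrict_H1:
  assumes f: "f \<in> H1 points" and K: "K \<subseteq> points"
  defines "h \<equiv> \<lambda>x. if x \<in> K then f x else 0"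
  shows "h \<in> H1 K"
    and "e \<in> arcs G \<Longrightarrow> AE r in lborel. ed K e h r = indicator (edge_dom K e) r * ed points e f r"
proof -
  have eq: "(h \<circ> edge_map e) t = (f \<circ> edge_map e) t" if "e \<in> arcs G" "t \<in> edge_dom K e" for e t
    using edge_dom_in[OF that] by (simp add: h_def)
  define w where "w e = weak_deriv (edge_dom points e) (f \<circ> edge_map e)" for e
  have sub: "edge_dom K e \<subseteq> edge_dom points e" if "e \<in> arcs G" for e
    using edge_dom_subset edge_dom_points[OF that] by auto
  have bor: "edge_dom K e \<in> sets borel" for e using open_edge_dom by auto
  note wf = weak_deriv[OF H1_sobolev[OF f], folded w_def]
  have sq: "sq_integrable_on (edge_dom K e) (w e)" if "e \<in> arcs G" for e
    by (rule sq_integrable_on_subset[OF wf(1)[OF that] bor sub[OF that]]) simp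
  have wd: "weak_derivative_on (edge_dom K e) (h \<circ> edge_map e) (w e)" if "e \<in> arcs G" for e
    by (rule weak_derivative_on_subset[OF wf(2)[OF that] sub[OF that] eq[OF that]])
  have "sq_integrable_on (edge_dom K e) (h \<circ> edge_map e)" if "e \<in> arcs G" for e
    by (rule sq_integrable_on_subset[OF
          H1_sobolev[OF f that, unfolded sobolev_H1_on_def, THEN conjunct1] bor sub[OF that] eq[OF that]])
  then have "sobolev_H1_on (edge_dom K e) (h \<circ> edge_map e)" if "e \<in> arcs G" for e
    using sq[OF that] wd[OF that] that by (auto simp: sobolev_H1_on_def)
  moreover have "continuous_map (subtopology gtop K) euclideanreal h"
  proof (rule continuous_map_eq)
    show "continuous_map (subtopology gtop K) euclideanreal f"
      using f by (intro continuous_map_from_subtopology) (simp add: H1_def)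
    show "f x = h x" if "x \<in> topspace (subtopology gtop K)" for x using that by (simp add: h_def)
  qed
  ultimately show H: "h \<in> H1 K" by (auto simp: H1_def h_def)
  assume e: "e \<in> arcs G"
  show "AE r in lborel. ed K e h r = indicator (edge_dom K e) r * ed points e f r"
    using ed_unique[OF H e sq[OF e] wd[OF e]]
  proof eventually_elim
    case (elim r)
    then show ?case using sub[OF e] by (auto simp: ed_def w_def indicator_def)
  qed
qed

lemma energy_zero_extension:
  assumes K: "closedin gtop K" and f: "f \<in> H1_dir K (gtop frontier_of K)"
    and g: "g \<in> H1_dir K (gtop frontier_of K)"
  shows "energy points f g = energy K f g"
  unfolding energy_ed[of K]
  using zero_extension[OF K f] zero_extension[OF K g] f g L2_measurable[OF L2_ed]
  by (intro energy_cong_AE) (auto simp: H1_dir_def)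

text \<open>Only \<open>g\<close> has to vanish on the frontier: its derivative is zero off the
  interior of \<open>K\<close>, so what \<open>f\<close> does there does not enter.\<close>

lemma energy_restrict:
  assumes K: "closedin gtop K" and f: "f \<in> H1 points" and g: "g \<in> H1_dir K (gtop frontier_of K)"
  shows "energy points f g = energy K (\<lambda>x. if x \<in> K then f x else 0) g"
proof -
  have gK: "g \<in> H1 K" using g by (simp add: H1_dir_def)
  have Ksub: "K \<subseteq> points" using K closedin_subset by fastforce
  have m: "ed points e f \<in> borel_measurable lborel" "ed K e g \<in> borel_measurable lborel"
    if "e \<in> arcs G" for e
    using L2_measurable[OF L2_ed[OF f that]] L2_measurable[OF L2_ed[OF gK that]] by simp_all
  have "energy points f g = (\<Sum>e\<in>arcs G. LINT r|lborel. ed points e f r * ed K e g r)"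
    using zero_extension[OF K g] m f by (intro energy_cong_AE) auto
  also have "\<dots> = (\<Sum>e\<in>arcs G. LINT r|lborel. (indicator (edge_dom K e) r * ed points e f r) * ed K e g r)"
    by (intro sum.cong Bochner_Integration.integral_cong refl) (auto simp: ed_def indicator_def)
  also have "\<dots> = energy K (\<lambda>x. if x \<in> K then f x else 0) g"
    using restrict_H1[OF f Ksub] m open_edge_dom gK
    by (intro energy_cong_AE[symmetric] borel_measurable_times) auto
  finally show ?thesis .
qed

text \<open>The derivatives live on the interiors, so shared boundaries contribute nothing, even
  boundaries of positive length.\<close>

lemma energy_disjoint_supports:
  assumes K: "closedin gtop K" "f \<in> H1_dir K (gtop frontier_of K)"
    and L: "closedin gtop L" "g \<in> H1_dir L (gtop frontier_of L)"
    and disj: "gtop interior_of K \<inter> gtop interior_of L = {}"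
  shows "energy points f g = 0"
proof -
  have fK: "f \<in> H1 K" and gL: "g \<in> H1 L" using K L by (auto simp: H1_dir_def)
  have m: "ed K e f \<in> borel_measurable lborel" "ed L e g \<in> borel_measurable lborel"
    if "e \<in> arcs G" for e
    using L2_measurable[OF L2_ed[OF fK that]] L2_measurable[OF L2_ed[OF gL that]] by simp_all
  have "energy points f g = (\<Sum>e\<in>arcs G. LINT r|lborel. ed K e f r * ed L e g r)"
    using zero_extension[OF K] zero_extension[OF L] m by (intro energy_cong_AE) auto
  also have "\<dots> = 0"
  proof (rule sum.neutral, rule ballI)
    fix e assume e: "e \<in> arcs G"
    have "ed K e f r * ed L e g r = 0" for r
    proof (cases "r \<in> edge_dom K e \<and> r \<in> edge_dom L e")
      case True
      then have "r \<in> {0<..<len e}" using edge_dom_subset by blast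
      then show ?thesis using True edge_dom_iff[OF e, of r] disj by blast
    qed (auto simp: ed_def)
    then have "(\<lambda>r. ed K e f r * ed L e g r) = (\<lambda>r. 0)" by (rule ext)
    then show "(LINT r|lborel. ed K e f r * ed L e g r) = 0" by (simp only: integral_zero)
  qed
  finally show ?thesis .
qed

end


section \<open>Minimizing the energy for given oscillation\<close>

lemma AC2_cong: "AC2 a b u g \<Longrightarrow> (\<And>t. t \<in> {a..b} \<Longrightarrow> w t = u t) \<Longrightarrow> AC2 a b w g"
  by (auto simp: AC2_def)

lemma AC2_tent:
  assumes "0 < l"
  shows "\<exists>w h. AC2 0 l w h \<and> w 0 = 0 \<and> w (l / 2) = 1 \<and> w l = (0::real)"
proof -
  have "AC2 0 l (\<lambda>t. if t \<le> l / 2 then 0 + t * (2 / l) else 2 + t * (- 2 / l))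
     (\<lambda>r. if r \<le> l / 2 then indicator {0<..l / 2} r * (2 / l) else indicator {l / 2<..l} r * (- 2 / l))"
    by (rule AC2_join[OF AC2_linear AC2_linear]) (use assms in auto)
  then show ?thesis
    using assms by (intro exI conjI) (assumption, auto)
qed

lemma finite_family_convergent_subsequence:
  fixes a :: "'i \<Rightarrow> nat \<Rightarrow> real"
  assumes "finite A" "\<And>i. i \<in> A \<Longrightarrow> bounded (range (a i))"
  shows "\<exists>r::nat \<Rightarrow> nat. strict_mono r \<and> (\<forall>i\<in>A. convergent (\<lambda>n. a i (r n)))"
  using assms
proof (induction A rule: finite_induct)
  case empty
  show ?case by (rule exI[of _ id]) (simp add: strict_mono_def)
next
  case (insert i A)
  then obtain r where r: "strict_mono r" "\<forall>i\<in>A. convergent (\<lambda>n. a i (r n))" by auto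
  have "bounded (range (\<lambda>n. a i (r n)))"
    by (rule bounded_subset[of "range (a i)"]) (use insert.prems in auto)
  then obtain l q where q: "strict_mono (q::nat\<Rightarrow>nat)" "((\<lambda>n. a i (r n)) \<circ> q) \<longlonglongrightarrow> l"
    using bounded_imp_convergent_subsequence by blast
  have "convergent (\<lambda>n. a j ((r \<circ> q) n))" if "j \<in> insert i A" for j
  proof (cases "j = i")
    case True
    then show ?thesis using q(2) by (auto simp: convergent_def o_def)
  next
    case False
    then have "convergent (\<lambda>n. a j (r n))" using that r(2) by auto
    from convergent_subseq_convergent[OF this q(1)] show ?thesis by (simp add: o_def)
  qed
  moreover have "strict_mono (r \<circ> q)" using r(1) q(1) by (rule strict_mono_o)
  ultimately show ?case by blast
qed

context metric_graph
begin

lemma finite_arcs_G [simp]: "finite (arcs G)"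
  by (rule finite_arcs)

lemma H1_Holder:
  assumes f: "f \<in> H1 points" and e: "e \<in> arcs G" and st: "s \<in> {0..len e}" "t \<in> {0..len e}"
  shows "(f (edge_map e t) - f (edge_map e s))\<^sup>2 \<le> \<bar>t - s\<bar> * energy points f f"
proof -
  have L: "L2 (ed points e f)" using f e by (rule L2_ed)
  have "(LINT r|lborel. ed points e f r * ed points e f r) \<le> energy points f f"
    unfolding energy_ed by (rule member_le_sum[OF e]) (auto intro: integral_nonneg_AE)
  then have le: "(LINT r:UNIV|lborel. (ed points e f r)\<^sup>2) \<le> energy points f f"
    by (simp add: set_lebesgue_integral_def power2_eq_square)
  have *: "(f (edge_map e b) - f (edge_map e a))\<^sup>2 \<le> (b - a) * energy points f f"
    if "0 \<le> a" "a \<le> b" "b \<le> len e" for a b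
  proof -
    have "(f (edge_map e b) - f (edge_map e a))\<^sup>2 \<le> (b - a) * (LINT r:{a<..b}|lborel. (ed points e f r)\<^sup>2)"
      using AC2_Holder[OF H1_edge_AC2[OF f e] that] by simp
    also have "\<dots> \<le> (b - a) * energy points f f"
      using set_integral_sq_mono[OF L, of "{a<..b}" UNIV] le that by (intro mult_left_mono) auto
    finally show ?thesis .
  qed
  show ?thesis
    using *[of s t] *[of t s] st by (cases "s \<le> t") (auto simp: power2_commute)
qed

lemma energy_zero_imp_constant:
  assumes f: "f \<in> H1 points" and z: "energy points f f = 0" and x: "x \<in> points" and y: "y \<in> points"
  shows "f x = f y"
proof -
  have edge: "f (edge_map e t) = f (Vertex (tail G e))" if "e \<in> arcs G" "t \<in> {0..len e}" for e t
    using H1_Holder[OF f that(1), of 0 t] that z len_pos[OF that(1)] by simp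
  have vert: "f (Vertex v) = f (Vertex w)" if "v \<in> verts G" "w \<in> verts G" for v w
  proof (rule vertex_reach[of v w "\<lambda>u. f (Vertex v) = f (Vertex u)"])
    fix e assume e: "e \<in> arcs G"
    show "f (Vertex v) = f (Vertex (tail G e)) \<longleftrightarrow> f (Vertex v) = f (Vertex (head G e))"
      using edge[OF e, of "len e"] len_pos[OF e] edge_map_len[OF e] by simp
  qed (use that in auto)
  obtain e s where e: "e \<in> arcs G" "s \<in> {0..len e}" "x = edge_map e s" using points_edge_map[OF x] .
  obtain d t where d: "d \<in> arcs G" "t \<in> {0..len d}" "y = edge_map d t" using points_edge_map[OF y] .
  show ?thesis
    using edge[OF e(1,2)] edge[OF d(1,2)] vert[of "tail G e" "tail G d"] e d by simp
qed

lemma attains_sup_points: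
  assumes f: "continuous_map gtop euclideanreal f"
  shows "\<exists>x\<in>points. \<forall>y\<in>points. f y \<le> f x"
proof -
  have "\<exists>s\<in>{0..len e}. \<forall>t\<in>{0..len e}. f (edge_map e t) \<le> f (edge_map e s)" if "e \<in> arcs G" for e
    using continuous_attains_sup[of "{0..len e}" "f \<circ> edge_map e"] f continuous_map_gtop_iff len_pos[OF that] that
    by auto
  then obtain s where s: "\<And>e. e \<in> arcs G \<Longrightarrow> s e \<in> {0..len e}"
    "\<And>e t. e \<in> arcs G \<Longrightarrow> t \<in> {0..len e} \<Longrightarrow> f (edge_map e t) \<le> f (edge_map e (s e))"
    by metis
  let ?S = "(\<lambda>e. f (edge_map e (s e))) ` arcs G"
  have S: "finite ?S" "?S \<noteq> {}" using arcs_nonempty by auto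
  then have "Max ?S \<in> ?S" by (rule Max_in)
  then obtain e0 where e0: "e0 \<in> arcs G" "Max ?S = f (edge_map e0 (s e0))" by auto
  show ?thesis
  proof (intro bexI ballI)
    show "edge_map e0 (s e0) \<in> points" using e0 edge_map_in_points by blast
    fix y assume "y \<in> points"
    then obtain e t where e: "e \<in> arcs G" "t \<in> {0..len e}" "y = edge_map e t" by (rule points_edge_map)
    then have "f y \<le> f (edge_map e (s e))" using s(2) by blast
    also have "\<dots> \<le> Max ?S" using S e by (intro Max_ge) auto
    finally show "f y \<le> f (edge_map e0 (s e0))" using e0 by simp
  qed
qed

lemma H1_continuous: "f \<in> H1 points \<Longrightarrow> continuous_map gtop euclideanreal f"
  by (simp add: H1_def)

lemma attains_inf_points:
  assumes f: "continuous_map gtop euclideanreal f"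
  shows "\<exists>x\<in>points. \<forall>y\<in>points. f x \<le> f y"
proof -
  have "continuous_map gtop euclideanreal (\<lambda>x. - f x)" using f by (intro continuous_intros)
  from attains_sup_points[OF this] show ?thesis by auto
qed

lemma points_nonempty: "points \<noteq> {}"
  using arcs_nonempty edge_map_in_points by blast

lemma glue_edges:
  assumes AC: "\<And>e. e \<in> arcs G \<Longrightarrow> AC2 0 (len e) (w e) (h e)"
    and ends: "\<And>e. e \<in> arcs G \<Longrightarrow> w e 0 = F (tail G e)" "\<And>e. e \<in> arcs G \<Longrightarrow> w e (len e) = F (head G e)"
  obtains f where "f \<in> H1 points" "\<And>e t. e \<in> arcs G \<Longrightarrow> t \<in> {0..len e} \<Longrightarrow> f (edge_map e t) = w e t"
    "energy points f f \<le> (\<Sum>e\<in>arcs G. LINT r:{0<..len e}|lborel. (h e r)\<^sup>2)"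
proof -
  define f where "f x = (if x \<in> points then (case x of Vertex v \<Rightarrow> F v | Inner e t \<Rightarrow> w e t) else 0)" for x
  have f_eq: "f (edge_map e t) = w e t" if "e \<in> arcs G" "t \<in> {0..len e}" for e t
    using that ends[OF that(1)] edge_map_in_points[OF that(1), of t] by (auto simp: f_def edge_map_def)
  have AC': "AC2 0 (len e) (f \<circ> edge_map e) (h e)" if "e \<in> arcs G" for e
    by (rule AC2_cong[OF AC[OF that]]) (use f_eq that in auto)
  have off: "f x = 0" if "x \<notin> points" for x using that by (simp add: f_def)
  have f: "f \<in> H1 points" by (rule H1_points_AC2(1)) (use off AC' in auto)
  have L: "L2 (h e)" if "e \<in> arcs G" for e using AC[OF that] by (simp add: AC2_def)
  have "energy points f f
      = (\<Sum>e\<in>arcs G. LINT r|lborel. (indicator {0<..<len e} r * h e r) * (indicator {0<..<len e} r * h e r))"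
  proof (rule energy_cong_AE[OF f f])
    fix e assume e: "e \<in> arcs G"
    show "(\<lambda>r. indicator {0<..<len e} r * h e r) \<in> borel_measurable lborel"
      using L2_measurable[OF L[OF e]] by simp
    then show "(\<lambda>r. indicator {0<..<len e} r * h e r) \<in> borel_measurable lborel" .
    show "AE r in lborel. ed points e f r = indicator {0<..<len e} r * h e r"
      by (rule H1_points_AC2(2)) (use off AC' e in auto)
    then show "AE r in lborel. ed points e f r = indicator {0<..<len e} r * h e r" .
  qed
  also have "\<dots> = (\<Sum>e\<in>arcs G. LINT r:{0<..<len e}|lborel. (h e r)\<^sup>2)"
    unfolding set_lebesgue_integral_def
    by (intro sum.cong Bochner_Integration.integral_cong refl) (auto simp: indicator_def power2_eq_square)
  also have "\<dots> \<le> (\<Sum>e\<in>arcs G. LINT r:{0<..len e}|lborel. (h e r)\<^sup>2)"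
    by (intro sum_mono set_integral_sq_mono L) auto
  finally show thesis using that[OF f f_eq] by blast
qed

lemma const_H1: "(\<lambda>x. if x \<in> points then c else 0) \<in> H1 points"
  and ed_const: "e \<in> arcs G \<Longrightarrow> AE r in lborel. ed points e (\<lambda>x. if x \<in> points then c else 0) r = 0"
proof -
  have AC: "AC2 0 (len e) ((\<lambda>x. if x \<in> points then c else 0) \<circ> edge_map e) (\<lambda>r. 0)" if "e \<in> arcs G" for e
    using edge_map_in_points[OF that] by (auto simp: AC2_def L2_def set_lebesgue_integral_def)
  show "(\<lambda>x. if x \<in> points then c else 0) \<in> H1 points"
    by (rule H1_points_AC2(1)) (use AC in auto)
  assume e: "e \<in> arcs G"
  have "AE r in lborel. ed points e (\<lambda>x. if x \<in> points then c else 0) r = indicator {0<..<len e} r * 0"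
    by (rule H1_points_AC2(2)[where g = "\<lambda>e r. 0"]) (use AC e in auto)
  then show "AE r in lborel. ed points e (\<lambda>x. if x \<in> points then c else 0) r = 0" by simp
qed

lemma energy_const:
  assumes "h \<in> H1 points"
  shows "energy points (\<lambda>x. if x \<in> points then c else 0) h = 0"
proof -
  have "energy points (\<lambda>x. if x \<in> points then c else 0) h = (\<Sum>e\<in>arcs G. LINT r|lborel. 0 * ed points e h r)"
    using ed_const L2_measurable[OF L2_ed[OF assms]] by (intro energy_cong_AE const_H1 assms) auto
  then show ?thesis by simp
qed

section \<open>The least energy for oscillation 1\<close>

definition osc_energies :: "real set" where
  "osc_energies = {energy points f f | f x y. f \<in> H1 points \<and> x \<in> points \<and> y \<in> points \<and> f x - f y = 1}"

text \<open>The reciprocal of the largest effective resistance between two points, the graph being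
  an electrical network in which each edge has its length as resistance. Admitting arbitrary points
  in \<open>osc_energies\<close>, not only extrema, leaves the infimum unchanged, since rescaling a
  larger oscillation to 1 lowers the energy.\<close>

definition osc_min :: real where
  "osc_min = Inf osc_energies"

lemma osc_energies_nonempty: "osc_energies \<noteq> {}"
proof -
  have "\<exists>w h. AC2 0 (len e) w h \<and> w 0 = 0 \<and> w (len e / 2) = 1 \<and> w (len e) = (0::real)" if "e \<in> arcs G" for e
    using AC2_tent len_pos that by blast
  then obtain w h where w: "\<And>e. e \<in> arcs G \<Longrightarrow> AC2 0 (len e) (w e) (h e)"
    "\<And>e. e \<in> arcs G \<Longrightarrow> w e 0 = 0" "\<And>e. e \<in> arcs G \<Longrightarrow> w e (len e / 2) = (1::real)"
    "\<And>e. e \<in> arcs G \<Longrightarrow> w e (len e) = 0"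
    by metis
  obtain f where f: "f \<in> H1 points" "\<And>e t. e \<in> arcs G \<Longrightarrow> t \<in> {0..len e} \<Longrightarrow> f (edge_map e t) = w e t"
    by (rule glue_edges[of w h "\<lambda>_. 0"]) (use w in auto)
  obtain e where e: "e \<in> arcs G" using arcs_nonempty by blast
  have "f (edge_map e (len e / 2)) - f (edge_map e 0) = 1"
    using f(2)[OF e, of "len e / 2"] f(2)[OF e, of 0] w[OF e] len_pos[OF e] by simp
  then have "energy points f f \<in> osc_energies"
    unfolding osc_energies_def using f(1) edge_map_in_points[OF e] by blast
  then show ?thesis by blast
qed

lemma osc_min_le:
  assumes f: "f \<in> H1 points" and xy: "x \<in> points" "y \<in> points"
  shows "osc_min * (f x - f y)\<^sup>2 \<le> energy points f f"
proof (cases "f x = f y")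
  case True
  then show ?thesis using energy_nonneg by simp
next
  case False
  define d where "d = f x - f y"
  have d: "d \<noteq> 0" using False by (simp add: d_def)
  have "(1 / d) * f x - (1 / d) * f y = 1"
    using d by (simp add: d_def diff_divide_distrib[symmetric])
  then have "energy points (\<lambda>x. (1 / d) * f x) (\<lambda>x. (1 / d) * f x) \<in> osc_energies"
    unfolding osc_energies_def using H1_scale[OF f, of "1 / d"] xy by blast
  moreover have "bdd_below osc_energies"
    unfolding osc_energies_def by (rule bdd_belowI[of _ 0]) (auto intro: energy_nonneg)
  ultimately have "osc_min \<le> (1 / d)\<^sup>2 * energy points f f"
    unfolding osc_min_def energy_scale[OF f, symmetric] by (rule cInf_lower)
  then have "osc_min \<le> energy points f f / d\<^sup>2" by (simp add: power_divide)
  moreover have "0 < d\<^sup>2" using d by simp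
  ultimately show ?thesis
    unfolding d_def[symmetric] by (simp only: pos_le_divide_eq)
qed

text \<open>Values in the unit interval keep the vertex values of a minimizing sequence in a compact
  set. Constants can be subtracted because they carry no energy, and division by the oscillation
  \<open>d\<close> \<ge> 1 does not raise the energy.\<close>

lemma osc_almost_minimizer:
  assumes "\<epsilon> > 0"
  obtains f x y where "f \<in> H1 points" "x \<in> points" "y \<in> points" "f x = 1" "f y = 0"
    "\<And>z. z \<in> points \<Longrightarrow> f z \<in> {0..1}" "energy points f f < osc_min + \<epsilon>"
proof -
  obtain q where "q \<in> osc_energies" "q < osc_min + \<epsilon>"
    using cInf_lessD[OF osc_energies_nonempty, of "osc_min + \<epsilon>"] assms by (auto simp: osc_min_def)
  then obtain f x y where f: "f \<in> H1 points" "x \<in> points" "y \<in> points" "f x - f y = 1"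
    "energy points f f < osc_min + \<epsilon>"
    unfolding osc_energies_def by blast
  obtain x' where x': "x' \<in> points" "\<And>z. z \<in> points \<Longrightarrow> f z \<le> f x'"
    using attains_sup_points[OF H1_continuous[OF f(1)]] by blast
  obtain y' where y': "y' \<in> points" "\<And>z. z \<in> points \<Longrightarrow> f y' \<le> f z"
    using attains_inf_points[OF H1_continuous[OF f(1)]] by blast
  define d where "d = f x' - f y'"
  have d: "d \<ge> 1" using x'(2)[OF f(2)] y'(2)[OF f(3)] f(4) by (simp add: d_def)
  define one where "one = (\<lambda>x. if x \<in> points then 1 else 0 :: real)"
  have one: "one \<in> H1 points" unfolding one_def by (rule const_H1)
  define g where "g = (\<lambda>z. (1 / d) * f z + (- f y' / d) * one z)"
  have g: "g \<in> H1 points" unfolding g_def by (rule H1_linear(1)[OF f(1) one])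
  have g_eq: "g z = (f z - f y') / d" if "z \<in> points" for z
    using that by (simp add: g_def one_def diff_divide_distrib)
  have "energy points one one = 0" "energy points f one = 0"
    using energy_const[OF one] energy_const[OF f(1)] energy_commute unfolding one_def by metis+
  then have "energy points g g = (1 / d)\<^sup>2 * energy points f f"
    unfolding g_def energy_linear_square[OF f(1) one] by simp
  also have "\<dots> \<le> 1 * energy points f f"
    using d by (intro mult_right_mono energy_nonneg power_le_one) auto
  finally have "energy points g g < osc_min + \<epsilon>" using f(5) by simp
  moreover have "g x' = 1" "g y' = 0" using g_eq x'(1) y'(1) d by (auto simp: d_def)
  moreover have "g z \<in> {0..1}" if "z \<in> points" for z
  proof -
    have "0 \<le> f z - f y'" "f z - f y' \<le> d" using x'(2)[OF that] y'(2)[OF that] by (auto simp: d_def)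
    then show ?thesis using g_eq[OF that] d by simp
  qed
  ultimately show thesis using that[OF g x'(1) y'(1)] by blast
qed

lemma osc_minimizer_exists:
  obtains f x y where "f \<in> H1 points" "x \<in> points" "y \<in> points" "f x = 1" "f y = 0"
    "energy points f f = osc_min"
proof -
  define P where "P e d n f s t \<longleftrightarrow> f \<in> H1 points \<and> s \<in> {0..len e} \<and> t \<in> {0..len d} \<and>
      f (edge_map e s) = 1 \<and> f (edge_map d t) = 0 \<and> (\<forall>z\<in>points. f z \<in> {0..1}) \<and>
      energy points f f < osc_min + 1 / real (Suc n)" for e d n f s t
  have P_mono: "P e d m f s t" if "P e d n f s t" "m \<le> n" for e d m n f s t
  proof -
    have "1 / real (Suc n) \<le> 1 / real (Suc m)" using that by (intro divide_left_mono) auto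
    then show ?thesis using that unfolding P_def by auto
  qed
  have ex: "\<exists>e\<in>arcs G. \<exists>d\<in>arcs G. \<exists>f s t. P e d n f s t" for n
  proof -
    obtain f x y where f: "f \<in> H1 points" "x \<in> points" "y \<in> points" "f x = 1" "f y = 0"
      "\<And>z. z \<in> points \<Longrightarrow> f z \<in> {0..1}" "energy points f f < osc_min + 1 / real (Suc n)"
      by (rule osc_almost_minimizer[of "1 / real (Suc n)"]) auto
    obtain e s where e: "e \<in> arcs G" "s \<in> {0..len e}" "x = edge_map e s" using points_edge_map[OF f(2)] .
    obtain d t where d: "d \<in> arcs G" "t \<in> {0..len d}" "y = edge_map d t" using points_edge_map[OF f(3)] .
    have "P e d n f s t" using f e d by (simp add: P_def)
    then show ?thesis using e(1) d(1) by blast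
  qed
  \<comment> \<open>The edges that carry the maximum and the minimum can be fixed once for all
    \<open>n\<close>: there are finitely many pairs, and \<open>P\<close> for a large
    \<open>n\<close> implies \<open>P\<close> for every smaller one.\<close>
  have "\<exists>e\<in>arcs G. \<exists>d\<in>arcs G. \<forall>n. \<exists>f s t. P e d n f s t"
  proof (rule ccontr)
    assume "\<not> ?thesis"
    then obtain N where N: "\<And>e d. e \<in> arcs G \<Longrightarrow> d \<in> arcs G \<Longrightarrow> \<not> (\<exists>f s t. P e d (N e d) f s t)"
      by metis
    define M where "M = Max ((\<lambda>(e, d). N e d) ` (arcs G \<times> arcs G))"
    obtain e d f s t where e: "e \<in> arcs G" "d \<in> arcs G" "P e d M f s t" using ex by blast
    have "N e d \<le> M" unfolding M_def using e by (intro Max_ge) auto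
    then show False using P_mono[OF e(3)] N[OF e(1,2)] by blast
  qed
  then obtain e d where ed: "e \<in> arcs G" "d \<in> arcs G" "\<And>n. \<exists>f s t. P e d n f s t" by blast
  then obtain F s t where F: "\<And>n. P e d n (F n) (s n) (t n)" by metis
  \<comment> \<open>Vertex values and the two positions on the fixed edges form one finite family,
    so that a single subsequence serves all of them.\<close>
  define a where "a i n = (case i of Inl v \<Rightarrow> F n (Vertex v) | Inr b \<Rightarrow> if b then s n else t n)" for i n
  have vp: "Vertex v \<in> points" if "v \<in> verts G" for v using that by (simp add: points_def)
  have "\<exists>r::nat \<Rightarrow> nat. strict_mono r \<and> (\<forall>i\<in>Inl ` verts G \<union> {Inr True, Inr False}. convergent (\<lambda>n. a i (r n)))"
  proof (rule finite_family_convergent_subsequence)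
    show "finite (Inl ` verts G \<union> {Inr True, Inr False})" by simp
    fix i assume i: "i \<in> Inl ` verts G \<union> {Inr True, Inr False}"
    have "range (a i) \<subseteq> {0..max 1 (max (len e) (len d))}"
      using i F vp by (fastforce simp: a_def P_def le_max_iff_disj)
    then show "bounded (range (a i))" using bounded_subset bounded_closed_interval by blast
  qed
  then obtain r where r: "strict_mono (r::nat\<Rightarrow>nat)"
    and conv: "\<And>i. i \<in> Inl ` verts G \<union> {Inr True, Inr False} \<Longrightarrow> convergent (\<lambda>n. a i (r n))" by blast
  define f where "f n = F (r n)" for n
  \<comment> \<open>An index \<open>r n\<close> of the subsequence is at least \<open>n\<close>, so
    the energy bound with index \<open>n\<close> survives the renumbering.\<close>
  have Pf: "P e d n (f n) (s (r n)) (t (r n))" for n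
    unfolding f_def using P_mono[OF F seq_suble[OF r]] .
  have fH: "f n \<in> H1 points" for n using Pf by (simp add: P_def)
  have f_en: "energy points (f n) (f n) < osc_min + 1 / real (Suc n)" for n using Pf by (simp add: P_def)
  obtain s0 where s0: "(\<lambda>n. s (r n)) \<longlonglongrightarrow> s0" using conv[of "Inr True"] by (auto simp: a_def convergent_def)
  obtain t0 where t0: "(\<lambda>n. t (r n)) \<longlonglongrightarrow> t0" using conv[of "Inr False"] by (auto simp: a_def convergent_def)
  have s0_in: "s0 \<in> {0..len e}"
    using closed_sequentially[OF _ _ s0, of "{0..len e}"] Pf by (simp add: P_def)
  have t0_in: "t0 \<in> {0..len d}"
    using closed_sequentially[OF _ _ t0, of "{0..len d}"] Pf by (simp add: P_def)
  define x where "x = edge_map e s0"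
  define y where "y = edge_map d t0"
  have xy: "x \<in> points" "y \<in> points" using ed edge_map_in_points by (auto simp: x_def y_def)
  \<comment> \<open>The bounded energies make the sequence uniformly Hoelder continuous on the edge,
    so the value \<open>c\<close> taken at the moving points \<open>p n\<close> is the limit of the
    values at their limit point.\<close>
  have lim_pt: "(\<lambda>n. f n (edge_map k p0)) \<longlonglongrightarrow> c"
    if k: "k \<in> arcs G" and p: "p \<longlonglongrightarrow> p0" "p0 \<in> {0..len k}" "\<And>n. p n \<in> {0..len k}" "\<And>n. f n (edge_map k (p n)) = c"
    for k p p0 c
  proof -
    have bound: "\<bar>f n (edge_map k p0) - c\<bar> \<le> sqrt (\<bar>p0 - p n\<bar> * (osc_min + 1))" for n
    proof (rule real_le_rsqrt)
      have "osc_min + 1 / real (Suc n) \<le> osc_min + 1" by simp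
      then have "energy points (f n) (f n) \<le> osc_min + 1" using f_en[of n] by linarith
      then have "\<bar>p0 - p n\<bar> * energy points (f n) (f n) \<le> \<bar>p0 - p n\<bar> * (osc_min + 1)"
        by (intro mult_left_mono) auto
      then show "\<bar>f n (edge_map k p0) - c\<bar>\<^sup>2 \<le> \<bar>p0 - p n\<bar> * (osc_min + 1)"
        using H1_Holder[OF fH[of n] k p(3)[of n] p(2)] p(4)[of n] by simp
    qed
    have "(\<lambda>n. sqrt (\<bar>p0 - p n\<bar> * (osc_min + 1))) \<longlonglongrightarrow> sqrt (\<bar>p0 - p0\<bar> * (osc_min + 1))"
      by (intro tendsto_intros p(1))
    then have "(\<lambda>n. sqrt (\<bar>p0 - p n\<bar> * (osc_min + 1))) \<longlonglongrightarrow> 0" by simp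
    then have "(\<lambda>n. f n (edge_map k p0) - c) \<longlonglongrightarrow> 0"
      by (rule Lim_null_comparison[rotated]) (use bound in auto)
    then show ?thesis by (simp add: LIM_zero_iff)
  qed
  have lim_x: "(\<lambda>n. f n x) \<longlonglongrightarrow> 1"
    unfolding x_def by (rule lim_pt[OF ed(1) s0 s0_in]) (use Pf in \<open>auto simp: P_def\<close>)
  have lim_y: "(\<lambda>n. f n y) \<longlonglongrightarrow> 0"
    unfolding y_def by (rule lim_pt[OF ed(2) t0 t0_in]) (use Pf in \<open>auto simp: P_def\<close>)
  define V where "V z = lim (\<lambda>n. f n z)" for z
  define Z where "Z = Vertex ` verts G \<union> {x, y}"
  have lim_V: "(\<lambda>n. f n z) \<longlonglongrightarrow> V z" if "z \<in> Z" for z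
  proof -
    have "convergent (\<lambda>n. f n (Vertex v))" if "v \<in> verts G" for v
      using conv[of "Inl v"] that by (simp add: a_def f_def)
    then have "convergent (\<lambda>n. f n z)"
      using that lim_x lim_y by (auto simp: Z_def convergent_def)
    then show ?thesis by (simp add: V_def convergent_LIMSEQ_iff)
  qed
  have V_xy: "V x = 1" "V y = 0" using lim_x lim_y by (auto simp: V_def limI)
  \<comment> \<open>If \<open>x\<close> or \<open>y\<close> lies inside an edge, it has to be a node
    of the interpolation besides the vertices; otherwise the limit function could miss the values 1
    and 0.\<close>
  define B where "B k = {p \<in> {0<..<len k}. edge_map k p \<in> {x, y}}" for k
  have B_fin: "finite (B k)" for k
  proof (rule finite_subset)
    show "B k \<subseteq> {s0, t0}"
      by (auto simp: B_def x_def y_def edge_map_def split: if_splits)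
  qed simp
  have vert: "tail G k \<in> verts G" "head G k \<in> verts G" if "k \<in> arcs G" for k using that by auto
  have B_Z: "edge_map k p \<in> Z" if "k \<in> arcs G" "p \<in> B k \<union> {0, len k}" for k p
    using that vert[OF that(1)] edge_map_len[OF that(1)] by (auto simp: B_def Z_def)
  have "\<forall>k\<in>arcs G. \<exists>w h Q. AC2 0 (len k) w h \<and> (\<forall>p \<in> B k \<union> {0, len k}. w p = V (edge_map k p)) \<and>
    (\<forall>n. Q n \<le> (LINT r:{0<..len k}|lborel. (ed points k (f n) r)\<^sup>2)) \<and> Q \<longlonglongrightarrow> (LINT r:{0<..len k}|lborel. (h r)\<^sup>2)"
  proof
    fix k assume k: "k \<in> arcs G"
    show "\<exists>w h Q. AC2 0 (len k) w h \<and> (\<forall>p \<in> B k \<union> {0, len k}. w p = V (edge_map k p)) \<and>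
      (\<forall>n. Q n \<le> (LINT r:{0<..len k}|lborel. (ed points k (f n) r)\<^sup>2)) \<and> Q \<longlonglongrightarrow> (LINT r:{0<..len k}|lborel. (h r)\<^sup>2)"
    proof (rule linear_interpolation_limit[where u = "\<lambda>n. f n \<circ> edge_map k"])
      show "B k \<subseteq> {0<..<len k}" by (auto simp: B_def)
      show "(\<lambda>n. (f n \<circ> edge_map k) p) \<longlonglongrightarrow> V (edge_map k p)" if "p \<in> B k \<union> {0, len k}" for p
        using lim_V[OF B_Z[OF k that]] by simp
    qed (use B_fin len_pos[OF k] H1_edge_AC2[OF fH k] in auto)
  qed
  then obtain w h Q where w: "\<And>k. k \<in> arcs G \<Longrightarrow> AC2 0 (len k) (w k) (h k)"
    and wV: "\<And>k p. k \<in> arcs G \<Longrightarrow> p \<in> B k \<union> {0, len k} \<Longrightarrow> w k p = V (edge_map k p)"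
    and Q: "\<And>k n. k \<in> arcs G \<Longrightarrow> Q k n \<le> (LINT r:{0<..len k}|lborel. (ed points k (f n) r)\<^sup>2)"
    and Q_lim: "\<And>k. k \<in> arcs G \<Longrightarrow> Q k \<longlonglongrightarrow> (LINT r:{0<..len k}|lborel. (h k r)\<^sup>2)"
    by metis
  obtain u where u: "u \<in> H1 points" "\<And>k p. k \<in> arcs G \<Longrightarrow> p \<in> {0..len k} \<Longrightarrow> u (edge_map k p) = w k p"
    "energy points u u \<le> (\<Sum>k\<in>arcs G. LINT r:{0<..len k}|lborel. (h k r)\<^sup>2)"
  proof (rule glue_edges[of w h "\<lambda>v. V (Vertex v)"])
    show "w k 0 = V (Vertex (tail G k))" if "k \<in> arcs G" for k
      using wV[OF that, of 0] by simp
    show "w k (len k) = V (Vertex (head G k))" if "k \<in> arcs G" for k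
      using wV[OF that, of "len k"] edge_map_len[OF that] by simp
  qed (use w in auto)
  have ux: "u x = 1"
  proof -
    have "s0 \<in> B e \<union> {0, len e}" using s0_in by (auto simp: B_def x_def)
    then show ?thesis using u(2)[OF ed(1) s0_in] wV[OF ed(1), of s0] V_xy by (simp add: x_def)
  qed
  have uy: "u y = 0"
  proof -
    have "t0 \<in> B d \<union> {0, len d}" using t0_in by (auto simp: B_def y_def)
    then show ?thesis using u(2)[OF ed(2) t0_in] wV[OF ed(2), of t0] V_xy by (simp add: y_def)
  qed
  have "(\<Sum>k\<in>arcs G. LINT r:{0<..len k}|lborel. (h k r)\<^sup>2) \<le> osc_min"
  proof (rule LIMSEQ_le)
    show "(\<lambda>n. \<Sum>k\<in>arcs G. Q k n) \<longlonglongrightarrow> (\<Sum>k\<in>arcs G. LINT r:{0<..len k}|lborel. (h k r)\<^sup>2)"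
      by (intro tendsto_sum Q_lim)
    have "(\<lambda>n. osc_min + 1 / real (Suc n)) \<longlonglongrightarrow> osc_min + 0"
      by (intro tendsto_intros) (use LIMSEQ_inverse_real_of_nat in \<open>simp add: inverse_eq_divide\<close>)
    then show "(\<lambda>n. osc_min + 1 / real (Suc n)) \<longlonglongrightarrow> osc_min" by simp
    have "(\<Sum>k\<in>arcs G. Q k n) \<le> osc_min + 1 / real (Suc n)" for n
    proof -
      have "(\<Sum>k\<in>arcs G. Q k n) \<le> (\<Sum>k\<in>arcs G. LINT r|lborel. ed points k (f n) r * ed points k (f n) r)"
      proof (rule sum_mono)
        fix k assume k: "k \<in> arcs G"
        have "Q k n \<le> (LINT r:{0<..len k}|lborel. (ed points k (f n) r)\<^sup>2)" by (rule Q[OF k])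
        also have "\<dots> \<le> (LINT r:UNIV|lborel. (ed points k (f n) r)\<^sup>2)"
          by (intro set_integral_sq_mono L2_ed fH k) auto
        finally show "Q k n \<le> (LINT r|lborel. ed points k (f n) r * ed points k (f n) r)"
          by (simp add: set_lebesgue_integral_def power2_eq_square)
      qed
      then show ?thesis using f_en[of n] by (simp add: energy_ed)
    qed
    then show "\<exists>N. \<forall>n\<ge>N. (\<Sum>k\<in>arcs G. Q k n) \<le> osc_min + 1 / real (Suc n)" by blast
  qed
  then have "energy points u u \<le> osc_min" using u(3) by linarith
  moreover have "osc_min \<le> energy points u u" using osc_min_le[OF u(1) xy] ux uy by simp
  ultimately show thesis using that[OF u(1) xy ux uy] by simp
qed

lemma osc_min_pos: "0 < osc_min"
proof -
  obtain f x y where f: "f \<in> H1 points" "x \<in> points" "y \<in> points" "f x = 1" "f y = 0" "energy points f f = osc_min"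
    by (rule osc_minimizer_exists)
  then have "energy points f f \<noteq> 0" using energy_zero_imp_constant[OF f(1) _ f(2,3)] by auto
  then show ?thesis using energy_nonneg[of points f] f(6) by simp
qed

lemma osc_minimizer_energy:
  assumes f: "f \<in> H1 points" and xy: "x \<in> points" "y \<in> points"
    and eq: "energy points f f = osc_min * (f x - f y)\<^sup>2" and g: "g \<in> H1 points"
  shows "energy points f g = osc_min * (f x - f y) * (g x - g y)"
proof -
  define D where "D = energy points f g - osc_min * (f x - f y) * (g x - g y)"
  define E where "E = energy points g g - osc_min * (g x - g y)\<^sup>2"
  have pos: "0 \<le> 2 * t * D + t\<^sup>2 * E" for t
  proof -
    have "osc_min * ((1 * f x + t * g x) - (1 * f y + t * g y))\<^sup>2
        \<le> 1\<^sup>2 * energy points f f + 2 * 1 * t * energy points f g + t\<^sup>2 * energy points g g"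
      using osc_min_le[OF H1_linear(1)[OF f g] xy, of 1 t] unfolding energy_linear_square[OF f g] .
    then show ?thesis unfolding eq D_def E_def by (simp add: power2_eq_square algebra_simps)
  qed
  have "D = 0"
  proof (rule ccontr)
    assume D: "D \<noteq> 0"
    have E: "0 \<le> E" unfolding E_def using osc_min_le[OF g xy] by simp
    \<comment> \<open>The quadratic polynomial takes the value
      \<open>- D\<^sup>2 * (E + 2) / (E + 1)\<^sup>2\<close> here. Dividing by \<open>E + 1\<close>
      instead of \<open>E\<close> covers the case \<open>E = 0\<close>.\<close>
    define t where "t = - D / (E + 1)"
    have t: "t * (E + 1) = - D" using E by (simp add: t_def)
    have "0 \<le> (2 * t * D + t\<^sup>2 * E) * (E + 1)\<^sup>2"
      using pos[of t] by simp
    also have "\<dots> = 2 * (t * (E + 1)) * D * (E + 1) + (t * (E + 1))\<^sup>2 * E"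
      by (simp add: power2_eq_square algebra_simps)
    also have "\<dots> = - (D\<^sup>2 * (E + 2))"
      unfolding t by (simp add: power2_eq_square algebra_simps)
    finally have "D\<^sup>2 * (E + 2) \<le> 0" by simp
    moreover have "0 < D\<^sup>2 * (E + 2)" using D E by simp
    ultimately show False by simp
  qed
  then show ?thesis by (simp add: D_def)
qed

end


section \<open>The first nonzero eigenvalue\<close>

interpretation fun_vs: vector_space "\<lambda>(c::real) (f::'a \<Rightarrow> real) x. c * f x"
  by (rule vector_space_real_fun)

lemma multiples_subset_span:
  assumes "\<And>h. h \<in> E \<Longrightarrow> \<exists>c. h = (\<lambda>x. c * f x)"
  shows "E \<subseteq> fun_vs.span {f}"
proof
  fix h assume "h \<in> E"
  then obtain c where "h = (\<lambda>x. c * f x)" using assms by blast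
  then show "h \<in> fun_vs.span {f}" using fun_vs.span_scale[OF fun_vs.span_base, of f "{f}" c] by simp
qed

lemma fun_dim_le_1:
  assumes "\<And>h. h \<in> E \<Longrightarrow> \<exists>c. h = (\<lambda>x. c * f x)"
  shows "fun_dim E \<le> 1"
  using fun_vs.dim_le_card[OF multiples_subset_span[OF assms]] by (simp add: fun_dim_def)

lemma fun_dim_eq_1:
  assumes "\<And>h. h \<in> E \<Longrightarrow> \<exists>c. h = (\<lambda>x. c * f x)" "f \<in> E" "f x \<noteq> 0"
  shows "fun_dim E = 1"
proof -
  have "f \<noteq> 0" using assms(3) by (auto simp: zero_fun_def)
  then have "fun_vs.independent {f}" by simp
  then have "fun_vs.dim E = 1"
    using assms(2) multiples_subset_span[OF assms(1)] by (intro fun_vs.dim_unique[of "{f}"]) auto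
  then show ?thesis by (simp add: fun_dim_def)
qed

section \<open>Borel probability measures and two point masses\<close>

context metric_graph
begin

definition borel_of :: "('v, 'e) gpoint set \<Rightarrow> ('v, 'e) gpoint measure" where
  "borel_of K = sigma K {U. openin (subtopology gtop K) U}"

lemma openin_subtopology_Pow: "{U. openin (subtopology gtop K) U} \<subseteq> Pow K"
  using openin_subset by fastforce

lemma space_borel_of [simp]: "space (borel_of K) = K"
  unfolding borel_of_def by (rule space_measure_of[OF openin_subtopology_Pow])

lemma sets_borel_of: "sets (borel_of K) = sigma_sets K {U. openin (subtopology gtop K) U}"
  unfolding borel_of_def by (rule sets_measure_of[OF openin_subtopology_Pow])

lemma borel_probs_iff: "\<mu> \<in> borel_probs K \<longleftrightarrow> prob_space \<mu> \<and> sets \<mu> = sets (borel_of K)"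
  by (simp add: borel_probs_def sets_borel_of)

lemma borel_probs_space: "\<mu> \<in> borel_probs K \<Longrightarrow> space \<mu> = K"
  using sets_eq_imp_space_eq[of \<mu> "borel_of K"] by (simp add: borel_probs_iff)

lemma openin_sets_borel_of: "openin (subtopology gtop K) U \<Longrightarrow> U \<in> sets (borel_of K)"
  by (auto simp: sets_borel_of)

lemma continuous_borel_of:
  assumes "continuous_map (subtopology gtop K) euclideanreal f" "K \<subseteq> points"
  shows "f \<in> borel_measurable (borel_of K)"
proof (rule borel_measurableI)
  fix S :: "real set" assume "open S"
  then have "openin (subtopology gtop K) {x \<in> topspace (subtopology gtop K). f x \<in> S}"
    using assms(1) by (simp add: continuous_map_def)
  also have "{x \<in> topspace (subtopology gtop K). f x \<in> S} = f -` S \<inter> space (borel_of K)"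
    using assms(2) by auto
  finally show "f -` S \<inter> space (borel_of K) \<in> sets (borel_of K)"
    by (rule openin_sets_borel_of)
qed

lemma borel_probs_measurable:
  assumes "\<mu> \<in> borel_probs K" "f \<in> borel_measurable (borel_of K)"
  shows "f \<in> borel_measurable \<mu>"
  using assms measurable_cong_sets[of \<mu> "borel_of K" borel borel] by (auto simp: borel_probs_iff)

lemma borel_probs_integrable:
  fixes f :: "('v, 'e) gfun"
  assumes \<mu>: "\<mu> \<in> borel_probs K" and f: "f \<in> borel_measurable (borel_of K)" and B: "\<And>x. x \<in> K \<Longrightarrow> \<bar>f x\<bar> \<le> B"
  shows "integrable \<mu> f"
proof -
  interpret prob_space \<mu> using \<mu> by (simp add: borel_probs_iff)
  show ?thesis
    using borel_probs_space[OF \<mu>] B borel_probs_measurable[OF \<mu> f]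
    by (intro integrable_const_bound[of _ B]) auto
qed

text \<open>The set where \<open>f\<close> is nonzero is open and null, hence disjoint from the
  support. This settles Rayleigh quotients with denominator 0, to which division assigns the value
  0.\<close>

lemma msupp_zero:
  assumes \<mu>: "\<mu> \<in> borel_probs K" and K: "K \<subseteq> points"
    and f: "continuous_map (subtopology gtop K) euclideanreal f"
    and int: "integrable \<mu> (\<lambda>x. (f x)\<^sup>2)" and z: "(LINT x|\<mu>. (f x)\<^sup>2) = 0" and x: "x \<in> msupp K \<mu>"
  shows "f x = 0"
proof (rule ccontr)
  assume "f x \<noteq> 0"
  define U where "U = {x \<in> topspace (subtopology gtop K). f x \<in> - {0}}"
  have U: "openin (subtopology gtop K) U"
    unfolding U_def by (rule openin_continuous_map_preimage[OF f]) auto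
  have "x \<in> U" using x K \<open>f x \<noteq> 0\<close> by (auto simp: U_def msupp_def)
  then have pos: "0 < emeasure \<mu> U" using x U by (auto simp: msupp_def)
  have "AE x in \<mu>. (f x)\<^sup>2 = 0"
    using integral_nonneg_eq_0_iff_AE[OF int] z by auto
  then have "AE x in \<mu>. x \<notin> U" by eventually_elim (auto simp: U_def)
  moreover have "U \<in> sets \<mu>" using openin_sets_borel_of[OF U] \<mu> by (simp add: borel_probs_iff)
  moreover have "{x \<in> space \<mu>. \<not> x \<notin> U} = U"
    using openin_subset[OF U] borel_probs_space[OF \<mu>] by auto
  ultimately have "emeasure \<mu> U = 0" using AE_iff_measurable[of U \<mu> "\<lambda>x. x \<notin> U"] by simp
  then show False using pos by simp
qed

text \<open>As the image of a fair coin it includes the case \<open>x = y\<close>, the unit mass at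
  \<open>x\<close>, which is the measure used on a nodal domain.\<close>

definition two_point :: "('v, 'e) gpoint set \<Rightarrow> ('v, 'e) gpoint \<Rightarrow> ('v, 'e) gpoint \<Rightarrow> ('v, 'e) gpoint measure" where
  "two_point K x y = distr (measure_pmf (bernoulli_pmf (1 / 2))) (borel_of K) (\<lambda>b. if b then x else y)"

lemma two_point_borel_probs:
  assumes "x \<in> K" "y \<in> K"
  shows "two_point K x y \<in> borel_probs K"
  unfolding borel_probs_iff two_point_def
  using assms by (auto intro!: prob_space.prob_space_distr prob_space_measure_pmf)

lemma integral_two_point:
  fixes f :: "('v, 'e) gfun"
  assumes "x \<in> K" "y \<in> K" "f \<in> borel_measurable (borel_of K)"
  shows "(LINT z|two_point K x y. f z) = (f x + f y) / 2"
  unfolding two_point_def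
  using assms by (subst integral_distr) (auto simp: field_simps)

lemma emeasure_two_point:
  assumes "x \<in> K" "y \<in> K" "A \<in> sets (borel_of K)"
  shows "emeasure (two_point K x y) A = emeasure (measure_pmf (bernoulli_pmf (1 / 2))) {b. (if b then x else y) \<in> A}"
  unfolding two_point_def using assms by (subst emeasure_distr) (auto simp: vimage_def)

lemma msupp_two_point:
  assumes xy: "x \<in> K" "y \<in> K"
  shows "x \<in> msupp K (two_point K x y)" "y \<in> msupp K (two_point K x y)"
proof -
  have "0 < emeasure (two_point K x y) U" if U: "openin (subtopology gtop K) U" and xU: "x \<in> U \<or> y \<in> U" for U
  proof -
    obtain b where b: "(if b then x else y) \<in> U"
    proof (cases "x \<in> U")
      case True
      then show thesis using that[of True] by simp
    next
      case False
      then show thesis using that[of False] xU by simp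
    qed
    have "0 < pmf (bernoulli_pmf (1 / 2)) b" by (cases b) simp_all
    then have "0 < emeasure (measure_pmf (bernoulli_pmf (1 / 2))) {b}"
      by (simp only: emeasure_pmf_single ennreal_less_zero_iff)
    also have "\<dots> \<le> emeasure (measure_pmf (bernoulli_pmf (1 / 2))) {b. (if b then x else y) \<in> U}"
      using b by (intro emeasure_mono) auto
    finally show ?thesis using emeasure_two_point[OF xy openin_sets_borel_of[OF U]] by simp
  qed
  then show "x \<in> msupp K (two_point K x y)" "y \<in> msupp K (two_point K x y)"
    using xy by (auto simp: msupp_def)
qed

lemma H1_borel_of: "f \<in> H1 points \<Longrightarrow> f \<in> borel_measurable (borel_of points)"
  using continuous_borel_of[of points f] H1_continuous by simp

lemma H1_bounded:
  assumes f: "f \<in> H1 points"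
  shows "\<exists>B. \<forall>x\<in>points. \<bar>f x\<bar> \<le> B"
proof -
  have "continuous_map gtop euclideanreal (\<lambda>x. \<bar>f x\<bar>)"
    using H1_continuous[OF f] by (intro continuous_intros)
  from attains_sup_points[OF this] show ?thesis by blast
qed

lemma H1_mult_integrable:
  assumes \<mu>: "\<mu> \<in> borel_probs points" and f: "f \<in> H1 points" and g: "g \<in> H1 points"
  shows "integrable \<mu> (\<lambda>x. f x * g x)"
proof -
  obtain B where B: "\<And>x. x \<in> points \<Longrightarrow> \<bar>f x\<bar> \<le> B" using H1_bounded[OF f] by blast
  obtain C where C: "\<And>x. x \<in> points \<Longrightarrow> \<bar>g x\<bar> \<le> C" using H1_bounded[OF g] by blast
  show ?thesis
  proof (rule borel_probs_integrable[OF \<mu>])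
    show "(\<lambda>x. f x * g x) \<in> borel_measurable (borel_of points)"
      using H1_borel_of[OF f] H1_borel_of[OF g] by simp
    show "\<bar>f x * g x\<bar> \<le> B * C" if "x \<in> points" for x
      unfolding abs_mult using B[OF that] C[OF that] by (intro mult_mono) auto
  qed
qed

definition one :: "('v, 'e) gfun" where
  "one x = (if x \<in> points then 1 else 0)"

lemma one_H1: "one \<in> H1 points"
  unfolding one_def[abs_def] by (rule const_H1)

lemma energy_one: "h \<in> H1 points \<Longrightarrow> energy points one h = 0"
  unfolding one_def[abs_def] by (rule energy_const)

lemma H1_integrable: "\<mu> \<in> borel_probs points \<Longrightarrow> f \<in> H1 points \<Longrightarrow> integrable \<mu> f"
proof -
  assume \<mu>: "\<mu> \<in> borel_probs points" and f: "f \<in> H1 points"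
  have "integrable \<mu> (\<lambda>x. f x * one x) \<longleftrightarrow> integrable \<mu> f"
    by (rule Bochner_Integration.integrable_cong) (auto simp: borel_probs_space[OF \<mu>] one_def)
  then show "integrable \<mu> f" using H1_mult_integrable[OF \<mu> f one_H1] by simp
qed

section \<open>Eigenfunctions of the Laplacian of a measure\<close>

lemma H1_mu_iff:
  "f \<in> H1_mu \<mu> \<longleftrightarrow> f \<in> H1 points \<and> (\<forall>g\<in>H1 points. (\<forall>x\<in>msupp points \<mu>. g x = 0) \<longrightarrow> energy points f g = 0)"
proof -
  have "points - (points - msupp points \<mu>) = msupp points \<mu>" by (auto simp: msupp_def)
  then show ?thesis by (auto simp: H1_mu_def harmonic_on_def)
qed

lemma one_H1_mu: "one \<in> H1_mu \<mu>"
  by (simp add: H1_mu_iff one_H1 energy_one)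

lemma H1_mu_linear:
  assumes "f \<in> H1_mu \<mu>" "g \<in> H1_mu \<mu>"
  shows "(\<lambda>x. a * f x + b * g x) \<in> H1_mu \<mu>"
  using assms by (auto simp: H1_mu_iff H1_linear(1) energy_linear_left)

lemma eigenspace_energy:
  assumes "f \<in> eigenspace \<mu> \<kappa>" "\<phi> \<in> H1_mu \<mu>"
  shows "energy points f \<phi> = \<kappa> * (LINT x|\<mu>. f x * \<phi> x)"
proof -
  have "energy points f \<phi> = (LINT x|\<mu>. \<kappa> * f x * \<phi> x)"
    using assms by (simp add: eigenspace_def laplacian_def)
  also have "\<dots> = (LINT x|\<mu>. \<kappa> * (f x * \<phi> x))" by (simp add: mult.assoc)
  finally show ?thesis by simp
qed

lemma eigenspace_H1: "f \<in> eigenspace \<mu> \<kappa> \<Longrightarrow> f \<in> H1_mu \<mu>" "f \<in> eigenspace \<mu> \<kappa> \<Longrightarrow> f \<in> H1 points"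
  by (auto simp: eigenspace_def laplacian_def H1_mu_def)

lemma eigenspaceI:
  assumes \<mu>: "\<mu> \<in> borel_probs points" and f: "f \<in> H1_mu \<mu>"
    and "\<And>\<phi>. \<phi> \<in> H1_mu \<mu> \<Longrightarrow> energy points f \<phi> = \<kappa> * (LINT x|\<mu>. f x * \<phi> x)"
  shows "f \<in> eigenspace \<mu> \<kappa>"
proof -
  have fH: "f \<in> H1 points" using f by (simp add: H1_mu_iff)
  have "f \<in> borel_measurable \<mu>" using borel_probs_measurable[OF \<mu> H1_borel_of[OF fH]] .
  moreover have "integrable \<mu> (\<lambda>x. \<kappa>\<^sup>2 * (f x * f x))"
    using H1_mult_integrable[OF \<mu> fH fH] by simp
  moreover have "(\<kappa> * f x)\<^sup>2 = \<kappa>\<^sup>2 * (f x * f x)" for x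
    by (simp add: power2_eq_square)
  moreover have "(LINT x|\<mu>. \<kappa> * f x * \<phi> x) = \<kappa> * (LINT x|\<mu>. f x * \<phi> x)" for \<phi>
    by (simp add: mult.assoc)
  ultimately show ?thesis
    using f assms(3) by (simp add: eigenspace_def laplacian_def)
qed

text \<open>Since \<open>\<integral>f d\<mu> = 0\<close>, integrating \<open>(max f - f)(f - min f) \<ge> 0\<close> bounds \<open>\<integral>f\<^sup>2 d\<mu>\<close>.\<close>

lemma eigenfunction_estimate:
  assumes \<mu>: "\<mu> \<in> borel_probs points" and f: "eigenfunction \<mu> \<kappa> f" and \<kappa>: "\<kappa> \<noteq> 0"
  obtains x y where "x \<in> points" "y \<in> points" "energy points f f = \<kappa> * (LINT z|\<mu>. f z * f z)"
    "0 < (LINT z|\<mu>. f z * f z)" "(LINT z|\<mu>. f z * f z) \<le> - f x * f y"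
proof -
  interpret prob_space \<mu> using \<mu> by (simp add: borel_probs_iff)
  have fE: "f \<in> eigenspace \<mu> \<kappa>" and f0: "f \<noteq> (\<lambda>x. 0)" using f by (auto simp: eigenfunction_def)
  note fH = eigenspace_H1(2)[OF fE]
  have int: "integrable \<mu> f" "integrable \<mu> (\<lambda>z. f z * f z)"
    using H1_integrable[OF \<mu> fH] H1_mult_integrable[OF \<mu> fH fH] by auto
  have en: "energy points f f = \<kappa> * (LINT z|\<mu>. f z * f z)"
    by (rule eigenspace_energy[OF fE eigenspace_H1(1)[OF fE]])
  have "\<kappa> * (LINT z|\<mu>. f z * one z) = 0"
    using eigenspace_energy[OF fE one_H1_mu] energy_one[OF fH] energy_commute by metis
  then have "(LINT z|\<mu>. f z * one z) = 0" using \<kappa> by simp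
  moreover have "(LINT z|\<mu>. f z * one z) = (LINT z|\<mu>. f z)"
    by (rule Bochner_Integration.integral_cong) (auto simp: borel_probs_space[OF \<mu>] one_def)
  ultimately have mean: "(LINT z|\<mu>. f z) = 0" by simp
  \<comment> \<open>Being zero almost everywhere is weaker than being zero. It does force the energy
    to be 0, so that \<open>f\<close> is constant, and mean zero then leaves only the zero
    function.\<close>
  have pos: "0 < (LINT z|\<mu>. f z * f z)"
  proof (rule ccontr)
    assume "\<not> ?thesis"
    moreover have "0 \<le> (LINT z|\<mu>. f z * f z)" by (intro integral_nonneg_AE) auto
    ultimately have "energy points f f = 0" using en by simp
    then have const: "f z = f w" if "z \<in> points" "w \<in> points" for z w
      using energy_zero_imp_constant[OF fH] that by blast
    obtain w where w: "w \<in> points" using points_nonempty by blast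
    have "(LINT z|\<mu>. f z) = (LINT z|\<mu>. f w)"
      by (rule Bochner_Integration.integral_cong) (auto simp: borel_probs_space[OF \<mu>] intro: const[OF _ w])
    then have "f w = 0" using mean by (simp add: prob_space)
    then have "f z = 0" for z using const[OF _ w, of z] H1_off[OF fH, of z] by auto
    then show False using f0 by blast
  qed
  obtain x where x: "x \<in> points" "\<And>z. z \<in> points \<Longrightarrow> f z \<le> f x"
    using attains_sup_points[OF H1_continuous[OF fH]] by blast
  obtain y where y: "y \<in> points" "\<And>z. z \<in> points \<Longrightarrow> f y \<le> f z"
    using attains_inf_points[OF H1_continuous[OF fH]] by blast
  have "(LINT z|\<mu>. f z * f z) \<le> (LINT z|\<mu>. (f x + f y) * f z - f x * f y)"
  proof (rule integral_mono)
    show "integrable \<mu> (\<lambda>z. (f x + f y) * f z - f x * f y)" using int by simp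
    fix z assume "z \<in> space \<mu>"
    then have "z \<in> points" using borel_probs_space[OF \<mu>] by simp
    then have "0 \<le> (f x - f z) * (f z - f y)" using x y by simp
    then show "f z * f z \<le> (f x + f y) * f z - f x * f y" by (simp add: algebra_simps)
  qed (rule int)
  also have "\<dots> = - f x * f y"
    using int mean by (simp add: prob_space)
  finally show thesis using that[OF x(1) y(1) en pos] by blast
qed

lemma eigenvalue_ge:
  assumes \<mu>: "\<mu> \<in> borel_probs points" and f: "eigenfunction \<mu> \<kappa> f" and \<kappa>: "\<kappa> \<noteq> 0"
  shows "4 * osc_min \<le> \<kappa>"
proof -
  obtain x y where xy: "x \<in> points" "y \<in> points" and en: "energy points f f = \<kappa> * (LINT z|\<mu>. f z * f z)"
    and pos: "0 < (LINT z|\<mu>. f z * f z)" and le: "(LINT z|\<mu>. f z * f z) \<le> - f x * f y"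
    using eigenfunction_estimate[OF assms] .
  have fH: "f \<in> H1 points" using f eigenspace_H1(2) by (auto simp: eigenfunction_def)
  have "4 * (- f x * f y) \<le> (f x - f y)\<^sup>2"
    using zero_le_power2[of "f x + f y"] by (simp add: power2_eq_square algebra_simps)
  then have "4 * (LINT z|\<mu>. f z * f z) \<le> (f x - f y)\<^sup>2" using le by linarith
  then have "osc_min * (4 * (LINT z|\<mu>. f z * f z)) \<le> osc_min * (f x - f y)\<^sup>2"
    using osc_min_pos by (intro mult_left_mono) auto
  also have "\<dots> \<le> \<kappa> * (LINT z|\<mu>. f z * f z)" using osc_min_le[OF fH xy] en by simp
  finally show ?thesis using pos by simp
qed

text \<open>For this eigenvalue the chain \<open>I \<le> - f x * f y \<le> (f x - f y)\<^sup>2 / 4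
  \<le> energy points f f / (4 * osc_min) = I\<close> consists of equalities. The middle one is
  \<open>f x + f y = 0\<close>, the last one minimality.\<close>

lemma minimal_eigenfunction:
  assumes \<mu>: "\<mu> \<in> borel_probs points" and f: "eigenfunction \<mu> (4 * osc_min) f"
  obtains x y where "x \<in> points" "y \<in> points" "f \<in> H1 points" "0 < f x" "f y = - f x"
    "energy points f f = osc_min * (f x - f y)\<^sup>2"
proof -
  define I where "I = (LINT z|\<mu>. f z * f z)"
  have \<kappa>: "4 * osc_min \<noteq> 0" using osc_min_pos by simp
  obtain x y where xy: "x \<in> points" "y \<in> points" and en: "energy points f f = 4 * osc_min * I"
    and pos: "0 < I" and le: "I \<le> - f x * f y"
    using eigenfunction_estimate[OF assms \<kappa>] unfolding I_def .
  have fH: "f \<in> H1 points" using f eigenspace_H1(2) by (auto simp: eigenfunction_def)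
  have "osc_min * (f x - f y)\<^sup>2 \<le> osc_min * (4 * I)" using osc_min_le[OF fH xy] en by simp
  then have up: "(f x - f y)\<^sup>2 \<le> 4 * I" using osc_min_pos by simp
  have "(f x + f y)\<^sup>2 = (f x - f y)\<^sup>2 + 4 * (f x * f y)" by (simp add: power2_eq_square algebra_simps)
  then have "(f x + f y)\<^sup>2 \<le> 0" using up le by simp
  then have sum: "f y = - f x" by simp
  then have I: "I = (f x)\<^sup>2" using up le by (simp add: power2_eq_square)
  have en': "energy points f f = osc_min * (f x - f y)\<^sup>2"
    unfolding en I sum by (simp add: power2_eq_square)
  have "f x \<noteq> 0" using pos I by auto
  \<comment> \<open>The estimate does not tell which of the two points is the maximum, so they are
    exchanged when \<open>f x\<close> is negative.\<close>
  show thesis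
  proof (cases "0 < f x")
    case True
    then show thesis using that[OF xy fH _ sum en'] by blast
  next
    case False
    then have "0 < f y" "f x = - f y" using sum \<open>f x \<noteq> 0\<close> by auto
    then show thesis using that[OF xy(2,1) fH] en' by (simp add: power2_commute)
  qed
qed

lemma eigenspace_0_constant:
  assumes h: "h \<in> eigenspace \<mu> 0"
  shows "\<exists>c. h = (\<lambda>x. c * one x)"
proof -
  note hH = eigenspace_H1(2)[OF h]
  have "energy points h h = 0" using eigenspace_energy[OF h eigenspace_H1(1)[OF h]] by simp
  then have const: "h z = h w" if "z \<in> points" "w \<in> points" for z w
    using energy_zero_imp_constant[OF hH] that by blast
  obtain w where w: "w \<in> points" using points_nonempty by blast
  have "h x = h w * one x" for x
    using const[OF _ w, of x] H1_off[OF hH, of x] by (auto simp: one_def)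
  then show ?thesis by blast
qed

text \<open>Eigenfunctions for 0 are constant, so 0 has multiplicity at most 1. A total multiplicity
  above 1 therefore involves a nonzero eigenvalue, for which \<open>eigenvalue_ge\<close>
  applies.\<close>

lemma eigval_1_ge:
  assumes \<mu>: "\<mu> \<in> borel_probs points"
  shows "ereal (4 * osc_min) \<le> eigval \<mu> 1"
  unfolding eigval_def
proof (rule INF_greatest)
  fix \<kappa> assume "\<kappa> \<in> {\<kappa>. 1 < (\<Sum>\<eta> \<in> {\<eta> \<in> eigenvalues \<mu>. \<eta> \<le> \<kappa>}. fun_dim (eigenspace \<mu> \<eta>))}"
  then have gt: "1 < (\<Sum>\<eta> \<in> {\<eta> \<in> eigenvalues \<mu>. \<eta> \<le> \<kappa>}. fun_dim (eigenspace \<mu> \<eta>))" by simp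
  have "\<exists>\<eta>\<in>eigenvalues \<mu>. \<eta> \<le> \<kappa> \<and> \<eta> \<noteq> 0"
  proof (rule ccontr)
    assume "\<not> ?thesis"
    then have "{\<eta> \<in> eigenvalues \<mu>. \<eta> \<le> \<kappa>} \<subseteq> {0}" by auto
    then have "(\<Sum>\<eta> \<in> {\<eta> \<in> eigenvalues \<mu>. \<eta> \<le> \<kappa>}. fun_dim (eigenspace \<mu> \<eta>)) \<le> (\<Sum>\<eta>\<in>{0}. fun_dim (eigenspace \<mu> \<eta>))"
      by (intro sum_mono2) auto
    also have "\<dots> \<le> 1" using fun_dim_le_1[of "eigenspace \<mu> 0", OF eigenspace_0_constant] by simp
    finally show False using gt by simp
  qed
  then obtain \<eta> f where "\<eta> \<le> \<kappa>" "\<eta> \<noteq> 0" "eigenfunction \<mu> \<eta> f" by (auto simp: eigenvalues_def)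
  then show "ereal (4 * osc_min) \<le> ereal \<kappa>" using eigenvalue_ge[OF \<mu>] by force
qed

text \<open>The minimizer is moved to \<open>2 * u - 1\<close>, so that it has opposite values at
  \<open>x\<close> and \<open>y\<close>, hence mean zero for equal masses at these points and two
  nodal domains of equal weight.\<close>

lemma centered_osc_minimizer:
  obtains f x y where "f \<in> H1 points" "x \<in> points" "y \<in> points" "f x = 1" "f y = - 1"
    "\<forall>g\<in>H1 points. energy points f g = 2 * osc_min * (g x - g y)"
proof -
  obtain u x y where u: "u \<in> H1 points" "x \<in> points" "y \<in> points" "u x = 1" "u y = 0"
    "energy points u u = osc_min"
    by (rule osc_minimizer_exists)
  define f where "f = (\<lambda>z. 2 * u z + (- 1) * one z)"
  have f: "f \<in> H1 points" unfolding f_def by (rule H1_linear(1)[OF u(1) one_H1])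
  have "energy points f g = 2 * osc_min * (g x - g y)" if g: "g \<in> H1 points" for g
    using osc_minimizer_energy[OF u(1-3) _ g] u energy_one[OF g]
    unfolding f_def energy_linear_left[OF u(1) one_H1 g] by simp
  moreover have "f x = 1" "f y = - 1" using u by (auto simp: f_def one_def)
  ultimately show thesis using that[OF f u(2,3)] by blast
qed

text \<open>An infinite sum and an infinite \<open>fun_dim\<close> both evaluate to 0, so exhibiting
  two eigenfunctions is not enough for \<open>eigval\<close>. The spectrum up to
  \<open>4 * osc_min\<close> is determined exactly: the eigenvalues 0 and
  \<open>4 * osc_min\<close>, both simple.\<close>

lemma eigval_1_attained: "\<exists>\<mu>\<in>borel_probs points. eigval \<mu> 1 \<le> ereal (4 * osc_min)"
proof -
  obtain f x y where f: "f \<in> H1 points" and xy: "x \<in> points" "y \<in> points" and fxy: "f x = 1" "f y = - 1"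
    and "\<forall>g\<in>H1 points. energy points f g = 2 * osc_min * (g x - g y)"
    using centered_osc_minimizer .
  then have fe: "\<And>g. g \<in> H1 points \<Longrightarrow> energy points f g = 2 * osc_min * (g x - g y)" by blast
  define \<mu> where "\<mu> = two_point points x y"
  have \<mu>: "\<mu> \<in> borel_probs points" unfolding \<mu>_def by (rule two_point_borel_probs[OF xy])
  have supp: "x \<in> msupp points \<mu>" "y \<in> msupp points \<mu>"
    unfolding \<mu>_def by (rule msupp_two_point[OF xy])+
  have int: "(LINT z|\<mu>. g z * h z) = (g x * h x + g y * h y) / 2" if "g \<in> H1 points" "h \<in> H1 points" for g h
    unfolding \<mu>_def by (rule integral_two_point[OF xy]) (use that H1_borel_of in auto)
  let ?\<kappa> = "4 * osc_min"
  have \<kappa>: "?\<kappa> > 0" using osc_min_pos by simp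
  \<comment> \<open>The identity for the minimizer pairs \<open>f\<close> only with the values of
    \<open>g\<close> at \<open>x\<close> and \<open>y\<close>, both in the support, so it contains
    harmonicity elsewhere.\<close>
  have f_mu: "f \<in> H1_mu \<mu>" using f fe supp by (auto simp: H1_mu_iff)
  have fE: "f \<in> eigenspace \<mu> ?\<kappa>"
  proof (rule eigenspaceI[OF \<mu> f_mu])
    fix \<phi> assume "\<phi> \<in> H1_mu \<mu>"
    then have \<phi>: "\<phi> \<in> H1 points" by (simp add: H1_mu_iff)
    show "energy points f \<phi> = ?\<kappa> * (LINT z|\<mu>. f z * \<phi> z)"
      unfolding fe[OF \<phi>] int[OF f \<phi>] fxy by simp
  qed
  have oneE: "one \<in> eigenspace \<mu> 0"
    by (rule eigenspaceI[OF \<mu> one_H1_mu]) (use energy_one in \<open>auto simp: H1_mu_iff\<close>)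
  have multiple: "\<exists>c. h = (\<lambda>z. c * f z)" if h: "h \<in> eigenspace \<mu> ?\<kappa>" for h
  proof -
    note hH = eigenspace_H1(2)[OF h]
    have "?\<kappa> * (LINT z|\<mu>. h z * one z) = 0"
      using eigenspace_energy[OF h one_H1_mu] energy_one[OF hH] energy_commute by metis
    then have sum: "h x + h y = 0" using \<kappa> int[OF hH one_H1] xy by (simp add: one_def)
    \<comment> \<open>The difference of \<open>h\<close> and \<open>h x * f\<close> vanishes at both
      point masses. Pairing it with \<open>h\<close> and with \<open>f\<close> gives 0, so its
      energy is 0 and it is the zero function.\<close>
    define g where "g = (\<lambda>z. 1 * h z + (- h x) * f z)"
    have g_mu: "g \<in> H1_mu \<mu>" unfolding g_def by (rule H1_mu_linear[OF eigenspace_H1(1)[OF h] f_mu])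
    then have gH: "g \<in> H1 points" by (simp add: H1_mu_iff)
    have gxy: "g x = 0" "g y = 0" using fxy sum by (auto simp: g_def)
    have "energy points h g = 0"
      using eigenspace_energy[OF h g_mu] int[OF hH gH] gxy by simp
    moreover have "energy points f g = 0" using fe[OF gH] gxy by simp
    moreover have "energy points g g = 1 * energy points h g + (- h x) * energy points f g"
      using energy_linear_left[OF hH f gH, of 1 "- h x"] by (simp add: g_def)
    ultimately have "energy points g g = 0" by simp
    then have g0: "g z = 0" for z
      using energy_zero_imp_constant[OF gH _ _ xy(1), of z] gxy H1_off[OF gH, of z] by auto
    have "h z = h x * f z" for z
      using g0[of z] unfolding g_def by linarith
    then have "h = (\<lambda>z. h x * f z)" by (rule ext)
    then show ?thesis by blast
  qed
  have ev: "{\<eta> \<in> eigenvalues \<mu>. \<eta> \<le> ?\<kappa>} = {0, ?\<kappa>}"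
  proof (intro equalityI subsetI)
    fix \<eta> assume "\<eta> \<in> {\<eta> \<in> eigenvalues \<mu>. \<eta> \<le> ?\<kappa>}"
    then show "\<eta> \<in> {0, ?\<kappa>}" using eigenvalue_ge[OF \<mu>] by (force simp: eigenvalues_def)
  next
    fix \<eta> assume \<eta>: "\<eta> \<in> {0, ?\<kappa>}"
    have "one x \<noteq> 0" "f x \<noteq> 0" using xy fxy by (simp_all add: one_def)
    then have "one \<noteq> (\<lambda>x. 0)" "f \<noteq> (\<lambda>x. 0)" by metis+
    then show "\<eta> \<in> {\<eta> \<in> eigenvalues \<mu>. \<eta> \<le> ?\<kappa>}"
      using \<eta> \<kappa> fE oneE by (auto simp: eigenvalues_def eigenfunction_def)
  qed
  have "fun_dim (eigenspace \<mu> 0) = 1"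
    by (rule fun_dim_eq_1[OF eigenspace_0_constant oneE, where x = x]) (use xy in \<open>auto simp: one_def\<close>)
  moreover have "fun_dim (eigenspace \<mu> ?\<kappa>) = 1"
    by (rule fun_dim_eq_1[OF multiple fE, where x = x]) (use fxy in auto)
  ultimately have "1 < (\<Sum>\<eta> \<in> {\<eta> \<in> eigenvalues \<mu>. \<eta> \<le> ?\<kappa>}. fun_dim (eigenspace \<mu> \<eta>))"
    unfolding ev using \<kappa> by simp
  then have "eigval \<mu> 1 \<le> ereal ?\<kappa>"
    unfolding eigval_def by (intro INF_lower) simp
  then show ?thesis using \<mu> by blast
qed

lemma eigval_min_1: "eigval_min 1 = ereal (4 * osc_min)"
proof (rule antisym)
  show "eigval_min 1 \<le> ereal (4 * osc_min)"
    using eigval_1_attained unfolding eigval_min_def by (meson INF_lower2)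
  show "ereal (4 * osc_min) \<le> eigval_min 1"
    unfolding eigval_min_def by (rule INF_greatest) (rule eigval_1_ge)
qed

end


section \<open>Two-partitions\<close>

context metric_graph
begin

lemma H1_dir_nonzero_interior:
  assumes "closedin gtop K" "f \<in> H1_dir K (gtop frontier_of K)" "f x \<noteq> 0"
  shows "x \<in> gtop interior_of K"
  using assms H1_off[of f K x] by (auto simp: H1_dir_def frontier_of_def closure_of_closedin)

text \<open>For a probability measure the integral of the square of \<open>f\<close> is at most its
  maximum, so dividing \<open>f\<close> by its value of largest modulus makes the energy no larger
  than the Rayleigh quotient. The measure disappears, and the place of the maximum is interior
  because \<open>f\<close> is nonzero there.\<close>

lemma cell_test_function:
  assumes K: "closedin gtop K" and lt: "dir_eigval0_min K (gtop frontier_of K) < ereal c" and c: "0 < c"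
  obtains g z where "g \<in> H1_dir K (gtop frontier_of K)" "g z = 1" "z \<in> gtop interior_of K" "energy K g g < c"
proof -
  let ?A = "gtop frontier_of K"
  have Ksub: "K \<subseteq> points" using K closedin_subset by fastforce
  obtain \<mu> where \<mu>: "\<mu> \<in> borel_probs K" and lt\<mu>: "dir_eigval0 K ?A \<mu> < ereal c"
    using lt unfolding dir_eigval0_min_def by (auto simp: INF_less_iff)
  obtain f where f: "f \<in> H1_dir_mu K ?A \<mu>" "f \<noteq> (\<lambda>x. 0)"
    and q: "energy K f f / (LINT x|\<mu>. (f x)\<^sup>2) < c"
    using lt\<mu> unfolding dir_eigval0_def by (auto simp: INF_less_iff)
  interpret prob_space \<mu> using \<mu> by (simp add: borel_probs_iff)
  have fd: "f \<in> H1_dir K ?A" and harm: "harmonic_on K (K - (msupp K \<mu> \<union> ?A)) f"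
    using f by (auto simp: H1_dir_mu_def)
  have fK: "f \<in> H1 K" using fd by (simp add: H1_dir_def)
  have fP: "f \<in> H1 points" by (rule zero_extension(1)[OF K fd])
  have cont: "continuous_map (subtopology gtop K) euclideanreal f" using fK by (simp add: H1_def)
  have "continuous_map gtop euclideanreal (\<lambda>x. \<bar>f x\<bar>)"
    using H1_continuous[OF fP] by (intro continuous_intros)
  then obtain z where z: "z \<in> points" "\<And>x. x \<in> points \<Longrightarrow> \<bar>f x\<bar> \<le> \<bar>f z\<bar>"
    using attains_sup_points by blast
  have fz: "f z \<noteq> 0"
  proof
    assume "f z = 0"
    then have "f x = 0" for x using z(2)[of x] H1_off[OF fP, of x] by (cases "x \<in> points") auto
    then show False using f(2) by blast
  qed
  have sq_le: "(f x)\<^sup>2 \<le> (f z)\<^sup>2" if "x \<in> K" for x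
    using z(2)[of x] that Ksub by (simp add: abs_le_square_iff subset_iff)
  have int: "integrable \<mu> (\<lambda>x. (f x)\<^sup>2)"
  proof (rule borel_probs_integrable[OF \<mu>])
    show "(\<lambda>x. (f x)\<^sup>2) \<in> borel_measurable (borel_of K)"
      using continuous_borel_of[OF cont Ksub] by simp
    show "\<bar>(f x)\<^sup>2\<bar> \<le> (f z)\<^sup>2" if "x \<in> K" for x using sq_le[OF that] by simp
  qed
  define I where "I = (LINT x|\<mu>. (f x)\<^sup>2)"
  have "I \<le> (LINT x|\<mu>. (f z)\<^sup>2)"
    unfolding I_def by (rule integral_mono[OF int]) (auto simp: borel_probs_space[OF \<mu>] sq_le)
  then have I_le: "I \<le> (f z)\<^sup>2" by (simp add: prob_space)
  have I0: "0 \<le> I" unfolding I_def by (rule integral_nonneg_AE) auto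
  have "energy K f f < c * (f z)\<^sup>2"
  \<comment> \<open>For \<open>I = 0\<close> the quotient is 0 by convention and says nothing about
    the energy. Then \<open>f\<close> vanishes on the support and on the boundary, so it is
    admissible in its own harmonicity condition and has energy 0.\<close>
  proof (cases "I = 0")
    case True
    have "f x = 0" if "x \<in> msupp K \<mu>" for x
      by (rule msupp_zero[OF \<mu> Ksub cont int]) (use True that in \<open>auto simp: I_def\<close>)
    then have "\<forall>x\<in>K - (K - (msupp K \<mu> \<union> ?A)). f x = 0"
      using fd by (auto simp: H1_dir_def)
    then have "energy K f f = 0" using harm fK by (auto simp: harmonic_on_def)
    then show ?thesis using c fz by simp
  next
    case False
    then have "energy K f f < c * I" using q I0 by (simp add: I_def[symmetric] pos_divide_less_eq)
    also have "\<dots> \<le> c * (f z)\<^sup>2" using I_le c by simp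
    finally show ?thesis .
  qed
  moreover have "0 < (f z)\<^sup>2" using fz by simp
  ultimately have "energy K f f / (f z)\<^sup>2 < c" by (simp only: pos_divide_less_eq)
  then have "energy K (\<lambda>x. (1 / f z) * f x) (\<lambda>x. (1 / f z) * f x) < c"
    unfolding energy_scale[OF fK] by (simp add: power_divide)
  moreover have "(\<lambda>x. (1 / f z) * f x) \<in> H1_dir K ?A"
    using fd H1_scale[OF fK, of "1 / f z"] by (auto simp: H1_dir_def)
  ultimately show thesis
    using that[of "\<lambda>x. (1 / f z) * f x" z] fz H1_dir_nonzero_interior[OF K fd fz] by simp
qed

lemma ereal_divide_less:
  assumes "ereal (1 / w) * d < ereal c" "0 < w"
  shows "d < ereal (c * w)"
  using assms by (cases d) (auto simp: pos_divide_less_eq)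

lemma partition_energy_ge:
  assumes P: "weighted_partition 2 P"
  shows "ereal (4 * osc_min) \<le> partition_energy P"
proof (rule ccontr)
  assume "\<not> ?thesis"
  then have lt: "partition_energy P < ereal (4 * osc_min)" by simp
  have "length P = 2" using P by (simp add: weighted_partition_def)
  then obtain K1 w1 K2 w2 where P_eq: "P = [(K1, w1), (K2, w2)]"
    by (auto simp: numeral_2_eq_2 length_Suc_conv)
  have K: "closedin gtop K1" "closedin gtop K2" and w: "0 < w1" "0 < w2" "w1 + w2 = 1"
    using P by (auto simp: weighted_partition_def P_eq)
  have disj: "gtop interior_of K1 \<inter> gtop interior_of K2 = {}"
  proof -
    have "\<forall>i<2. \<forall>j<2. i \<noteq> j \<longrightarrow> gtop interior_of fst (P ! i) \<inter> gtop interior_of fst (P ! j) = {}"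
      using P unfolding weighted_partition_def by blast
    from this[rule_format, of 0 1] show ?thesis by (simp add: P_eq)
  qed
  define c where "c = 4 * osc_min"
  have c: "0 < c" using osc_min_pos by (simp add: c_def)
  have "ereal (1 / w1) * dir_eigval0_min K1 (gtop frontier_of K1) < ereal c"
    "ereal (1 / w2) * dir_eigval0_min K2 (gtop frontier_of K2) < ereal c"
    using lt by (auto simp: partition_energy_def P_eq c_def)
  then have d: "dir_eigval0_min K1 (gtop frontier_of K1) < ereal (c * w1)"
    "dir_eigval0_min K2 (gtop frontier_of K2) < ereal (c * w2)"
    using ereal_divide_less w by blast+
  obtain g1 z1 where g1: "g1 \<in> H1_dir K1 (gtop frontier_of K1)" "g1 z1 = 1" "z1 \<in> gtop interior_of K1"
    "energy K1 g1 g1 < c * w1"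
    using cell_test_function[OF K(1) d(1)] c w by auto
  obtain g2 z2 where g2: "g2 \<in> H1_dir K2 (gtop frontier_of K2)" "g2 z2 = 1" "z2 \<in> gtop interior_of K2"
    "energy K2 g2 g2 < c * w2"
    using cell_test_function[OF K(2) d(2)] c w by auto
  have H: "g1 \<in> H1 points" "g2 \<in> H1 points"
    using zero_extension(1)[OF K(1) g1(1)] zero_extension(1)[OF K(2) g2(1)] .
  have cross: "g2 z1 = 0" "g1 z2 = 0"
    using H1_dir_nonzero_interior[OF K(2) g2(1), of z1] H1_dir_nonzero_interior[OF K(1) g1(1), of z2]
      g1(3) g2(3) disj by blast+
  have z: "z1 \<in> points" "z2 \<in> points"
    using g1(3) g2(3) interior_of_subset_topspace[of gtop] by auto
  \<comment> \<open>Among the combinations \<open>a g1 - b g2\<close> with \<open>a + b = 1\<close>,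
    the bound \<open>c * (a\<^sup>2 * w1 + b\<^sup>2 * w2)\<close> is least for the crossed weights
    \<open>a = w2\<close> and \<open>b = w1\<close>, where it equals
    \<open>c * w1 * w2\<close>.\<close>
  define f where "f = (\<lambda>x. w2 * g1 x + (- w1) * g2 x)"
  have f: "f \<in> H1 points" unfolding f_def by (rule H1_linear(1)[OF H])
  have "osc_min * (f z1 - f z2)\<^sup>2 \<le> energy points f f" by (rule osc_min_le[OF f z])
  moreover have "f z1 - f z2 = 1" using w cross g1(2) g2(2) by (simp add: f_def)
  moreover have "energy points f f = w2\<^sup>2 * energy K1 g1 g1 + w1\<^sup>2 * energy K2 g2 g2"
    unfolding f_def energy_linear_square[OF H]
    by (simp add: energy_disjoint_supports[OF K(1) g1(1) K(2) g2(1) disj]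
        energy_zero_extension[OF K(1) g1(1) g1(1)] energy_zero_extension[OF K(2) g2(1) g2(1)])
  ultimately have "osc_min \<le> w2\<^sup>2 * energy K1 g1 g1 + w1\<^sup>2 * energy K2 g2 g2" by simp
  also have "\<dots> < w2\<^sup>2 * (c * w1) + w1\<^sup>2 * (c * w2)"
    using g1(4) g2(4) w by (intro add_strict_mono mult_strict_left_mono) auto
  also have "\<dots> = c * (w1 * w2) * (w1 + w2)" by (simp add: power2_eq_square algebra_simps)
  also have "\<dots> = osc_min * (4 * (w1 * w2))" using w by (simp add: c_def)
  also have "\<dots> \<le> osc_min * 1"
  proof (intro mult_left_mono)
    have "4 * (w1 * w2) = (w1 + w2)\<^sup>2 - (w1 - w2)\<^sup>2" by (simp add: power2_eq_square algebra_simps)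
    then show "4 * (w1 * w2) \<le> 1" using w(3) by simp
  qed (use osc_min_pos in simp)
  finally show False by simp
qed

section \<open>Nodal domains of a minimizer\<close>

lemma cell_of_H1:
  assumes C: "closedin gtop C" and f: "f \<in> H1 points" and f0: "\<And>z. z \<in> gtop frontier_of C \<Longrightarrow> f z = 0"
  defines "h \<equiv> \<lambda>x. if x \<in> C then f x else 0"
  shows "h \<in> H1_dir C (gtop frontier_of C)"
    and "g \<in> H1_dir C (gtop frontier_of C) \<Longrightarrow> energy C h g = energy points f g"
proof -
  have "C \<subseteq> points" using C closedin_subset by fastforce
  then show "h \<in> H1_dir C (gtop frontier_of C)"
    using restrict_H1(1)[OF f] f0 by (auto simp: H1_dir_def h_def)
  show "energy C h g = energy points f g" if "g \<in> H1_dir C (gtop frontier_of C)"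
    unfolding h_def by (rule energy_restrict[OF C f that, symmetric])
qed

lemma openin_positive: "f \<in> H1 points \<Longrightarrow> openin gtop {z \<in> points. 0 < f z}"
  using openin_continuous_map_preimage[OF H1_continuous, of f "{0<..}"] by simp

text \<open>Nonnegativity passes to the closure, and points with positive value are interior because
  they form an open set; on the frontier only the value 0 remains.\<close>

lemma pos_nodal_properties:
  assumes f: "f \<in> H1 points"
  shows "closedin gtop (pos_nodal f)" and "{z \<in> points. 0 < f z} \<subseteq> pos_nodal f"
    and "z \<in> pos_nodal f \<Longrightarrow> 0 \<le> f z"
    and "z \<in> gtop frontier_of (pos_nodal f) \<Longrightarrow> f z = 0"
proof -
  let ?A = "{z \<in> points. 0 < f z}"
  show cl: "closedin gtop (pos_nodal f)" by (simp add: pos_nodal_def)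
  show sub: "?A \<subseteq> pos_nodal f" unfolding pos_nodal_def by (rule closure_of_subset) auto
  have "closedin gtop {z \<in> topspace gtop. f z \<in> {0..}}"
    by (rule closedin_continuous_map_preimage[OF H1_continuous[OF f]]) auto
  moreover have "?A \<subseteq> {z \<in> topspace gtop. f z \<in> {0..}}" by auto
  ultimately have le: "pos_nodal f \<subseteq> {z \<in> topspace gtop. f z \<in> {0..}}"
    unfolding pos_nodal_def by (rule closure_of_minimal[rotated])
  then show nonneg: "0 \<le> f z" if "z \<in> pos_nodal f" for z using that by auto
  assume z: "z \<in> gtop frontier_of (pos_nodal f)"
  then have zN: "z \<in> pos_nodal f" "z \<notin> gtop interior_of (pos_nodal f)"
    using cl by (auto simp: frontier_of_def closure_of_closedin)
  have "?A \<subseteq> gtop interior_of (pos_nodal f)"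
    using interior_of_maximal[OF sub openin_positive[OF f]] .
  then have "\<not> 0 < f z" using zN le by auto
  then show "f z = 0" using nonneg[OF zN(1)] by simp
qed

text \<open>A part \<open>C2\<close> of the nodal domain that avoids \<open>x\<close> carries a test function on which the energy
  of \<open>f\<close> vanishes, so \<open>f\<close> would be constant on it.\<close>

lemma pos_nodal_connected_part:
  assumes f: "f \<in> H1 points" and x: "x \<in> points" "0 < f x" and y: "y \<in> points" "f y < 0"
    and fe: "\<And>g. g \<in> H1 points \<Longrightarrow> energy points f g = a * (g x - g y)"
    and C: "closedin gtop C1" "closedin gtop C2" "pos_nodal f = C1 \<union> C2" "C1 \<inter> C2 = {}" and xC: "x \<in> C1"
  shows "C2 = {}"
proof (rule ccontr)
  assume "C2 \<noteq> {}"
  then obtain z where z: "z \<in> C2" by blast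
  note N = pos_nodal_properties[OF f]
  let ?A = "{z \<in> points. 0 < f z}"
  have o: "openin gtop (points - C1)" using C(1) by (simp add: closedin_def)
  have f0: "f z = 0" if z: "z \<in> gtop frontier_of C2" for z
  proof -
    have zC: "z \<in> C2" "z \<notin> gtop interior_of C2"
      using z C(2) by (auto simp: frontier_of_def closure_of_closedin)
    \<comment> \<open>Near \<open>C2\<close> the nodal domain consists of \<open>C2\<close> alone,
      since \<open>C1\<close> is closed and disjoint from it. Hence points of \<open>C2\<close> with
      positive value are interior to \<open>C2\<close>.\<close>
    have "openin gtop (?A \<inter> (points - C1))" using openin_positive[OF f] o by (rule openin_Int)
    moreover have "?A \<inter> (points - C1) \<subseteq> C2" using N(2) C(3) by blast
    ultimately have "?A \<inter> (points - C1) \<subseteq> gtop interior_of C2" by (rule interior_of_maximal[rotated])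
    moreover have "z \<in> points - C1" using zC C closedin_subset[OF C(2)] by auto
    ultimately have "\<not> 0 < f z" using zC by blast
    then show ?thesis using N(3)[of z] zC C(3) by force
  qed
  define h where "h = (\<lambda>x. if x \<in> C2 then f x else 0)"
  have hd: "h \<in> H1_dir C2 (gtop frontier_of C2)" unfolding h_def by (rule cell_of_H1(1)[OF C(2) f f0])
  have hP: "h \<in> H1 points" by (rule zero_extension(1)[OF C(2) hd])
  have "y \<notin> pos_nodal f" using N(3)[of y] y by auto
  then have hxy: "h x = 0" "h y = 0" using xC C(3,4) by (auto simp: h_def)
  have "energy points h h = energy C2 h h" by (rule energy_zero_extension[OF C(2) hd hd])
  also have "\<dots> = energy points f h" unfolding h_def
    by (rule cell_of_H1(2)[OF C(2) f f0]) (use hd in \<open>auto simp: h_def\<close>)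
  also have "\<dots> = 0" using fe[OF hP] hxy by simp
  finally have h0: "h w = 0" if "w \<in> points" for w
    using energy_zero_imp_constant[OF hP _ that x(1)] hxy by simp
  \<comment> \<open>Every point of the nodal domain is a limit of points with positive value. Near
    \<open>z\<close> these lie in \<open>C2\<close>, where \<open>h\<close> equals \<open>f\<close>
    and yet was shown to vanish.\<close>
  have "z \<in> gtop closure_of ?A" using z C(3) by (auto simp: pos_nodal_def)
  moreover have "z \<in> points - C1" using z C(4) closedin_subset[OF C(2)] by auto
  ultimately obtain p where p: "p \<in> ?A" "p \<in> points - C1" using o unfolding in_closure_of by blast
  then have "p \<in> C2" using N(2) C(3) by blast
  then show False using h0[of p] p by (simp add: h_def)
qed

lemma pos_nodal_connectedin:
  assumes f: "f \<in> H1 points" and x: "x \<in> points" "0 < f x" and y: "y \<in> points" "f y < 0"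
    and fe: "\<And>g. g \<in> H1 points \<Longrightarrow> energy points f g = a * (g x - g y)"
  shows "connectedin gtop (pos_nodal f)"
  unfolding connectedin_closedin
proof (intro conjI notI)
  note N = pos_nodal_properties[OF f]
  show "pos_nodal f \<subseteq> topspace gtop" using closedin_subset[OF N(1)] .
  assume "\<exists>E1 E2. closedin gtop E1 \<and> closedin gtop E2 \<and> pos_nodal f \<subseteq> E1 \<union> E2 \<and>
    E1 \<inter> E2 \<inter> pos_nodal f = {} \<and> E1 \<inter> pos_nodal f \<noteq> {} \<and> E2 \<inter> pos_nodal f \<noteq> {}"
  then obtain E1 E2 where E: "closedin gtop E1" "closedin gtop E2" "pos_nodal f \<subseteq> E1 \<union> E2"
    "E1 \<inter> E2 \<inter> pos_nodal f = {}" "E1 \<inter> pos_nodal f \<noteq> {}" "E2 \<inter> pos_nodal f \<noteq> {}" by blast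
  define C1 where "C1 = E1 \<inter> pos_nodal f"
  define C2 where "C2 = E2 \<inter> pos_nodal f"
  have C: "closedin gtop C1" "closedin gtop C2" "pos_nodal f = C1 \<union> C2" "pos_nodal f = C2 \<union> C1"
    "C1 \<inter> C2 = {}" "C2 \<inter> C1 = {}"
    using E N(1) by (auto simp: C1_def C2_def)
  have "x \<in> C1 \<or> x \<in> C2" using N(2) x C(3) by blast
  then show False
  proof
    assume "x \<in> C1"
    then have "C2 = {}" using pos_nodal_connected_part[OF assms C(1,2,3,5)] by blast
    then show False using E by (simp add: C2_def)
  next
    assume "x \<in> C2"
    then have "C1 = {}" using pos_nodal_connected_part[OF assms C(2,1,4,6)] by blast
    then show False using E by (simp add: C1_def)
  qed
qed

text \<open>The witnesses are the unit mass at \<open>x\<close> and the restriction of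
  \<open>f\<close>. Functions on the nodal domain vanish at \<open>y\<close>, so pairing with the
  restriction sees only the value at \<open>x\<close>: this gives harmonicity off \<open>x\<close>
  and the Rayleigh quotient \<open>a * f x / (f x)\<^sup>2\<close>.\<close>

lemma pos_nodal_dir_eigval0_min:
  assumes f: "f \<in> H1 points" and x: "x \<in> points" "0 < f x" and y: "y \<in> points" "f y < 0"
    and fe: "\<And>g. g \<in> H1 points \<Longrightarrow> energy points f g = a * (g x - g y)"
  shows "dir_eigval0_min (pos_nodal f) (gtop frontier_of (pos_nodal f)) \<le> ereal (a / f x)"
proof -
  note N = pos_nodal_properties[OF f]
  let ?N = "pos_nodal f"
  let ?F = "gtop frontier_of ?N"
  let ?\<mu> = "two_point ?N x x"
  have sub: "?N \<subseteq> points" using closedin_subset[OF N(1)] by simp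
  have xN: "x \<in> ?N" using N(2) x by blast
  have xF: "x \<notin> ?F" using N(4)[of x] x by auto
  have yN: "y \<notin> ?N" using N(3)[of y] y by auto
  have \<mu>: "?\<mu> \<in> borel_probs ?N" by (rule two_point_borel_probs[OF xN xN])
  have F_sub: "?F \<subseteq> ?N" using N(1) by (simp add: frontier_of_def closure_of_closedin)
  have "openin (subtopology gtop ?N) (gtop interior_of ?N)"
    using interior_of_subset[of gtop ?N] by (auto simp: openin_subtopology intro!: exI[of _ "gtop interior_of ?N"])
  from openin_sets_borel_of[OF this] have "space (borel_of ?N) - gtop interior_of ?N \<in> sets (borel_of ?N)"
    by (rule sets.compl_sets)
  moreover have "space (borel_of ?N) - gtop interior_of ?N = ?F"
    using N(1) by (simp add: frontier_of_def closure_of_closedin)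
  ultimately have F_sets: "?F \<in> sets (borel_of ?N)" by simp
  have F_null: "emeasure ?\<mu> ?F = 0"
    using emeasure_two_point[OF xN xN F_sets] xF by simp
  define h where "h = (\<lambda>z. if z \<in> ?N then f z else 0)"
  have hd: "h \<in> H1_dir ?N ?F" unfolding h_def by (rule cell_of_H1(1)[OF N(1) f N(4)])
  have hK: "h \<in> H1 ?N" using hd by (simp add: H1_dir_def)
  have en: "energy ?N h g = a * (g x - g y)" if "g \<in> H1_dir ?N ?F" for g
    using cell_of_H1(2)[OF N(1) f N(4) that] fe[OF zero_extension(1)[OF N(1) that]] by (simp add: h_def)
  have "harmonic_on ?N (?N - (msupp ?N ?\<mu> \<union> ?F)) h"
    unfolding harmonic_on_def
  proof (intro conjI ballI impI hK)
    fix g assume g: "g \<in> H1 ?N" "\<forall>z\<in>?N - (?N - (msupp ?N ?\<mu> \<union> ?F)). g z = 0"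
    have "x \<in> msupp ?N ?\<mu>" using msupp_two_point[OF xN xN] by simp
    then have "g x = 0" using g(2) xN by blast
    moreover have "g y = 0" using H1_off[OF g(1) yN] .
    moreover have "g \<in> H1_dir ?N ?F" using g F_sub by (auto simp: H1_dir_def)
    ultimately show "energy ?N h g = 0" using en by simp
  qed
  then have h_mu: "h \<in> H1_dir_mu ?N ?F ?\<mu>" using hd by (simp add: H1_dir_mu_def)
  have hx: "h x = f x" "h y = 0" using xN yN by (auto simp: h_def)
  then have "h \<noteq> (\<lambda>z. 0)" using x by (metis less_irrefl)
  then have "dir_eigval0 ?N ?F ?\<mu> \<le> ereal (energy ?N h h / (LINT z|?\<mu>. (h z)\<^sup>2))"
    unfolding dir_eigval0_def using h_mu by (intro INF_lower) auto
  moreover have "(LINT z|?\<mu>. (h z)\<^sup>2) = (f x)\<^sup>2"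
  proof -
    have "(\<lambda>z. (h z)\<^sup>2) \<in> borel_measurable (borel_of ?N)"
      using continuous_borel_of[of ?N h] hK sub by (simp add: H1_def)
    from integral_two_point[OF xN xN this] show ?thesis using hx by simp
  qed
  moreover have "energy ?N h h = a * f x" using en[OF hd] hx by simp
  ultimately have "dir_eigval0 ?N ?F ?\<mu> \<le> ereal (a / f x)"
    using x by (simp add: power2_eq_square)
  then show ?thesis
    unfolding dir_eigval0_min_def using \<mu> F_null by (intro INF_lower2[of ?\<mu>]) auto
qed

lemma neg_nodal_eq: "neg_nodal f = pos_nodal (\<lambda>x. - f x)"
  by (simp add: neg_nodal_def pos_nodal_def)

text \<open>Exchanging \<open>x\<close> and \<open>y\<close> turns the identity for \<open>f\<close>
  into that for \<open>- f\<close>, so one argument serves both domains. Each cell value is at most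
  \<open>2 * osc_min\<close>, the weights double it, and the lower bound for all partitions turns
  the estimate into an equality.\<close>

lemma nodal_partition:
  assumes f: "f \<in> H1 points" and x: "x \<in> points" "0 < f x" and y: "y \<in> points" "f y = - f x"
    and eq: "energy points f f = osc_min * (f x - f y)\<^sup>2"
  shows "weighted_partition 2 [(pos_nodal f, 1 / 2), (neg_nodal f, 1 / 2)]"
    and "partition_energy [(pos_nodal f, 1 / 2), (neg_nodal f, 1 / 2)] = ereal (4 * osc_min)"
proof -
  \<comment> \<open>This is \<open>osc_min * (f x - f y)\<close>, the factor in
    \<open>osc_minimizer_energy\<close>, for opposite extreme values.\<close>
  define a where "a = 2 * osc_min * f x"
  define g where "g = (\<lambda>x. - f x)"
  have g: "g \<in> H1 points" using H1_scale[OF f, of "- 1"] by (simp add: g_def)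
  have fe: "energy points f k = a * (k x - k y)" if "k \<in> H1 points" for k
    using osc_minimizer_energy[OF f x(1) y(1) eq that] y(2) by (simp add: a_def)
  have ge: "energy points g k = a * (k y - k x)" if "k \<in> H1 points" for k
    using energy_linear_left[OF f f that, of "- 1" 0] fe[OF that] by (simp add: g_def algebra_simps)
  have sgn: "f y < 0" "0 < g y" "g x < 0" using x y by (auto simp: g_def)
  note Nf = pos_nodal_properties[OF f] and Ng = pos_nodal_properties[OF g]
  have neg: "neg_nodal f = pos_nodal g" by (simp add: neg_nodal_eq g_def)
  have conn: "connectedin gtop (pos_nodal f)" "connectedin gtop (pos_nodal g)"
    using pos_nodal_connectedin[OF f x y(1) sgn(1) fe] pos_nodal_connectedin[OF g y(1) sgn(2) x(1) sgn(3) ge]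
    by auto
  have ne: "pos_nodal f \<noteq> {}" "pos_nodal g \<noteq> {}" using Nf(2) Ng(2) x y sgn by blast+
  have disj: "gtop interior_of pos_nodal f \<inter> gtop interior_of pos_nodal g = {}"
  proof (rule ccontr)
    assume "\<not> ?thesis"
    then obtain z where z: "z \<in> gtop interior_of pos_nodal f" "z \<in> gtop interior_of pos_nodal g" by blast
    \<comment> \<open>A common interior point would be a limit of points with \<open>f\<close> < 0,
      some of them inside the positive nodal domain, where \<open>f\<close> \<ge> 0.\<close>
    then have "z \<in> gtop closure_of {z \<in> points. 0 < g z}"
      using interior_of_subset[of gtop "pos_nodal g"] by (auto simp: pos_nodal_def)
    then obtain p where "p \<in> gtop interior_of pos_nodal f" "0 < g p"
      using z(1) openin_interior_of[of gtop "pos_nodal f"] unfolding in_closure_of by blast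
    then show False using Nf(3)[of p] interior_of_subset[of gtop "pos_nodal f"] by (auto simp: g_def)
  qed
  show wp: "weighted_partition 2 [(pos_nodal f, 1 / 2), (neg_nodal f, 1 / 2)]"
    unfolding weighted_partition_def neg
    using Nf(1) Ng(1) conn ne disj by (auto simp: less_2_cases_iff)
  have "dir_eigval0_min (pos_nodal f) (gtop frontier_of pos_nodal f) \<le> ereal (2 * osc_min)"
    using pos_nodal_dir_eigval0_min[OF f x y(1) sgn(1) fe] x by (simp add: a_def)
  moreover have "dir_eigval0_min (pos_nodal g) (gtop frontier_of pos_nodal g) \<le> ereal (2 * osc_min)"
    using pos_nodal_dir_eigval0_min[OF g y(1) sgn(2) x(1) sgn(3) ge] x y by (simp add: a_def g_def)
  ultimately have "partition_energy [(pos_nodal f, 1 / 2), (neg_nodal f, 1 / 2)] \<le> ereal 2 * ereal (2 * osc_min)"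
    unfolding partition_energy_def neg by (auto intro: ereal_mult_left_mono simp del: times_ereal.simps)
  then show "partition_energy [(pos_nodal f, 1 / 2), (neg_nodal f, 1 / 2)] = ereal (4 * osc_min)"
    using partition_energy_ge[OF wp] by (intro antisym) auto
qed

lemma min_partition_energy_2: "min_partition_energy 2 = ereal (4 * osc_min)"
proof (rule antisym)
  obtain f x y where f: "f \<in> H1 points" and xy: "x \<in> points" "y \<in> points" and fxy: "f x = 1" "f y = - 1"
    and fe: "\<forall>g\<in>H1 points. energy points f g = 2 * osc_min * (g x - g y)"
    using centered_osc_minimizer .
  have "energy points f f = osc_min * (f x - f y)\<^sup>2" using fe f fxy by simp
  note P = nodal_partition[OF f xy(1) _ xy(2) _ this]
  show "min_partition_energy 2 \<le> ereal (4 * osc_min)"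
    unfolding min_partition_energy_def using P fxy by (intro INF_lower2[of "[(pos_nodal f, 1 / 2), (neg_nodal f, 1 / 2)]"]) auto
  show "ereal (4 * osc_min) \<le> min_partition_energy 2"
    unfolding min_partition_energy_def by (rule INF_greatest) (use partition_energy_ge in auto)
qed

end

theorem theorem5p15:
  fixes G :: "('v, 'e) pre_digraph" and len :: "'e \<Rightarrow> real"
  assumes "metric_graph G len"
  shows "metric_graph.min_partition_energy G len 2 = metric_graph.eigval_min G len 1 \<and>
    (\<forall>\<mu> \<kappa> f.
       \<mu> \<in> metric_graph.borel_probs G len (metric_graph.points G len) \<longrightarrow>
       metric_graph.eigval G len \<mu> 1 = metric_graph.eigval_min G len 1 \<longrightarrow>
       ereal \<kappa> = metric_graph.eigval G len \<mu> 1 \<longrightarrow>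
       metric_graph.eigenfunction G len \<mu> \<kappa> f \<longrightarrow>
       metric_graph.weighted_partition G len 2
         [(metric_graph.pos_nodal G len f, 1/2), (metric_graph.neg_nodal G len f, 1/2)] \<and>
       metric_graph.partition_energy G len
         [(metric_graph.pos_nodal G len f, 1/2), (metric_graph.neg_nodal G len f, 1/2)] =
       metric_graph.min_partition_energy G len 2)"
proof -
  interpret metric_graph G len by (rule assms)
  show ?thesis
  proof (intro conjI allI impI)
    show "min_partition_energy 2 = eigval_min 1"
      by (simp only: min_partition_energy_2 eigval_min_1)
    fix \<mu> \<kappa> f
    assume \<mu>: "\<mu> \<in> borel_probs points" and min: "eigval \<mu> 1 = eigval_min 1" "ereal \<kappa> = eigval \<mu> 1"
      and f: "eigenfunction \<mu> \<kappa> f"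
    have "ereal \<kappa> = ereal (4 * osc_min)" using min unfolding eigval_min_1 by simp
    then have "\<kappa> = 4 * osc_min" by simp
    then obtain x y where "x \<in> points" "y \<in> points" "f \<in> H1 points" "0 < f x" "f y = - f x"
      "energy points f f = osc_min * (f x - f y)\<^sup>2"
      using minimal_eigenfunction[OF \<mu>] f by blast
    from nodal_partition[OF this(3,1,4,2,5,6)]
    show "weighted_partition 2 [(pos_nodal f, 1/2), (neg_nodal f, 1/2)]"
      and "partition_energy [(pos_nodal f, 1/2), (neg_nodal f, 1/2)] = min_partition_energy 2"
      by (simp_all only: min_partition_energy_2)
  qed
qed

end
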